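(* For $F=B_\Delta S^{-1}B_\Delta^T$, we have $$\underline C_F\,\lambda^T\lambda\lesssim\lambda^TF\lambda\lesssim\overline C_F\,\lambda^T\lambda\qquad\text{for all Lagrange multiplier vectors }\lambda,$$ where $\underline C_F=h^{2-d}$ for $d=2,3$, and $$\overline C_F=\begin{cases}\left(\frac Hh\right)\left(1+\ln\frac Hh\right)&\text{for }d=2,\\ h^{-1}\left(\frac Hh\right)^2&\text{for }d=3.\end{cases}$$ Consequently, the condition number $\kappa(F)$ of $F$ satisfies $$\kappa(F)\lesssim\begin{cases}\left(\frac Hh\right)\left(1+\ln\frac Hh\right)&\text{for }d=2,\\ \left(\frac Hh\right)^2&\text{for }d=3.\end{cases}$$
   Context: Setting. $\Omega\subset\mathbb R^d$ ($d=2,3$) is a bounded polygonal (polyhedral) domain, decomposed into nonoverlapping polygonal (polyhedral) Lipschitz subdomains $\Omega_1,\dots,\Omega_{N_s}$ of diameter comparable to $H$. Each $\Omega_j$ is a union of a uniformly bounded number of elements of a conforming, shape-regular, quasi-uniform coarse mesh $\mathcal T_H$ of $\Omega$ of mesh size $H$. The vertices of the subdomains (also called corners) are the vertices of $\mathcal T_H$. Each $\Omega_j$ carries a shape-regular quasi-uniform triangulation of mesh size $h$, and the triangulations match across the interface $\Gamma$, the union of the common boundaries $\Gamma_{jk}=\partial\Omega_j\cap\partial\Omega_k$ of neighbouring subdomains. Spaces. $X_h^j$ is the conforming $\mathbb P_1$ finite element space on $\Omega_j$. $X_h^c$ is the space of functions $v$ on $\Omega$ with $v|_{\Omega_j}\in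 X_h^j$ for all $j$ that vanish on $\partial\Omega$ and are continuous at the subdomain vertices; at the other interface nodes they may be discontinuous across $\Gamma$. The bilinear form is $\tilde a(u,v)=\sum_{j=1}^{N_s}\int_{\Omega_j}\nabla u\cdot\nabla v\,dx$. Decomposition. Every $v\in X_h^c$ is written uniquely as $v=v_I+v_\Delta+v_c$, where, in terms of the nodal basis, $v_I$ is the part associated with nodes interior to the subdomains, $v_\Delta$ the part associated with the nodes on $\Gamma$ (not on $\partial\Omega$) other than subdomain vertices (with separate values from each adjacent subdomain), and $v_c$ the part associated with the subdomain vertices not on $\partial\Omega$ (one value per vertex). The vector of nodal values of $v_\Delta$ is denoted $\bm v_\Delta$, and $\bm v_\Delta^{(j)}$ is its part from $\Omega_j$. Given $v_\Delta$, the discrete $\tilde a$-harmonic extension $\mathcal H^c(v_\Delta)\in X_h^c$ is the unique function with $\Delta$-part $v_\Delta$ such that $\tilde a(\mathcal H^c(v_\Delta),z)=0$ for all $z\in X_h^c$ with $z_\Delta=0$. Matrices. $S$ is the symmetric positive definite Schur complement of the stiffness matrix of $\tilde a$ on $X_h^c$ obtained by eliminating the interior and corner unknowns, i.e. $\bm v_\Delta^TS\bm v_\Delta=\tilde a(\mathcal H^c(v_\Delta),\mathcal H^c(v_\Delta))$ for all $\bm v_\Delta$. $B_\Delta$ is the signed Boolean matrix (entries $0,\pm1$) which takes the jumps of $\bm v_\Delta$ across the interface: $B_\Delta\bm v_\Delta$ collects the differences $\bm v_\Delta^{(j)}|_{\Gamma_{jk}}-\bm v_\Delta^{(k)}|_{\Gamma_{jk}}$,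 $j<k$. $F$ is the standard unpreconditioned FETI-DP dual operator. The Lagrange multiplier vectors $\lambda$ range over the range of $B_\Delta$ (which is the full space when the constraints are non-redundant, i.e. $B_\Delta$ has full row rank), and $\kappa(F)$ is the ratio of the largest to the smallest eigenvalue of $F$ on that space. Convention. $A\lesssim B$ means $A\le CB$ with a constant $C>0$ independent of $h$ and $H$ (it may depend on $\Omega$, $d$ and the regularity constants of the meshes). *)

theory Defs
  imports "HOL-Analysis.Analysis" "Jordan_Normal_Form.Gauss_Jordan_Elimination"
    "Jordan_Normal_Form.Char_Poly"
begin

section \<open>Domains and meshes\<close>

text \<open>The condition \<open>D = interior (closure D)\<close> excludes slits and punctures: \<open>D\<close> is the interior
  of a polyhedron, which need be neither convex nor simply connected.\<close>

definition polyhedral_domain :: "'a::euclidean_space set \<Rightarrow> bool" where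
  "polyhedral_domain D \<longleftrightarrow>
     open D \<and> connected D \<and> bounded D \<and> D \<noteq> {} \<and> D = interior (closure D) \<and>
     (\<exists>\<P>. finite \<P> \<and> (\<forall>P\<in>\<P>. polytope P) \<and> closure D = \<Union>\<P>)"

text \<open>Near each boundary point, \<open>D\<close> is the part above the graph of a Lipschitz function \<open>g\<close> of the
  coordinates orthogonal to a unit vector \<open>e\<close>.\<close>

definition lipschitz_domain :: "'a::euclidean_space set \<Rightarrow> bool" where
  "lipschitz_domain D \<longleftrightarrow>
     open D \<and>
     (\<forall>x\<in>frontier D. \<exists>r>0. \<exists>e L g. norm e = 1 \<and> L-lipschitz_on UNIV g \<and>
        D \<inter> ball x r = {y \<in> ball x r. g (y - inner y e *\<^sub>R e) < inner y e})"

text \<open>Face-to-face meshes of full-dimensional convex polytopes; this covers simplicial as well as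
  quadrilateral and hexahedral meshes.\<close>

definition conforming_mesh :: "'a::euclidean_space set set \<Rightarrow> bool" where
  "conforming_mesh \<T> \<longleftrightarrow>
     finite \<T> \<and> (\<forall>K\<in>\<T>. polytope K \<and> interior K \<noteq> {}) \<and>
     (\<forall>K\<in>\<T>. \<forall>K'\<in>\<T>. K \<inter> K' face_of K \<and> K \<inter> K' face_of K')"

definition shape_regular :: "real \<Rightarrow> 'a::euclidean_space set set \<Rightarrow> bool" where
  "shape_regular \<sigma> \<T> \<longleftrightarrow> (\<forall>K\<in>\<T>. \<exists>x \<rho>. 0 < \<rho> \<and> cball x \<rho> \<subseteq> K \<and> diameter K \<le> \<sigma> * \<rho>)"

definition quasi_uniform :: "real \<Rightarrow> real \<Rightarrow> 'a::euclidean_space set set \<Rightarrow> bool" where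
  "quasi_uniform \<tau> h \<T> \<longleftrightarrow> (\<forall>K\<in>\<T>. diameter K \<le> h \<and> h \<le> \<tau> * diameter K)"

definition mesh_vertices :: "'a::euclidean_space set set \<Rightarrow> 'a set" where
  "mesh_vertices \<T> = {p. \<exists>K\<in>\<T>. p extreme_point_of K}"


section \<open>Domain decompositions\<close>

text \<open>The subdomains are \<open>subdomain P j\<close> for \<open>j < nsub P\<close>, and \<open>fine_mesh P j\<close> is the triangulation of
  \<open>subdomain P j\<close>.\<close>

record 'a decomposition =
  dom\<Omega> :: "'a set"
  coarse_mesh :: "'a set set"
  nsub :: nat
  subdomain :: "nat \<Rightarrow> 'a set"
  fine_mesh :: "nat \<Rightarrow> 'a set set"

definition interface :: "'a::euclidean_space decomposition \<Rightarrow> 'a set" where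
  "interface P = (\<Union>j<nsub P. \<Union>k\<in>{..<nsub P} - {j}. frontier (subdomain P j) \<inter> frontier (subdomain P k))"

text \<open>Subdomain vertices are the coarse mesh vertices on the subdomain boundaries (a coarse vertex
  in the interior of a subdomain is an ordinary interior point).\<close>

definition corners :: "'a::euclidean_space decomposition \<Rightarrow> 'a set" where
  "corners P = mesh_vertices (coarse_mesh P) \<inter> (\<Union>j<nsub P. frontier (subdomain P j))"

text \<open>The regularity constants are \<open>\<sigma>\<close> (shape regularity), \<open>\<tau>\<close> (quasi-uniformity and
  comparability of the subdomain diameters with \<open>H\<close>) and \<open>M\<close> (number of coarse elements per
  subdomain). That the triangulations match across the interface is expressed by requiring their
  union to be a triangulation, i.e. face-to-face.\<close>

definition admissible_decomposition ::
    "real \<Rightarrow> real \<Rightarrow> nat \<Rightarrow> real \<Rightarrow> real \<Rightarrow> 'a::euclidean_space decomposition \<Rightarrow> bool" where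
  "admissible_decomposition \<sigma> \<tau> M H h P \<longleftrightarrow>
     0 < h \<and> h \<le> H \<and>
     polyhedral_domain (dom\<Omega> P) \<and>
     conforming_mesh (coarse_mesh P) \<and> \<Union>(coarse_mesh P) = closure (dom\<Omega> P) \<and>
     shape_regular \<sigma> (coarse_mesh P) \<and> quasi_uniform \<tau> H (coarse_mesh P) \<and>
     (\<forall>j<nsub P. polyhedral_domain (subdomain P j) \<and> lipschitz_domain (subdomain P j) \<and>
        subdomain P j \<subseteq> dom\<Omega> P \<and>
        H \<le> \<tau> * diameter (subdomain P j) \<and> diameter (subdomain P j) \<le> \<tau> * H \<and>
        (\<exists>\<K>. \<K> \<subseteq> coarse_mesh P \<and> card \<K> \<le> M \<and> closure (subdomain P j) = \<Union>\<K>)) \<and>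
     (\<forall>j<nsub P. \<forall>k<nsub P. j \<noteq> k \<longrightarrow> subdomain P j \<inter> subdomain P k = {}) \<and>
     closure (dom\<Omega> P) = (\<Union>j<nsub P. closure (subdomain P j)) \<and>
     triangulation (\<Union>j<nsub P. fine_mesh P j) \<and>
     (\<forall>j<nsub P. (\<forall>K\<in>fine_mesh P j. int DIM('a) simplex K) \<and>
        \<Union>(fine_mesh P j) = closure (subdomain P j) \<and>
        shape_regular \<sigma> (fine_mesh P j) \<and> quasi_uniform \<tau> h (fine_mesh P j) \<and>
        corners P \<inter> frontier (subdomain P j) \<subseteq> mesh_vertices (fine_mesh P j))"


section \<open>Finite element spaces and the broken bilinear form\<close>

text \<open>Functions are normalised to be \<open>0\<close> outside the closed subdomain, so that they are
  determined by their nodal values.\<close>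

definition P1_space :: "'a::euclidean_space set set \<Rightarrow> 'a set \<Rightarrow> ('a \<Rightarrow> real) set" where
  "P1_space \<T> D = {v. continuous_on (closure D) v \<and>
     (\<forall>K\<in>\<T>. \<exists>a b. \<forall>x\<in>K. v x = inner a x + b) \<and> (\<forall>x. x \<notin> closure D \<longrightarrow> v x = 0)}"

text \<open>As functions in this space may be discontinuous across the interface, they are represented by
  the family of their restrictions \<open>v j\<close> to the closed subdomains.\<close>

definition Xc_space :: "'a::euclidean_space decomposition \<Rightarrow> (nat \<Rightarrow> 'a \<Rightarrow> real) set" where
  "Xc_space P = {v. (\<forall>j<nsub P. v j \<in> P1_space (fine_mesh P j) (subdomain P j)) \<and>
     (\<forall>j\<ge>nsub P. v j = (\<lambda>_. 0)) \<and>
     (\<forall>j<nsub P. \<forall>x\<in>frontier (dom\<Omega> P) \<inter> closure (subdomain P j). v j x = 0) \<and>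
     (\<forall>p\<in>corners P. \<forall>j<nsub P. \<forall>k<nsub P.
        p \<in> closure (subdomain P j) \<inter> closure (subdomain P k) \<longrightarrow> v j p = v k p)}"

text \<open>A piecewise affine function has a classical gradient in the interior of each element; the value
  on the element boundaries, a null set, is irrelevant.\<close>

definition grad :: "('a::euclidean_space \<Rightarrow> real) \<Rightarrow> 'a \<Rightarrow> 'a" where
  "grad f x = (THE g. GDERIV f x :> g)"

definition broken_form ::
    "'a::euclidean_space decomposition \<Rightarrow> (nat \<Rightarrow> 'a \<Rightarrow> real) \<Rightarrow> (nat \<Rightarrow> 'a \<Rightarrow> real) \<Rightarrow> real" where
  "broken_form P u v =
     (\<Sum>j<nsub P. set_lebesgue_integral lebesgue (subdomain P j)
                   (\<lambda>x. inner (grad (u j) x) (grad (v j) x)))"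


section \<open>Degrees of freedom and the stiffness matrix\<close>

text \<open>\<open>Local j p\<close> is the value at node \<open>p\<close> seen from subdomain \<open>j\<close>; \<open>Corner p\<close> is the single value
  shared by all subdomains adjacent to the corner \<open>p\<close>.\<close>

datatype 'a dof = Local nat 'a | Corner 'a

definition interior_dofs :: "'a::euclidean_space decomposition \<Rightarrow> 'a dof set" where
  "interior_dofs P = {Local j p | j p. j < nsub P \<and> p \<in> mesh_vertices (fine_mesh P j) \<inter> subdomain P j}"

definition corner_dofs :: "'a::euclidean_space decomposition \<Rightarrow> 'a dof set" where
  "corner_dofs P = {Corner p | p. p \<in> corners P - frontier (dom\<Omega> P)}"

definition dual_dofs :: "'a::euclidean_space decomposition \<Rightarrow> 'a dof set" where
  "dual_dofs P = {Local j p | j p. j < nsub P \<and>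
     p \<in> mesh_vertices (fine_mesh P j) \<inter> interface P - frontier (dom\<Omega> P) - corners P}"

fun carries :: "'a dof \<Rightarrow> nat \<Rightarrow> 'a \<Rightarrow> bool" where
  "carries (Local i p) j q \<longleftrightarrow> i = j \<and> p = q"
| "carries (Corner p) j q \<longleftrightarrow> p = q"

definition nodal_basis :: "'a::euclidean_space decomposition \<Rightarrow> 'a dof \<Rightarrow> nat \<Rightarrow> 'a \<Rightarrow> real" where
  "nodal_basis P a = (THE \<phi>. \<phi> \<in> Xc_space P \<and>
     (\<forall>j<nsub P. \<forall>q\<in>mesh_vertices (fine_mesh P j). \<phi> j q = (if carries a j q then 1 else 0)))"

definition stiffness_block ::
    "'a::euclidean_space decomposition \<Rightarrow> 'a dof list \<Rightarrow> 'a dof list \<Rightarrow> real Matrix.mat" where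
  "stiffness_block P as bs = Matrix.mat (length as) (length bs)
     (\<lambda>(i, k). broken_form P (nodal_basis P (as ! i)) (nodal_basis P (bs ! k)))"


section \<open>The FETI-DP dual operator\<close>

abbreviation mat_inv :: "real Matrix.mat \<Rightarrow> real Matrix.mat" where
  "mat_inv A \<equiv> the (mat_inverse A)"

text \<open>In the following, \<open>rs\<close> enumerates the interior and corner unknowns, which are eliminated,
  \<open>ds\<close> the dual unknowns, and \<open>js\<close> the jump constraints.\<close>

definition schur_matrix ::
    "'a::euclidean_space decomposition \<Rightarrow> 'a dof list \<Rightarrow> 'a dof list \<Rightarrow> real Matrix.mat" where
  "schur_matrix P rs ds = stiffness_block P ds ds -
     stiffness_block P ds rs * mat_inv (stiffness_block P rs rs) * stiffness_block P rs ds"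

text \<open>A triple \<open>(j, k, p)\<close> stands for the jump between the values at the node \<open>p\<close> on the common
  boundary of the subdomains \<open>j < k\<close>.\<close>

definition interface_jumps :: "'a::euclidean_space decomposition \<Rightarrow> (nat \<times> nat \<times> 'a) set" where
  "interface_jumps P = {(j, k, p). j < k \<and> k < nsub P \<and>
     p \<in> frontier (subdomain P j) \<inter> frontier (subdomain P k) \<and>
     Local j p \<in> dual_dofs P \<and> Local k p \<in> dual_dofs P}"

text \<open>Redundant and non-redundant constraints are both covered: one may impose all jumps, or any
  subset of them which still forces all jumps to vanish.\<close>

definition jump_constraints ::
    "'a::euclidean_space decomposition \<Rightarrow> (nat \<times> nat \<times> 'a) set \<Rightarrow> bool" where
  "jump_constraints P J \<longleftrightarrow> J \<subseteq> interface_jumps P \<and>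
     (\<forall>w :: nat \<Rightarrow> 'a \<Rightarrow> real. (\<forall>(j, k, p)\<in>J. w j p = w k p) \<longrightarrow>
        (\<forall>(j, k, p)\<in>interface_jumps P. w j p = w k p))"

definition jump_matrix :: "(nat \<times> nat \<times> 'a) list \<Rightarrow> 'a dof list \<Rightarrow> real Matrix.mat" where
  "jump_matrix js ds = Matrix.mat (length js) (length ds)
     (\<lambda>(i, a). case js ! i of (j, k, p) \<Rightarrow>
        if ds ! a = Local j p then 1 else if ds ! a = Local k p then - 1 else 0)"

definition fetidp_matrix :: "'a::euclidean_space decomposition \<Rightarrow>
    'a dof list \<Rightarrow> 'a dof list \<Rightarrow> (nat \<times> nat \<times> 'a) list \<Rightarrow> real Matrix.mat" where
  "fetidp_matrix P rs ds js =
     jump_matrix js ds * mat_inv (schur_matrix P rs ds) * transpose_mat (jump_matrix js ds)"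

definition multipliers :: "(nat \<times> nat \<times> 'a) list \<Rightarrow> 'a dof list \<Rightarrow> real Matrix.vec set" where
  "multipliers js ds = {jump_matrix js ds *\<^sub>v w | w. w \<in> carrier_vec (length ds)}"

definition eigenvalues_on :: "real Matrix.vec set \<Rightarrow> real Matrix.mat \<Rightarrow> real set" where
  "eigenvalues_on V A = {\<mu>. \<exists>x\<in>V. eigenvector A x \<mu>}"

definition condition_number_on :: "real Matrix.vec set \<Rightarrow> real Matrix.mat \<Rightarrow> real" where
  "condition_number_on V A = Max (eigenvalues_on V A) / Min (eigenvalues_on V A)"

definition C_lower :: "nat \<Rightarrow> real \<Rightarrow> real" where
  "C_lower d h = h powi (2 - int d)"

text \<open>Only \<open>d = 2\<close> and \<open>d = 3\<close> are meaningful here and in \<open>kappa_bound\<close>.\<close>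

definition C_upper :: "nat \<Rightarrow> real \<Rightarrow> real \<Rightarrow> real" where
  "C_upper d H h = (if d = 2 then H / h * (1 + ln (H / h)) else inverse h * (H / h)\<^sup>2)"

definition kappa_bound :: "nat \<Rightarrow> real \<Rightarrow> real \<Rightarrow> real" where
  "kappa_bound d H h = (if d = 2 then H / h * (1 + ln (H / h)) else (H / h)\<^sup>2)"

end

theory Submission
  imports Defs
begin

text \<open>Let \<open>F = B S\<inverse> B\<^sup>T\<close>. By Cauchy-Schwarz, bounds for \<open>F\<close> on the range of \<open>B\<close> follow from three
  inequalities (\<open>dual_operator_bounds\<close>): the jump estimate \<open>\<bar>B u\<bar>\<^sup>2 \<le> K u\<^sup>T S u\<close> gives \<open>l\<^sup>T F l \<le> K \<bar>l\<bar>\<^sup>2\<close>, while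
  \<open>u\<^sup>T S u \<le> c \<bar>u\<bar>\<^sup>2\<close> and \<open>\<bar>l\<bar>\<^sup>2 \<le> D \<bar>B\<^sup>T l\<bar>\<^sup>2\<close> on the range of \<open>B\<close> give \<open>\<bar>l\<bar>\<^sup>2 \<le> D c l\<^sup>T F l\<close>. The eigenvalues of \<open>F\<close> on the multipliers lie
  between these bounds, which yields the condition number. As \<open>u\<^sup>T S u\<close> is the energy of the discrete harmonic
  extension (\<open>schur_energy\<close>), the inequalities are statements about finite element functions.

  The constant \<open>c\<close>, of order \<open>h\<close> to the power \<open>d - 2\<close> with \<open>d = DIM('a)\<close>, comes from the inverse inequality (\<open>inverse_estimate\<close>).
  The constant \<open>D\<close> depends only on the number of subdomains that meet at a node, because the jump
  constraints decouple into one connected graph for each node (\<open>jump_graph_bound\<close>).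

  The jump estimate (\<open>jump_energy_bound\<close>) is the core. Suppose that the subdomains \<open>j\<close> and \<open>k\<close> meet at the node
  \<open>p\<close>. On either side there is a coarse element at \<open>p\<close>, these two elements share a face, and a vertex \<open>c\<close> of that
  face is a corner of both subdomains (\<open>common_corner\<close>), where both sides have the same value. So the jump at
  \<open>p\<close> is the difference of \<open>v\<^sub>j(p) - v\<^sub>j(c)\<close> and \<open>v\<^sub>k(p) - v\<^sub>k(c)\<close>, and each of these compares the values of one function
  at two boundary points of one convex coarse element. The discrete Sobolev inequality
  (\<open>discrete_sobolev_difference\<close>, \<open>pointwise_estimate\<close>) bounds the square by the energy times \<open>1 + ln (H / h)\<close>
  for \<open>d = 2\<close> and times \<open>1 / h\<close> for \<open>d = 3\<close>. The boundary of a coarse element carries at most a multiple of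
  \<open>H / h\<close> to the power \<open>d - 1\<close> nodes (\<open>card_nodes_on_coarse_boundary\<close>), and the product is the upper bound.

  For the Sobolev inequality, both points are joined by segments to the points \<open>y\<close> of a ball inside the
  coarse element. Cauchy-Schwarz along a segment with the weight \<open>t\<close> to the power \<open>d - 1\<close> leaves the integral of
  the reciprocal weight over \<open>t \<ge> h / H\<close>, which is \<open>ln (H / h)\<close> or \<open>H / h - 1\<close>, times a weighted line integral of
  the squared gradient, whose average over \<open>y\<close> is bounded by the energy (polar coordinates,
  \<open>nn_integral_ray_weight_le\<close>). The remaining part, of length at most \<open>h\<close>, is covered by the inverse inequality.

  Finally, \<open>S\<close> is invertible because a function of zero energy vanishes (\<open>zero_energy_imp_zero\<close>), and the nodal
  basis exists because affine interpolation is continuous on a conforming mesh and vanishes on the boundary of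
  the domain if the boundary vertices carry the value zero (\<open>vanishes_on_frontier\<close>).\<close>

section \<open>Positive definite matrices and the dual operator\<close>

text \<open>Every Cauchy-Schwarz inequality for matrices below comes from this discriminant condition.\<close>

lemma quadratic_nonneg_discriminant:
  fixes a b c :: real
  assumes "\<And>t. 0 \<le> a + 2 * t * b + t\<^sup>2 * c"
  shows "b\<^sup>2 \<le> a * c"
proof (cases "c = 0")
  case True
  have "b = 0"
  proof (rule ccontr)
    assume "b \<noteq> 0"
    then show False using assms[of "- (a + 1) / (2 * b)"] True by (simp add: field_simps)
  qed
  then show ?thesis using True by simp
next
  case False
  have "0 \<le> a" using assms[of 0] by simp
  have "0 \<le> c"
  proof (rule ccontr)
    assume "\<not> 0 \<le> c"
    define k where "k = - c"
    have k: "k > 0" unfolding k_def using \<open>\<not> 0 \<le> c\<close> by simp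
    define t where "t = (a + 1 + 2 * \<bar>b\<bar>) / k + 1"
    have t: "t \<ge> 1" "t * (- c) \<ge> a + 1 + 2 * \<bar>b\<bar>"
    proof -
      show "t \<ge> 1" unfolding t_def using k \<open>0 \<le> a\<close> by simp
      have "t * k = a + 1 + 2 * \<bar>b\<bar> + k" unfolding t_def distrib_right using k by simp
      then show "t * (- c) \<ge> a + 1 + 2 * \<bar>b\<bar>" using k unfolding k_def by simp
    qed
    have "t * (t * (- c)) \<ge> t * (a + 1 + 2 * \<bar>b\<bar>)" using t by (intro mult_left_mono) auto
    moreover have "t * (a + 1 + 2 * \<bar>b\<bar>) \<ge> 1 * (a + 1) + t * (2 * \<bar>b\<bar>)"
    proof -
      have "t * (a + 1) \<ge> 1 * (a + 1)" using t \<open>0 \<le> a\<close> by (intro mult_right_mono) auto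
      then show ?thesis by (simp add: algebra_simps)
    qed
    moreover have "t * (2 * b) \<le> t * (2 * \<bar>b\<bar>)" using t by (intro mult_left_mono) auto
    ultimately show False using assms[of t] by (simp add: power2_eq_square algebra_simps)
  qed
  then have "c > 0" using False by simp
  then have "0 \<le> c * (a + 2 * (- b / c) * b + (- b / c)\<^sup>2 * c)"
    using assms[of "- b / c"] by (intro mult_nonneg_nonneg) auto
  also have "\<dots> = a * c - b\<^sup>2" using \<open>c > 0\<close> by (simp add: field_simps power2_eq_square)
  finally show ?thesis by simp
qed

abbreviation qform :: "real Matrix.mat \<Rightarrow> real Matrix.vec \<Rightarrow> real Matrix.vec \<Rightarrow> real" where
  "qform A x y \<equiv> scalar_prod x (A *\<^sub>v y)"

definition psd_mat :: "nat \<Rightarrow> real Matrix.mat \<Rightarrow> bool" where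
  "psd_mat n A \<longleftrightarrow> A \<in> carrier_mat n n \<and> transpose_mat A = A \<and> (\<forall>x\<in>carrier_vec n. 0 \<le> qform A x x)"

definition pd_mat :: "nat \<Rightarrow> real Matrix.mat \<Rightarrow> bool" where
  "pd_mat n A \<longleftrightarrow> psd_mat n A \<and> (\<forall>x\<in>carrier_vec n. qform A x x = 0 \<longrightarrow> x = 0\<^sub>v n)"

lemma scalar_prod_self_nonneg: "0 \<le> scalar_prod x (x :: real Matrix.vec)"
  unfolding scalar_prod_def by (intro sum_nonneg) simp

lemma scalar_prod_self_pos:
  assumes "x \<in> carrier_vec n" "x \<noteq> 0\<^sub>v n"
  shows "0 < scalar_prod x (x :: real Matrix.vec)"
proof -
  have "\<exists>i<n. vec_index x i \<noteq> 0"
  proof (rule ccontr)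
    assume "\<not> ?thesis"
    then have "x = 0\<^sub>v n" using assms(1) by (intro eq_vecI) auto
    then show False using assms by simp
  qed
  then obtain i where i: "i < n" "vec_index x i \<noteq> 0" by auto
  have "0 < (vec_index x i)\<^sup>2" using i by simp
  then have "0 < vec_index x i * vec_index x i" by (simp add: power2_eq_square)
  also have "\<dots> \<le> scalar_prod x x" unfolding scalar_prod_def
    using i assms(1) by (intro member_le_sum[where f="\<lambda>i. vec_index x i * vec_index x i"]) auto
  finally show ?thesis .
qed

lemma qform_commute:
  assumes "A \<in> carrier_mat n n" "transpose_mat A = A" "x \<in> carrier_vec n" "y \<in> carrier_vec n"
  shows "qform A x y = qform A y x"
proof -
  have "qform A y x = scalar_prod (transpose_mat A *\<^sub>v y) x"
    using transpose_vec_mult_scalar[OF assms(1,3,4)] by simp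
  also have "\<dots> = qform A x y" using assms by (simp add: comm_scalar_prod[of x n])
  finally show ?thesis by simp
qed

lemma qform_smult_add:
  assumes A: "A \<in> carrier_mat n n" "transpose_mat A = A" and x: "x \<in> carrier_vec n" and y: "y \<in> carrier_vec n"
  shows "qform A (x + t \<cdot>\<^sub>v y) (x + t \<cdot>\<^sub>v y) = qform A x x + 2 * t * qform A x y + t\<^sup>2 * qform A y y"
proof -
  have Ax: "A *\<^sub>v x \<in> carrier_vec n" "A *\<^sub>v y \<in> carrier_vec n" "A *\<^sub>v (t \<cdot>\<^sub>v y) \<in> carrier_vec n" using A x y by auto
  have "A *\<^sub>v (x + t \<cdot>\<^sub>v y) = A *\<^sub>v x + t \<cdot>\<^sub>v (A *\<^sub>v y)"
    using A x y by (simp add: mult_add_distrib_mat_vec[of A n n] mult_mat_vec[of A n n])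
  then have "qform A (x + t \<cdot>\<^sub>v y) (x + t \<cdot>\<^sub>v y)
     = scalar_prod x (A *\<^sub>v x) + t * scalar_prod x (A *\<^sub>v y) + (t * scalar_prod y (A *\<^sub>v x) + t * (t * scalar_prod y (A *\<^sub>v y)))"
    using Ax x y by (simp add: add_scalar_prod_distrib[of _ n] scalar_prod_add_distrib[of _ n] distrib_left)
  also have "scalar_prod y (A *\<^sub>v x) = scalar_prod x (A *\<^sub>v y)" using qform_commute[OF A y x] .
  finally show ?thesis by (simp add: power2_eq_square)
qed

lemma psd_Cauchy_Schwarz:
  assumes "psd_mat n A" "x \<in> carrier_vec n" "y \<in> carrier_vec n"
  shows "(qform A x y)\<^sup>2 \<le> qform A x x * qform A y y"
proof (rule quadratic_nonneg_discriminant)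
  fix t
  have "x + t \<cdot>\<^sub>v y \<in> carrier_vec n" using assms by simp
  then show "0 \<le> qform A x x + 2 * t * qform A x y + t\<^sup>2 * qform A y y"
    using assms qform_smult_add[of A n x y t] unfolding psd_mat_def by metis
qed

lemma psd_one: "psd_mat n (1\<^sub>m n)"
  unfolding psd_mat_def by (auto simp: scalar_prod_self_nonneg)

lemma scalar_prod_Cauchy_Schwarz:
  assumes "x \<in> carrier_vec n" "y \<in> carrier_vec n"
  shows "(scalar_prod x y)\<^sup>2 \<le> scalar_prod x x * scalar_prod y (y :: real Matrix.vec)"
  using psd_Cauchy_Schwarz[OF psd_one assms] assms by simp

lemma nonsingular_mat_inv:
  fixes A :: "real Matrix.mat"
  assumes A: "A \<in> carrier_mat n n" and inj: "\<And>x. x \<in> carrier_vec n \<Longrightarrow> A *\<^sub>v x = 0\<^sub>v n \<Longrightarrow> x = 0\<^sub>v n"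
  shows "mat_inv A \<in> carrier_mat n n" "A * mat_inv A = 1\<^sub>m n" "mat_inv A * A = 1\<^sub>m n"
proof -
  have "det A \<noteq> 0" using det_0_iff_vec_prod_zero_field[OF A] inj by blast
  then have "A \<in> Units (ring_mat TYPE(real) n ())" by (rule det_non_zero_imp_unit[OF A])
  then obtain B where "mat_inverse A = Some B" using mat_inverse(1)[OF A, of "()"] by (cases "mat_inverse A") auto
  then show "mat_inv A \<in> carrier_mat n n" "A * mat_inv A = 1\<^sub>m n" "mat_inv A * A = 1\<^sub>m n"
    using mat_inverse(2)[OF A, of B] by auto
qed

lemma pd_mat_inv:
  assumes "pd_mat n A"
  shows "mat_inv A \<in> carrier_mat n n" "A * mat_inv A = 1\<^sub>m n" "mat_inv A * A = 1\<^sub>m n"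
    "transpose_mat (mat_inv A) = mat_inv A"
proof -
  have A: "A \<in> carrier_mat n n" "transpose_mat A = A" using assms unfolding pd_mat_def psd_mat_def by auto
  have inj: "x = 0\<^sub>v n" if "x \<in> carrier_vec n" "A *\<^sub>v x = 0\<^sub>v n" for x
    using assms that unfolding pd_mat_def by auto
  show 1: "mat_inv A \<in> carrier_mat n n" "A * mat_inv A = 1\<^sub>m n" "mat_inv A * A = 1\<^sub>m n"
    using nonsingular_mat_inv[OF A(1) inj] by auto
  have tr: "transpose_mat (mat_inv A) * A = 1\<^sub>m n"
    using transpose_mult[OF A(1) 1(1)] 1(2) A(2) by simp
  have "transpose_mat (mat_inv A) = transpose_mat (mat_inv A) * (A * mat_inv A)" using 1 by simp
  also have "\<dots> = (transpose_mat (mat_inv A) * A) * mat_inv A"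
    using 1 A by (intro assoc_mult_mat[symmetric]) auto
  also have "\<dots> = mat_inv A" using tr 1 by simp
  finally show "transpose_mat (mat_inv A) = mat_inv A" .
qed

lemma pd_mat_inv_mult_vec:
  assumes "pd_mat n A" "x \<in> carrier_vec n"
  shows "mat_inv A *\<^sub>v x \<in> carrier_vec n" "A *\<^sub>v (mat_inv A *\<^sub>v x) = x"
proof -
  have A: "A \<in> carrier_mat n n" using assms unfolding pd_mat_def psd_mat_def by auto
  note i = pd_mat_inv[OF assms(1)]
  show "mat_inv A *\<^sub>v x \<in> carrier_vec n" using i assms by simp
  show "A *\<^sub>v (mat_inv A *\<^sub>v x) = x"
    using assoc_mult_mat_vec[OF A i(1) assms(2)] i(2) assms(2) by simp
qed

lemma qform_le_scalar_prod:
  fixes A :: "real Matrix.mat"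
  assumes A: "A \<in> carrier_mat n n"
  obtains g where "g > 0" "\<And>x. x \<in> carrier_vec n \<Longrightarrow> qform A x x \<le> g * scalar_prod x x"
proof -
  define g where "g = 1 + (\<Sum>i<n. \<Sum>j<n. \<bar>A $$ (i, j)\<bar>)"
  have "qform A x x \<le> g * scalar_prod x x" if x: "x \<in> carrier_vec n" for x
  proof -
    let ?s = "scalar_prod x x"
    have s0: "0 \<le> ?s" by (rule scalar_prod_self_nonneg)
    have c: "vec_index x i * vec_index x j \<le> ?s \<and> - (vec_index x i * vec_index x j) \<le> ?s" if "i < n" "j < n" for i j
    proof -
      have le: "(vec_index x k)\<^sup>2 \<le> ?s" if "k < n" for k
        unfolding scalar_prod_def power2_eq_square using x that
        by (intro member_le_sum[where f="\<lambda>i. vec_index x i * vec_index x i"]) auto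
      have "0 \<le> (vec_index x i - vec_index x j)\<^sup>2" "0 \<le> (vec_index x i + vec_index x j)\<^sup>2" by auto
      then show ?thesis using le[OF that(1)] le[OF that(2)] by (simp add: power2_diff power2_sum)
    qed
    have "qform A x x = (\<Sum>i<n. vec_index x i * (\<Sum>j<n. A $$ (i, j) * vec_index x j))"
      using A x unfolding scalar_prod_def by (auto simp: atLeast0LessThan mult_mat_vec_def scalar_prod_def intro!: sum.cong)
    also have "\<dots> = (\<Sum>i<n. \<Sum>j<n. A $$ (i, j) * (vec_index x i * vec_index x j))"
      by (simp add: sum_distrib_left mult_ac)
    also have "\<dots> \<le> (\<Sum>i<n. \<Sum>j<n. \<bar>A $$ (i, j)\<bar> * ?s)"
    proof (intro sum_mono)
      fix i j assume "i \<in> {..<n}" "j \<in> {..<n}"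
      then have "\<bar>vec_index x i * vec_index x j\<bar> \<le> ?s" using c[of i j] by auto
      then have "\<bar>A $$ (i, j)\<bar> * \<bar>vec_index x i * vec_index x j\<bar> \<le> \<bar>A $$ (i, j)\<bar> * ?s"
        by (intro mult_left_mono) auto
      then show "A $$ (i, j) * (vec_index x i * vec_index x j) \<le> \<bar>A $$ (i, j)\<bar> * ?s"
        by (metis abs_le_D1 abs_mult)
    qed
    also have "\<dots> = (\<Sum>i<n. \<Sum>j<n. \<bar>A $$ (i, j)\<bar>) * ?s" by (simp add: sum_distrib_right)
    also have "\<dots> \<le> g * ?s" unfolding g_def using s0 by (simp add: algebra_simps)
    finally show ?thesis .
  qed
  moreover have "g > 0" unfolding g_def by (smt (verit) sum_nonneg abs_ge_zero)
  ultimately show ?thesis using that by blast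
qed

text \<open>Let \<open>m\<close> be the supremum of the Rayleigh quotients. The matrix \<open>m I - F\<close> is positive semidefinite.
  If it were invertible, then by Cauchy-Schwarz \<open>qform (m I - F) x x\<close> would be bounded below by a
  positive multiple of the squared length of \<open>x\<close>, and \<open>m\<close> could be lowered. So \<open>m\<close> is an
  eigenvalue.\<close>

lemma symmetric_mat_positive_eigenvalue:
  fixes F :: "real Matrix.mat"
  assumes F: "F \<in> carrier_mat n n" "transpose_mat F = F"
    and x0: "x0 \<in> carrier_vec n" "0 < qform F x0 x0"
  shows "\<exists>x \<mu>. 0 < \<mu> \<and> eigenvector F x \<mu>"
proof -
  obtain g where g: "g > 0" "\<And>x. x \<in> carrier_vec n \<Longrightarrow> qform F x x \<le> g * scalar_prod x x"
    using qform_le_scalar_prod[OF F(1)] by blast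
  define R where "R = {\<mu>. 0 \<le> \<mu> \<and> (\<forall>x\<in>carrier_vec n. qform F x x \<le> \<mu> * scalar_prod x x)}"
  define m where "m = Inf R"
  have Rne: "g \<in> R" unfolding R_def using g by auto
  have Rbdd: "bdd_below R" unfolding R_def by (intro bdd_belowI[of _ 0]) auto
  have x00: "x0 \<noteq> 0\<^sub>v n" using x0 F by auto
  have le: "qform F x x \<le> m * scalar_prod x x" if x: "x \<in> carrier_vec n" for x
  proof (cases "x = 0\<^sub>v n")
    case True
    then show ?thesis using F by simp
  next
    case False
    then have p: "0 < scalar_prod x x" using x scalar_prod_self_pos by blast
    have "qform F x x / scalar_prod x x \<le> m" unfolding m_def
      using Rne x p by (intro cInf_greatest) (auto simp: R_def divide_simps)
    then show ?thesis using p by (simp add: field_simps)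
  qed
  have m0: "0 < m"
  proof -
    have "0 < scalar_prod x0 x0" using x0 x00 scalar_prod_self_pos by blast
    moreover have "0 < m * scalar_prod x0 x0" using le[OF x0(1)] x0(2) by simp
    ultimately show ?thesis by (simp add: zero_less_mult_iff)
  qed
  define G where "G = (m \<cdot>\<^sub>m 1\<^sub>m n) - F"
  have G: "G \<in> carrier_mat n n" unfolding G_def using F by auto
  have Gt: "transpose_mat G = G" unfolding G_def using F
    by (auto intro!: eq_matI) (metis index_transpose_mat(1) carrier_matD)+
  have Gv: "G *\<^sub>v x = m \<cdot>\<^sub>v x - F *\<^sub>v x" if "x \<in> carrier_vec n" for x
  proof -
    have "(m \<cdot>\<^sub>m 1\<^sub>m n) *\<^sub>v x = m \<cdot>\<^sub>v x"
      using that by (auto intro!: eq_vecI simp: scalar_prod_def if_distrib if_distribR cong: if_cong)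
    then show ?thesis
      unfolding G_def using F that by (simp add: minus_mult_distrib_mat_vec[of _ n n])
  qed
  have Gq: "qform G x x = m * scalar_prod x x - qform F x x" if "x \<in> carrier_vec n" for x
    unfolding Gv[OF that] using F that by (simp add: scalar_prod_minus_distrib[of _ n])
  have Gpsd: "psd_mat n G" unfolding psd_mat_def using G Gt le Gq by auto
  have "\<exists>x. x \<in> carrier_vec n \<and> x \<noteq> 0\<^sub>v n \<and> G *\<^sub>v x = 0\<^sub>v n"
  proof (rule ccontr)
    assume "\<not> ?thesis"
    then have inj: "x = 0\<^sub>v n" if "x \<in> carrier_vec n" "G *\<^sub>v x = 0\<^sub>v n" for x using that by blast
    note Gi = nonsingular_mat_inv[OF G inj]
    obtain k where k: "k > 0" "\<And>x. x \<in> carrier_vec n \<Longrightarrow> qform (mat_inv G) x x \<le> k * scalar_prod x x"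
      using qform_le_scalar_prod[OF Gi(1)] by blast
    \<comment> \<open>The margin is capped by \<open>m\<close> so that \<open>m - k'\<close> stays nonnegative, as membership in \<open>R\<close> demands.\<close>
    define k' where "k' = min (1 / k) m"
    have k': "0 < k'" "k' \<le> m" "k' * k \<le> 1" unfolding k'_def using k m0 by (auto simp: min_def field_simps)
    have low: "k' * scalar_prod x x \<le> qform G x x" if x: "x \<in> carrier_vec n" for x
    proof (cases "x = 0\<^sub>v n")
      case True
      then show ?thesis using G by simp
    next
      case False
      let ?s = "scalar_prod x x"
      have s: "0 < ?s" using x False scalar_prod_self_pos by blast
      define y where "y = mat_inv G *\<^sub>v x"
      have y: "y \<in> carrier_vec n" "G *\<^sub>v y = x"
        using Gi x assoc_mult_mat_vec[OF G Gi(1) x] unfolding y_def by auto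
      have "?s\<^sup>2 \<le> qform G x x * qform G y y"
        using psd_Cauchy_Schwarz[OF Gpsd x y(1)] y by simp
      also have "qform G y y = qform (mat_inv G) x x"
        using y x comm_scalar_prod[of y n x] unfolding y_def by simp
      also have "qform G x x * qform (mat_inv G) x x \<le> qform G x x * (k * ?s)"
        using k(2)[OF x] Gpsd x unfolding psd_mat_def by (intro mult_left_mono) auto
      finally have "?s * ?s \<le> (qform G x x * k) * ?s" by (simp add: power2_eq_square mult_ac)
      then have "?s \<le> qform G x x * k" using s by simp
      then have "k' * ?s \<le> k' * (qform G x x * k)" using k' by (intro mult_left_mono) auto
      also have "\<dots> = (k' * k) * qform G x x" by simp
      also have "\<dots> \<le> 1 * qform G x x" using k' Gpsd x unfolding psd_mat_def by (intro mult_right_mono) auto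
      finally show ?thesis by simp
    qed
    have "m - k' \<in> R" unfolding R_def using low Gq k' by (auto simp: algebra_simps) 
    then have "m \<le> m - k'" unfolding m_def using Rbdd by (intro cInf_lower) (auto simp: m_def)
    then show False using k' by simp
  qed
  then obtain x where x: "x \<in> carrier_vec n" "x \<noteq> 0\<^sub>v n" "G *\<^sub>v x = 0\<^sub>v n" by auto
  have "F *\<^sub>v x = m \<cdot>\<^sub>v x"
  proof (rule eq_vecI)
    fix i assume i: "i < dim_vec (m \<cdot>\<^sub>v x)"
    then have "vec_index (m \<cdot>\<^sub>v x - F *\<^sub>v x) i = 0" using x Gv[OF x(1)] by simp
    then show "vec_index (F *\<^sub>v x) i = vec_index (m \<cdot>\<^sub>v x) i" using i x F by simp
  qed (use F x in auto)
  then have "eigenvector F x m" unfolding eigenvector_def using F x by auto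
  then show ?thesis using m0 by blast
qed

lemma finite_eigenvalues_on:
  fixes F :: "real Matrix.mat"
  assumes F: "F \<in> carrier_mat n n"
  shows "finite (eigenvalues_on V F)"
proof -
  have "eigenvalues_on V F \<subseteq> {\<mu>. poly (char_poly F) \<mu> = 0}"
    unfolding eigenvalues_on_def using eigenvalue_root_char_poly[OF F] by (auto simp: eigenvalue_def)
  moreover have "char_poly F \<noteq> 0" using degree_monic_char_poly[OF F] by auto
  ultimately show ?thesis using poly_roots_finite[of "char_poly F"] finite_subset by blast
qed

text \<open>An eigenvalue is the Rayleigh quotient of its eigenvector. The existence of an eigenvector in \<open>V\<close>
  makes the extremal eigenvalues meaningful, since \<open>Max\<close> and \<open>Min\<close> of the empty set are arbitrary.\<close>

lemma condition_number_on_le: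
  fixes F :: "real Matrix.mat"
  assumes F: "F \<in> carrier_mat n n" and V: "V \<subseteq> carrier_vec n"
    and ne: "\<exists>x\<in>V. \<exists>\<mu>. eigenvector F x \<mu>"
    and \<alpha>: "0 < \<alpha>" "\<And>l. l \<in> V \<Longrightarrow> \<alpha> * scalar_prod l l \<le> qform F l l"
    and \<beta>: "\<And>l. l \<in> V \<Longrightarrow> qform F l l \<le> \<beta> * scalar_prod l l"
  shows "condition_number_on V F \<le> \<beta> / \<alpha>"
proof -
  let ?E = "eigenvalues_on V F"
  have fin: "finite ?E" by (rule finite_eigenvalues_on[OF F])
  have ne': "?E \<noteq> {}" using ne unfolding eigenvalues_on_def by auto
  have b: "\<alpha> \<le> \<mu> \<and> \<mu> \<le> \<beta>" if mu: "\<mu> \<in> ?E" for \<mu>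
  proof -
    obtain x where x: "x \<in> V" "x \<in> carrier_vec n" "x \<noteq> 0\<^sub>v n" "F *\<^sub>v x = \<mu> \<cdot>\<^sub>v x"
      using mu F V unfolding eigenvalues_on_def eigenvector_def by auto
    have "0 < scalar_prod x x" using x scalar_prod_self_pos by blast
    moreover have "qform F x x = \<mu> * scalar_prod x x" using x by simp
    ultimately show ?thesis using \<alpha>(2)[OF x(1)] \<beta>[OF x(1)] by simp
  qed
  have "Max ?E \<le> \<beta>" "\<alpha> \<le> Min ?E" "\<alpha> \<le> Max ?E" using fin ne' b Max_in Min_in by auto
  then show ?thesis unfolding condition_number_on_def
    using \<alpha>(1) by (intro frac_le) auto
qed

text \<open>With \<open>u = S\<inverse> B\<^sup>T l\<close> one has \<open>F l = B u\<close> and \<open>qform F l l = qform S u u\<close>. The upper bound is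
  Cauchy-Schwarz for \<open>l\<close> and \<open>B u\<close>; the lower bound is Cauchy-Schwarz for \<open>B\<^sup>T l\<close> and \<open>u\<close> in the form
  \<open>S\<close>. An eigenvector of \<open>F\<close> with a nonzero eigenvalue lies in the range of \<open>B\<close>, so a positive
  eigenvalue of \<open>F\<close> is also one on the space of multipliers.\<close>

lemma dual_operator_bounds:
  fixes S B :: "real Matrix.mat"
  assumes S: "pd_mat n S" and B: "B \<in> carrier_mat m n"
    and F: "F = B * mat_inv S * transpose_mat B"
    and V: "V = {B *\<^sub>v w | w. w \<in> carrier_vec n}"
    and K: "0 \<le> K" "\<And>u. u \<in> carrier_vec n \<Longrightarrow> scalar_prod (B *\<^sub>v u) (B *\<^sub>v u) \<le> K * qform S u u"
    and c: "0 < c" "\<And>u. u \<in> carrier_vec n \<Longrightarrow> qform S u u \<le> c * scalar_prod u u"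
    and D: "0 < D" "\<And>l. l \<in> V \<Longrightarrow> scalar_prod l l \<le> D * scalar_prod (transpose_mat B *\<^sub>v l) (transpose_mat B *\<^sub>v l)"
  shows "\<And>l. l \<in> V \<Longrightarrow> qform F l l \<le> K * scalar_prod l l"
    and "\<And>l. l \<in> V \<Longrightarrow> scalar_prod l l \<le> D * c * qform F l l"
    and "V \<noteq> {0\<^sub>v m} \<Longrightarrow> condition_number_on V F \<le> K * (D * c)"
proof -
  have Sc: "S \<in> carrier_mat n n" "transpose_mat S = S" and Sp: "psd_mat n S"
    using S unfolding pd_mat_def psd_mat_def by auto
  note Si = pd_mat_inv[OF S]
  have Fc: "F \<in> carrier_mat m m" unfolding F using B Si by auto
  have Vm: "V \<subseteq> carrier_vec m" unfolding V using B by auto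
  have key: "\<exists>u\<in>carrier_vec n. F *\<^sub>v l = B *\<^sub>v u \<and> S *\<^sub>v u = transpose_mat B *\<^sub>v l \<and> qform F l l = qform S u u"
    if l: "l \<in> carrier_vec m" for l
  proof -
    define mu where "mu = transpose_mat B *\<^sub>v l"
    have mu: "mu \<in> carrier_vec n" unfolding mu_def using B l by auto
    define u where "u = mat_inv S *\<^sub>v mu"
    have u: "u \<in> carrier_vec n" "S *\<^sub>v u = mu" unfolding u_def using pd_mat_inv_mult_vec[OF S mu] by auto
    have Fl: "F *\<^sub>v l = B *\<^sub>v u"
    proof -
      have "F *\<^sub>v l = (B * mat_inv S) *\<^sub>v mu"
        unfolding F mu_def using B Si l by (intro assoc_mult_mat_vec) auto
      also have "\<dots> = B *\<^sub>v u" unfolding u_def using B Si mu by (intro assoc_mult_mat_vec) auto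
      finally show ?thesis .
    qed
    have "qform F l l = scalar_prod mu u"
      unfolding Fl mu_def using transpose_vec_mult_scalar[OF B u(1) l] by simp
    also have "\<dots> = qform S u u" unfolding u(2) using comm_scalar_prod[OF mu u(1)] .
    finally show ?thesis using u Fl mu_def by blast
  qed
  have up: "qform F l l \<le> K * scalar_prod l l" if l: "l \<in> carrier_vec m" for l
  proof -
    obtain u where u: "u \<in> carrier_vec n" "F *\<^sub>v l = B *\<^sub>v u" "qform F l l = qform S u u" using key[OF l] by blast
    have q0: "0 \<le> qform S u u" using Sp u unfolding psd_mat_def by auto
    have "(qform F l l)\<^sup>2 \<le> scalar_prod l l * scalar_prod (B *\<^sub>v u) (B *\<^sub>v u)"
      unfolding u(2) using scalar_prod_Cauchy_Schwarz[of l m "B *\<^sub>v u"] l B u by auto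
    also have "\<dots> \<le> scalar_prod l l * (K * qform S u u)"
      using K u by (intro mult_left_mono scalar_prod_self_nonneg) auto
    finally have le: "qform F l l * qform F l l \<le> (K * scalar_prod l l) * qform F l l"
      using u by (simp add: power2_eq_square mult_ac)
    show ?thesis
    proof (cases "qform F l l = 0")
      case True
      then show ?thesis using K scalar_prod_self_nonneg[of l] by simp
    next
      case False
      then have "0 < qform F l l" using u q0 by simp
      then show ?thesis using le by simp
    qed
  qed
  show "qform F l l \<le> K * scalar_prod l l" if "l \<in> V" for l using up that Vm by auto
  show low: "scalar_prod l l \<le> D * c * qform F l l" if lV: "l \<in> V" for l
  proof -
    have l: "l \<in> carrier_vec m" using Vm lV by auto
    obtain u where u: "u \<in> carrier_vec n" "S *\<^sub>v u = transpose_mat B *\<^sub>v l" "qform F l l = qform S u u" using key[OF l] by blast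
    define mu where "mu = transpose_mat B *\<^sub>v l"
    have mu: "mu \<in> carrier_vec n" unfolding mu_def using B l by auto
    let ?s = "scalar_prod mu mu"
    have q0: "0 \<le> qform S u u" using Sp u unfolding psd_mat_def by auto
    have "?s\<^sup>2 \<le> qform S mu mu * qform S u u"
      using psd_Cauchy_Schwarz[OF Sp mu u(1)] u unfolding mu_def by simp
    also have "\<dots> \<le> (c * ?s) * qform S u u" using c mu q0 by (intro mult_right_mono) auto
    finally have le: "?s * ?s \<le> (c * qform S u u) * ?s" by (simp add: power2_eq_square mult_ac)
    have "?s \<le> c * qform S u u"
    proof (cases "?s = 0")
      case True
      then show ?thesis using c q0 by simp
    next
      case False
      then have "0 < ?s" using scalar_prod_self_nonneg[of mu] by simp
      then show ?thesis using le by simp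
    qed
    then have "D * ?s \<le> D * (c * qform S u u)" using D by (intro mult_left_mono) auto
    then show ?thesis using D(2)[OF lV] u unfolding mu_def by simp
  qed
  show "condition_number_on V F \<le> K * (D * c)" if ne: "V \<noteq> {0\<^sub>v m}"
  proof -
    have "0\<^sub>v m \<in> V" unfolding V using B by (auto intro!: exI[of _ "0\<^sub>v n"])
    then obtain x0 where x0: "x0 \<in> V" "x0 \<noteq> 0\<^sub>v m" using ne by blast
    have x0c: "x0 \<in> carrier_vec m" using x0 Vm by auto
    have "0 < scalar_prod x0 x0" using scalar_prod_self_pos[OF x0c x0(2)] .
    then have "0 < D * c * qform F x0 x0" using low[OF x0(1)] by simp
    moreover have "0 < D * c" using D(1) c(1) by simp
    ultimately have pos: "0 < qform F x0 x0" by (rule zero_less_mult_pos)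
    have Ft: "transpose_mat F = F"
    proof -
      have "transpose_mat F = transpose_mat (transpose_mat B) * transpose_mat (B * mat_inv S)"
        unfolding F using B Si by (intro transpose_mult[of _ m n _ m]) auto
      also have "transpose_mat (B * mat_inv S) = mat_inv S * transpose_mat B"
        using transpose_mult[OF B Si(1)] Si(4) by simp
      also have "transpose_mat (transpose_mat B) * (mat_inv S * transpose_mat B) = F"
        unfolding F using B Si by (simp add: assoc_mult_mat[of B m n "mat_inv S" n "transpose_mat B" m])
      finally show ?thesis .
    qed
    obtain x \<mu> where x: "0 < \<mu>" "eigenvector F x \<mu>"
      using symmetric_mat_positive_eigenvalue[OF Fc Ft x0c pos] by blast
    have xc: "x \<in> carrier_vec m" "F *\<^sub>v x = \<mu> \<cdot>\<^sub>v x" using x Fc unfolding eigenvector_def by auto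
    have "x \<in> V"
    proof -
      obtain u where u: "u \<in> carrier_vec n" "F *\<^sub>v x = B *\<^sub>v u" using key[OF xc(1)] by blast
      have "B *\<^sub>v ((1 / \<mu>) \<cdot>\<^sub>v u) = (1 / \<mu>) \<cdot>\<^sub>v (\<mu> \<cdot>\<^sub>v x)" using u xc B by (simp add: mult_mat_vec)
      also have "\<dots> = x" using x(1) by (simp add: smult_smult_assoc)
      finally show ?thesis unfolding V using u by (metis (mono_tags, lifting) mem_Collect_eq smult_carrier_vec)
    qed
    then have "condition_number_on V F \<le> K / (1 / (D * c))"
      using x low up Vm D c
      by (intro condition_number_on_le[OF Fc Vm]) (auto simp: field_simps)
    then show ?thesis by simp
  qed
qed

section \<open>Piecewise affine functions on simplicial meshes\<close>

lemma affine_interpolation: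
  fixes C :: "'a::euclidean_space set" and w :: "'a \<Rightarrow> real"
  assumes "\<not> affine_dependent C"
  shows "\<exists>a b. \<forall>c\<in>C. inner a c + b = w c"
proof (cases "C = {}")
  case False
  then obtain c0 where c0: "c0 \<in> C" by auto
  have ind: "independent ((\<lambda>x. - c0 + x) ` (C - {c0}))"
    using assms affine_dependent_iff_dependent2[OF c0] by auto
  obtain g :: "'a \<Rightarrow> real" where g: "linear g"
    "\<forall>x\<in>(\<lambda>x. - c0 + x) ` (C - {c0}). g x = w (c0 + x) - w c0"
    using linear_independent_extend[OF ind, of "\<lambda>x. w (c0 + x) - w c0"] by blast
  define a where "a = adjoint g 1"
  have a: "inner a x = g x" for x
    using adjoint_works[OF g(1), of x 1] unfolding a_def by (simp add: inner_commute)
  have "inner a c + (w c0 - inner a c0) = w c" if "c \<in> C" for c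
  proof (cases "c = c0")
    case False
    then have "g (- c0 + c) = w c - w c0" using g(2) that by auto
    then show ?thesis unfolding a[symmetric] by (simp add: inner_simps)
  qed simp
  then show ?thesis by blast
qed simp

lemma affine_functions_agree:
  fixes F :: "'a::euclidean_space set"
  assumes F: "compact F" "convex F"
    and ext: "\<And>x. x extreme_point_of F \<Longrightarrow> inner a x + b = inner a' x + b'"
    and x: "x \<in> F"
  shows "inner a x + b = inner a' x + b'"
proof -
  have "convex hull {x. x extreme_point_of F} \<subseteq> {x. inner (a - a') x = b' - b}"
  proof (rule hull_minimal)
    show "{x. x extreme_point_of F} \<subseteq> {x. inner (a - a') x = b' - b}"
      using ext by (auto simp: inner_simps algebra_simps)
  qed (rule convex_hyperplane)
  then have "x \<in> {x. inner (a - a') x = b' - b}"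
    using Krein_Milman_Minkowski[OF F] x by auto
  then show ?thesis by (simp add: inner_simps algebra_simps)
qed

lemma affine_gradient_unique:
  fixes T :: "'a::euclidean_space set"
  assumes "interior T \<noteq> {}" "\<And>x. x \<in> T \<Longrightarrow> inner a x + b = inner a' x + b'"
  shows "a = a'"
proof (rule ccontr)
  assume ne: "a \<noteq> a'"
  obtain x0 r where r: "0 < r" "ball x0 r \<subseteq> T"
    using assms(1) by (meson all_not_in_conv mem_interior)
  define u where "u = (r / (2 * norm (a - a'))) *\<^sub>R (a - a')"
  have "norm u = r / 2" unfolding u_def using ne r by simp
  then have "x0 + u \<in> T" "x0 \<in> T" using r by (auto simp: dist_norm subset_iff)
  then have "inner (a - a') u = 0"
    using assms(2)[of x0] assms(2)[of "x0 + u"] by (simp add: inner_simps algebra_simps)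
  moreover have "inner (a - a') u = r / (2 * norm (a - a')) * (norm (a - a'))\<^sup>2"
    unfolding u_def by (simp add: power2_norm_eq_inner)
  ultimately show False using r ne by simp
qed

text \<open>The constant gradient of \<open>v\<close> on an element, meaningful if \<open>v\<close> is affine there and the element has
  interior points.\<close>

definition elem_grad :: "('a::euclidean_space \<Rightarrow> real) \<Rightarrow> 'a set \<Rightarrow> 'a" where
  "elem_grad v T = (SOME a. \<exists>b. \<forall>x\<in>T. v x = inner a x + b)"

lemma elem_grad:
  assumes "\<exists>a b. \<forall>x\<in>T. v x = inner a x + b"
  shows "\<exists>b. \<forall>x\<in>T. v x = inner (elem_grad v T) x + b"
  unfolding elem_grad_def using assms by (rule someI_ex)

lemma elem_grad_unique:
  assumes "interior T \<noteq> {}" "\<And>x. x \<in> T \<Longrightarrow> v x = inner a x + b"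
  shows "elem_grad v T = a"
proof -
  obtain b' where "\<forall>x\<in>T. v x = inner (elem_grad v T) x + b'" using elem_grad[of T v] assms(2) by blast
  then show ?thesis using affine_gradient_unique[OF assms(1), of "elem_grad v T" b' a b] assms(2) by auto
qed

lemma P1_space_affine:
  assumes "v \<in> P1_space \<T> D" "T \<in> \<T>"
  shows "\<exists>b. \<forall>x\<in>T. v x = inner (elem_grad v T) x + b"
  using assms elem_grad[of T v] unfolding P1_space_def by auto

lemma affine_sum:
  assumes "\<And>i. i \<in> I \<Longrightarrow> \<exists>b. \<forall>x\<in>T. v i x = inner (elem_grad (v i) T) x + b"
  shows "\<exists>b. \<forall>x\<in>T. (\<Sum>i\<in>I. w i * v i x) = inner (\<Sum>i\<in>I. w i *\<^sub>R elem_grad (v i) T) x + b"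
proof -
  obtain b where b: "\<And>i x. i \<in> I \<Longrightarrow> x \<in> T \<Longrightarrow> v i x = inner (elem_grad (v i) T) x + b i"
    using assms by metis
  have "(\<Sum>i\<in>I. w i * v i x) = inner (\<Sum>i\<in>I. w i *\<^sub>R elem_grad (v i) T) x + (\<Sum>i\<in>I. w i * b i)" if "x \<in> T" for x
  proof -
    have "(\<Sum>i\<in>I. w i * v i x) = (\<Sum>i\<in>I. w i * inner (elem_grad (v i) T) x + w i * b i)"
      using b that by (intro sum.cong) (auto simp: algebra_simps)
    then show ?thesis by (simp add: sum.distrib inner_sum_left)
  qed
  then show ?thesis by blast
qed

locale simplicial_mesh =
  fixes \<T> :: "'a::euclidean_space set set"
  assumes fin: "finite \<T>"
    and full: "\<And>T. T \<in> \<T> \<Longrightarrow> int DIM('a) simplex T"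
    and face: "\<And>T T'. T \<in> \<T> \<Longrightarrow> T' \<in> \<T> \<Longrightarrow> T \<inter> T' face_of T"
begin

lemma elem: assumes "T \<in> \<T>" shows "compact T" "convex T" "closed T" "interior T \<noteq> {}" "T \<noteq> {}"
proof -
  show c: "compact T" "convex T" "closed T" using full[OF assms] compact_simplex convex_simplex closed_simplex by auto
  have "aff_dim T = int DIM('a)" using full[OF assms] by (rule aff_dim_simplex)
  then have "T \<noteq> {}" "affine hull T = UNIV" by (auto simp: aff_dim_eq_full[symmetric])
  then show "interior T \<noteq> {}" using c rel_interior_eq_empty[of T] rel_interior_interior[of T] by simp
  then show "T \<noteq> {}" by auto
qed

lemma vertices: 
  assumes "T \<in> \<T>"
  obtains C where "finite C" "card C = DIM('a) + 1" "\<not> affine_dependent C" "T = convex hull C"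
    "C = {x. x extreme_point_of T}"
proof -
  obtain C where C: "\<not> affine_dependent C" "int (card C) = int DIM('a) + 1" "T = convex hull C"
    using full[OF assms] unfolding simplex_def by auto
  have "C = {x. x extreme_point_of T}"
    using extreme_point_of_convex_hull_affine_independent[OF C(1)] C(3) by auto
  then show ?thesis using that C aff_independent_finite by auto
qed

lemma disjoint_interiors:
  assumes "T \<in> \<T>" "T' \<in> \<T>" "T \<noteq> T'"
  shows "interior T \<inter> interior T' = {}"
proof (rule ccontr)
  assume ne: "interior T \<inter> interior T' \<noteq> {}"
  have "T \<inter> T' = T"
    using face_of_disjoint_interior[OF face[OF assms(1,2)]] ne interior_subset by blast
  moreover have "T' \<inter> T = T'"
    using face_of_disjoint_interior[OF face[OF assms(2,1)]] ne interior_subset by blast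
  ultimately show False using assms by auto
qed

text \<open>The affine interpolants on two elements agree on the common face, because they agree at its
  vertices, which are vertices of both elements. Hence they paste to a continuous function.\<close>

lemma interpolation_exists:
  fixes w :: "'a \<Rightarrow> real"
  assumes D: "\<Union>\<T> = closure D"
  shows "\<exists>v\<in>P1_space \<T> D. \<forall>q\<in>mesh_vertices \<T>. v q = w q"
proof -
  have "\<exists>a b. \<forall>c. c extreme_point_of T \<longrightarrow> inner a c + b = w c" if T: "T \<in> \<T>" for T
    using vertices[OF T] affine_interpolation[of _ w] by (metis mem_Collect_eq)
  then obtain a b where ab: "\<And>T c. T \<in> \<T> \<Longrightarrow> c extreme_point_of T \<Longrightarrow> inner (a T) c + b T = w c"
    by metis
  have agree: "inner (a T) x + b T = inner (a T') x + b T'"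
    if "T \<in> \<T>" "T' \<in> \<T>" "x \<in> T" "x \<in> T'" for T T' x
  proof (rule affine_functions_agree[of "T \<inter> T'"])
    show "compact (T \<inter> T')" "convex (T \<inter> T')" "x \<in> T \<inter> T'"
      using that elem by (auto intro: convex_Int compact_Int)
    fix c assume c: "c extreme_point_of T \<inter> T'"
    have "c extreme_point_of T" "c extreme_point_of T'"
      using c extreme_point_of_face[OF face[OF that(1,2)]] extreme_point_of_face[OF face[OF that(2,1)]]
      by (auto simp: Int_commute)
    then show "inner (a T) c + b T = inner (a T') c + b T'" using ab that by simp
  qed
  define pick where "pick x = (SOME T. T \<in> \<T> \<and> x \<in> T)" for x
  have pick: "pick x \<in> \<T>" "x \<in> pick x" if "x \<in> \<Union>\<T>" for x
    using someI_ex[of "\<lambda>T. T \<in> \<T> \<and> x \<in> T"] that unfolding pick_def by auto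
  define v where "v x = (if x \<in> \<Union>\<T> then inner (a (pick x)) x + b (pick x) else 0)" for x
  have v: "v x = inner (a T) x + b T" if "T \<in> \<T>" "x \<in> T" for T x
    using agree[OF pick(1) that(1) pick(2) that(2)] that unfolding v_def by auto
  have "continuous_on (\<Union>T\<in>\<T>. T) v"
  proof (rule continuous_on_closed_Union[OF fin])
    show "closed T" if "T \<in> \<T>" for T using elem that by auto
    show "continuous_on T v" if "T \<in> \<T>" for T
    proof (rule continuous_on_eq)
      show "continuous_on T (\<lambda>x. inner (a T) x + b T)" by (intro continuous_intros)
    qed (use v that in auto)
  qed
  then have "v \<in> P1_space \<T> D"
    unfolding P1_space_def D[symmetric] using v by (auto simp: v_def)
  moreover have "v q = w q" if "q \<in> mesh_vertices \<T>" for q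
  proof -
    obtain T where T: "T \<in> \<T>" "q extreme_point_of T" using \<open>q \<in> mesh_vertices \<T>\<close> unfolding mesh_vertices_def by auto
    then have "q \<in> T" by (simp add: extreme_point_of_def)
    then show ?thesis using v T ab by simp
  qed
  ultimately show ?thesis by blast
qed

lemma interpolation_unique:
  assumes D: "\<Union>\<T> = closure D" and v: "v \<in> P1_space \<T> D" "v' \<in> P1_space \<T> D"
    and eq: "\<And>q. q \<in> mesh_vertices \<T> \<Longrightarrow> v q = v' q"
  shows "v = v'"
proof
  fix x show "v x = v' x"
  proof (cases "x \<in> closure D")
    case True
    then obtain T where T: "T \<in> \<T>" "x \<in> T" using D by auto
    obtain b b' where b: "\<forall>x\<in>T. v x = inner (elem_grad v T) x + b" "\<forall>x\<in>T. v' x = inner (elem_grad v' T) x + b'"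
      using P1_space_affine[OF v(1) T(1)] P1_space_affine[OF v(2) T(1)] by blast
    have "inner (elem_grad v T) x + b = inner (elem_grad v' T) x + b'"
    proof (rule affine_functions_agree[of T])
      fix c assume c: "c extreme_point_of T"
      then have "c \<in> T" by (simp add: extreme_point_of_def)
      moreover have "v c = v' c" using c T eq unfolding mesh_vertices_def by auto
      ultimately show "inner (elem_grad v T) c + b = inner (elem_grad v' T) c + b'" using b by auto
    qed (use elem T in auto)
    then show ?thesis using b T by auto
  next
    case False
    then show ?thesis using v unfolding P1_space_def by auto
  qed
qed

text \<open>Near a point \<open>x'\<close> of \<open>\<Omega>\<close> inside the segment from \<open>c\<close> to \<open>z\<close> only elements containing \<open>x'\<close> occur. Each
  of them meets \<open>T\<close> in a face of \<open>T\<close>, which contains an inner point of the segment and therefore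
  \<open>z\<close>. By convexity these elements also cover a contracted neighbourhood of every point between
  \<open>x'\<close> and \<open>z\<close>, so such a point is interior to the closure of \<open>\<Omega>\<close>.\<close>

lemma segment_from_interior_point:
  assumes \<Omega>: "open \<Omega>" "\<Union>\<T> = closure \<Omega>" "\<Omega> = interior (closure \<Omega>)"
    and T: "T \<in> \<T>" "c \<in> T" "z \<in> T" "c \<in> \<Omega>" and \<theta>: "0 \<le> \<theta>" "\<theta> < 1"
  shows "(1 - \<theta>) *\<^sub>R c + \<theta> *\<^sub>R z \<in> \<Omega>"
proof (cases "\<theta> = 0 \<or> z = c")
  case True
  then show ?thesis using T by (auto simp: algebra_simps)
next
  case False
  define x where "x = (1 - \<theta>) *\<^sub>R c + \<theta> *\<^sub>R z"
  obtain e where e: "e > 0" "ball c e \<subseteq> \<Omega>" using \<Omega>(1) T(4) open_contains_ball by blast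
  define n where "n = norm (z - c)"
  have n: "n > 0" unfolding n_def using False by simp
  \<comment> \<open>Small enough to keep \<open>x'\<close> in the ball around \<open>c\<close> and before the target point \<open>x\<close>.\<close>
  define \<eta> where "\<eta> = min (\<theta> / 2) (e / (2 * n))"
  have \<eta>: "0 < \<eta>" "\<eta> < \<theta>" unfolding \<eta>_def using False \<theta> e n by auto
  define x' where "x' = (1 - \<eta>) *\<^sub>R c + \<eta> *\<^sub>R z"
  have "x' - c = \<eta> *\<^sub>R (z - c)" unfolding x'_def by (simp add: algebra_simps)
  then have "norm (x' - c) = \<eta> * n" using \<eta> unfolding n_def by simp
  also have "\<dots> \<le> e / (2 * n) * n" using n unfolding \<eta>_def by (intro mult_right_mono) auto
  also have "\<dots> < e" using n e by simp
  finally have x': "x' \<in> \<Omega>" using e by (auto simp: dist_norm norm_minus_commute)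
  define U where "U = \<Omega> - \<Union>{T' \<in> \<T>. x' \<notin> T'}"
  have "open U" unfolding U_def using \<Omega>(1) fin elem by (intro open_Diff closed_Union) auto
  moreover have "x' \<in> U" unfolding U_def using x' by auto
  ultimately obtain r where r: "r > 0" "ball x' r \<subseteq> U" using open_contains_ball by blast
  have seg: "x' \<in> open_segment c z"
    using \<eta> \<theta> False unfolding x'_def by (auto simp: in_segment intro!: exI[of _ \<eta>])
  have zin: "z \<in> T'" if "T' \<in> \<T>" "x' \<in> T'" for T'
  proof -
    have "x' \<in> T"
      using elem(2)[OF T(1)] T \<eta> \<theta> unfolding x'_def by (intro convexD) auto
    then have "x' \<in> T \<inter> T'" using that by auto
    then show ?thesis using face[OF T(1) that(1)] seg T unfolding face_of_def by blast
  qed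
  define s where "s = (\<theta> - \<eta>) / (1 - \<eta>)"
  have s: "0 \<le> s" "s < 1" unfolding s_def using \<eta> \<theta> by auto
  have "1 - s = (1 - \<theta>) / (1 - \<eta>)" unfolding s_def using \<eta> \<theta> by (simp add: field_simps)
  then have s1a: "(1 - s) * (1 - \<eta>) = 1 - \<theta>" using \<eta> \<theta> by simp
  have "(1 - s) * \<eta> + s = 1 - (1 - s) * (1 - \<eta>)" by (simp add: algebra_simps)
  then have s1: "(1 - s) * (1 - \<eta>) = 1 - \<theta>" "(1 - s) * \<eta> + s = \<theta>" using s1a by auto
  have xs: "x = (1 - s) *\<^sub>R x' + s *\<^sub>R z"
  proof -
    have "(1 - s) *\<^sub>R x' + s *\<^sub>R z = ((1 - s) * (1 - \<eta>)) *\<^sub>R c + ((1 - s) * \<eta> + s) *\<^sub>R z"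
      unfolding x'_def by (simp add: algebra_simps)
    then show ?thesis unfolding s1 x_def by simp
  qed
  have "ball x ((1 - s) * r) \<subseteq> closure \<Omega>"
  proof
    fix y assume y: "y \<in> ball x ((1 - s) * r)"
    define u where "u = x' + (1 / (1 - s)) *\<^sub>R (y - x)"
    have "norm (u - x') = norm (y - x) / (1 - s)" unfolding u_def using s by simp
    also have "\<dots> < r" using y s by (simp add: dist_norm norm_minus_commute field_simps)
    finally have "u \<in> U" using r by (auto simp: dist_norm norm_minus_commute)
    then obtain T' where T': "T' \<in> \<T>" "u \<in> T'" "x' \<in> T'"
      using \<Omega>(2) closure_subset[of \<Omega>] unfolding U_def by blast
    have "y = (1 - s) *\<^sub>R u + s *\<^sub>R z"
      unfolding u_def using s xs by (simp add: algebra_simps)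
    moreover have "(1 - s) *\<^sub>R u + s *\<^sub>R z \<in> T'"
      using elem(2)[OF T'(1)] T' zin s by (intro convexD) auto
    ultimately show "y \<in> closure \<Omega>" using T' \<Omega>(2) by auto
  qed
  moreover have "0 < (1 - s) * r" using s r by simp
  ultimately have "x \<in> interior (closure \<Omega>)" using mem_interior by blast
  then show ?thesis using \<Omega>(3) unfolding x_def by simp
qed

text \<open>A nodal function has to vanish on all of the boundary of \<open>\<Omega>\<close>, although only its values at boundary
  vertices are prescribed. By the preceding lemma, a boundary point of \<open>\<Omega>\<close> has zero weight on every
  vertex of its element that lies in \<open>\<Omega>\<close>.\<close>

lemma vanishes_on_frontier:
  assumes \<Omega>: "open \<Omega>" "\<Union>\<T> = closure \<Omega>" "\<Omega> = interior (closure \<Omega>)"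
    and T: "T \<in> \<T>" "x \<in> T" "x \<in> frontier \<Omega>" and v: "\<And>x. x \<in> T \<Longrightarrow> v x = inner a x + b"
    and zero: "\<And>c. c extreme_point_of T \<Longrightarrow> c \<in> frontier \<Omega> \<Longrightarrow> v c = 0"
  shows "v x = 0"
proof -
  obtain C where C: "finite C" "T = convex hull C" "C = {x. x extreme_point_of T}"
    using vertices[OF T(1)] by metis
  obtain l where l: "\<And>c. c \<in> C \<Longrightarrow> 0 \<le> l c" "sum l C = 1" "(\<Sum>c\<in>C. l c *\<^sub>R c) = x"
    using T(2) C(1,2) convex_hull_finite[OF C(1)] by auto
  have CT: "C \<subseteq> T" using C(2) hull_subset[of C convex] by simp
  have xO: "x \<notin> \<Omega>" using T(3) \<Omega>(1) by (simp add: frontier_def interior_open)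
  have "l c * v c = 0" if c: "c \<in> C" for c
  proof (cases "l c = 0")
    case False
    then have lc: "l c > 0" using l(1)[OF c] by simp
    have "c \<notin> \<Omega>"
    proof
      assume cO: "c \<in> \<Omega>"
      have l1: "l c \<le> 1" using member_le_sum[OF c, of l] l(1,2) C(1) by auto
      show False
      proof (cases "l c = 1")
        case True
        have "sum l (C - {c}) = 0" using l(2) c C(1) True by (simp add: sum_diff1)
        then have "\<forall>c'\<in>C - {c}. l c' = 0" using l(1) C(1) by (subst (asm) sum_nonneg_eq_0_iff) auto
        then have "(\<Sum>c\<in>C. l c *\<^sub>R c) = l c *\<^sub>R c"
          using sum.remove[OF C(1) c, of "\<lambda>c. l c *\<^sub>R c"] by simp
        then show False using xO cO True l(3) by simp
      next
        case False
        define \<theta> where "\<theta> = 1 - l c"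
        have \<theta>: "0 < \<theta>" "\<theta> < 1" unfolding \<theta>_def using False l1 lc by auto
        define z where "z = (\<Sum>c'\<in>C - {c}. (l c' / \<theta>) *\<^sub>R c')"
        have "sum l (C - {c}) = \<theta>" unfolding \<theta>_def using l(2) c C(1) by (simp add: sum_diff1)
        then have "(\<Sum>c'\<in>C - {c}. l c' / \<theta>) = 1" using \<theta> by (simp add: sum_divide_distrib[symmetric])
        then have "z \<in> T" unfolding z_def using C(1) elem(2)[OF T(1)] CT l(1) \<theta>
          by (intro convex_sum) auto
        moreover have "(1 - \<theta>) *\<^sub>R c + \<theta> *\<^sub>R z = x"
        proof -
          have "\<theta> *\<^sub>R z = (\<Sum>c'\<in>C - {c}. l c' *\<^sub>R c')"
            unfolding z_def scaleR_sum_right using \<theta> by (intro sum.cong) auto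
          then show ?thesis using sum.remove[OF C(1) c, of "\<lambda>c. l c *\<^sub>R c"] l(3) unfolding \<theta>_def by simp
        qed
        ultimately show False
          using segment_from_interior_point[OF \<Omega> T(1) _ _ cO, of z \<theta>] CT c \<theta> xO by auto
      qed
    qed
    moreover have "c \<in> closure \<Omega>" using CT c T \<Omega>(2) by auto
    ultimately have "c \<in> frontier \<Omega>" using \<Omega>(1) by (simp add: frontier_def interior_open)
    then show ?thesis using zero c C(3) by simp
  qed simp
  then have "(\<Sum>c\<in>C. l c * v c) = 0" by (simp add: sum.neutral)
  moreover have "(\<Sum>c\<in>C. l c * v c) = (\<Sum>c\<in>C. l c * inner a c + l c * b)"
    using CT v by (intro sum.cong) (auto simp: algebra_simps)
  moreover have "\<dots> = inner a x + b"
    unfolding l(3)[symmetric] by (simp add: sum.distrib inner_sum_right sum_distrib_right[symmetric] l(2))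
  ultimately show ?thesis using v T(2) by simp
qed

end

section \<open>A discrete Sobolev inequality\<close>

text \<open>A segment meets a convex element in one interval. Hence a piecewise affine function has finitely
  many kinks along a segment, and the time spent in an element is integrable.\<close>

lemma line_preimage_is_interval:
  fixes p y :: "'a::euclidean_space"
  assumes T: "compact T" "convex T"
  shows "\<exists>a b. {s..1} \<inter> (\<lambda>t. p + t *\<^sub>R (y - p)) -` T = {a..b}"
proof -
  define l where "l t = p + t *\<^sub>R (y - p)" for t
  define I where "I = {s..1} \<inter> l -` T"
  have "continuous_on {s..1} l"
    unfolding l_def by (intro continuous_intros)
  then have "closed I"
    unfolding I_def using T by (intro continuous_closed_preimage) (auto simp: compact_imp_closed)
  then have "compact I"
    by (metis I_def bounded_Int bounded_closed_interval compact_eq_bounded_closed)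
  moreover have "convex I"
  proof (rule convexI)
    fix a b u w :: real assume *: "a \<in> I" "b \<in> I" "0 \<le> u" "0 \<le> w" "u + w = 1"
    have "p = (u + w) *\<^sub>R p" using * by simp
    then have "l (u *\<^sub>R a + w *\<^sub>R b) = u *\<^sub>R l a + w *\<^sub>R l b"
      unfolding l_def by (simp add: algebra_simps)
    moreover have "u *\<^sub>R l a + w *\<^sub>R l b \<in> T"
      using T * unfolding I_def by (auto intro: convexD)
    moreover have "u *\<^sub>R a + w *\<^sub>R b \<in> {s..1}"
      using * unfolding I_def by (intro convexD[OF convex_real_interval(5)]) auto
    ultimately show "u *\<^sub>R a + w *\<^sub>R b \<in> I" unfolding I_def by auto
  qed
  ultimately show ?thesis
    using connected_compact_interval_1[of I] convex_connected unfolding I_def l_def by auto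
qed

text \<open>Off the finitely many end points of the intervals spent in the elements, the function is affine
  near the parameter \<open>t\<close>. This holds for every segment, including one that runs inside a common
  face of elements: there the derivative can be computed from any of them.\<close>

lemma lines_of_affine_pieces_derivative:
  fixes p y :: "'a::euclidean_space" and v :: "'a \<Rightarrow> real"
  assumes fin: "finite \<T>" and comp: "\<And>T. T \<in> \<T> \<Longrightarrow> compact T \<and> convex T"
    and seg: "closed_segment p y \<subseteq> \<Union>\<T>" and cont: "continuous_on (\<Union>\<T>) v"
    and aff: "\<And>T. T \<in> \<T> \<Longrightarrow> \<exists>b. \<forall>x\<in>T. v x = inner (g T) x + b"
  obtains f' where
    "\<And>s t. 0 \<le> s \<Longrightarrow> s \<le> t \<Longrightarrow> t \<le> 1 \<Longrightarrow>
       (f' has_integral (v (p + t *\<^sub>R (y - p)) - v (p + s *\<^sub>R (y - p)))) {s..t}"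
    "\<And>t. f' t = 0 \<or> (\<exists>T\<in>\<T>. p + t *\<^sub>R (y - p) \<in> T \<and> f' t = inner (g T) (y - p))"
proof -
  define l where "l t = p + t *\<^sub>R (y - p)" for t
  define I where "I T = {0..1} \<inter> l -` T" for T
  define S where "S = {0,1} \<union> (\<Union>T\<in>\<T>. frontier (I T))"
  have lcont: "continuous_on A l" for A
    unfolding l_def by (intro continuous_intros)
  have lin: "l t \<in> \<Union>\<T>" if "t \<in> {0..1}" for t
  proof -
    have "l t = (1 - t) *\<^sub>R p + t *\<^sub>R y"
      by (simp add: l_def algebra_simps)
    then have "l t \<in> closed_segment p y"
      using that by (auto simp: in_segment intro!: exI[of _ t])
    then show ?thesis using seg by auto
  qed
  have "finite (frontier (I T))" if TT: "T \<in> \<T>" for T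
  proof -
    obtain a b where "I T = {a..b}"
      using line_preimage_is_interval[of T 0 p y] comp[OF TT] unfolding I_def l_def by auto
    then have "frontier (I T) \<subseteq> {a,b}"
      by (auto simp: frontier_def)
    then show ?thesis by (rule finite_subset) auto
  qed
  then have finS: "finite S" unfolding S_def using fin by auto
  have ex: "\<exists>T\<in>\<T>. t \<in> interior (I T)" if "t \<in> {0..1} - S" for t
  proof -
    have "t \<in> {0..1}" using that by blast
    then obtain T where T: "T \<in> \<T>" "l t \<in> T" using lin by blast
    then have "t \<in> I T" using that unfolding I_def by auto
    moreover have "t \<notin> frontier (I T)" using that T unfolding S_def by auto
    ultimately have "t \<in> interior (I T)"
      using closure_subset unfolding frontier_def by auto
    then show ?thesis using T by auto
  qed
  define T where "T t = (SOME T. T \<in> \<T> \<and> t \<in> interior (I T))" for t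
  have T: "T t \<in> \<T>" "t \<in> interior (I (T t))" if "t \<in> {0..1} - S" for t
    using someI_ex[of "\<lambda>T. T \<in> \<T> \<and> t \<in> interior (I T)"] ex[OF that] unfolding T_def by auto
  \<comment> \<open>The value 0 at the exceptional parameters keeps the bound by \<open>g\<close> true for all \<open>t\<close>.\<close>
  define f' where "f' t = (if t \<in> {0..1} - S then inner (g (T t)) (y - p) else 0)" for t
  have der: "((\<lambda>t. v (l t)) has_vector_derivative f' t) (at t)" if "t \<in> {0..1} - S" for t
  proof -
    have "T t \<in> \<T>" using T that by blast
    then obtain b where b: "\<forall>x\<in>T t. v x = inner (g (T t)) x + b" using aff by blast
    have "((\<lambda>s. inner (g (T t)) (l s) + b) has_vector_derivative inner (g (T t)) (y - p)) (at t)"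
      unfolding l_def has_vector_derivative_def
      by (auto intro!: derivative_eq_intros simp: inner_simps algebra_simps)
    then have "((\<lambda>t. v (l t)) has_vector_derivative inner (g (T t)) (y - p)) (at t)"
    proof (rule has_vector_derivative_transform_within_open[OF _ open_interior])
      show "t \<in> interior (I (T t))" using T that by auto
      fix s assume "s \<in> interior (I (T t))"
      then have "s \<in> I (T t)" using interior_subset by blast
      then show "inner (g (T t)) (l s) + b = v (l s)" using b unfolding I_def by auto
    qed
    then show ?thesis unfolding f'_def using that by auto
  qed
  have 1: "(f' has_integral (v (l t) - v (l s))) {s..t}" if "0 \<le> s" "s \<le> t" "t \<le> 1" for s t
  proof (rule fundamental_theorem_of_calculus_interior_strong[OF finS \<open>s \<le> t\<close>])
    show "((\<lambda>t. v (l t)) has_vector_derivative f' x) (at x)" if "x \<in> {s<..<t} - S" for x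
      using that \<open>0 \<le> s\<close> \<open>t \<le> 1\<close> by (intro der) auto
    show "continuous_on {s..t} (\<lambda>t. v (l t))"
      using that lin by (intro continuous_on_compose2[OF cont lcont]) force
  qed
  have 2: "f' t = 0 \<or> (\<exists>T\<in>\<T>. l t \<in> T \<and> f' t = inner (g T) (y - p))" for t
  proof (cases "t \<in> {0..1} - S")
    case True
    then have "l t \<in> T t" using T(2)[OF True] interior_subset unfolding I_def by blast
    then show ?thesis using T(1)[OF True] True unfolding f'_def by auto
  next
    case False
    then have "f' t = 0" unfolding f'_def by (rule if_not_P)
    then show ?thesis by simp
  qed
  show ?thesis using that 1 2 unfolding l_def by blast
qed

text \<open>The optimal \<open>\<theta>\<close> is the square root of \<open>Q / L\<close>; both numbers are made positive first. Together with
  Young's inequality under the integral this replaces Cauchy-Schwarz for integrals.\<close>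

lemma square_le_of_weighted_bounds:
  fixes D L Q :: real
  assumes "0 \<le> D" "0 \<le> L" "0 \<le> Q" and b: "\<And>\<theta>. 0 < \<theta> \<Longrightarrow> D \<le> \<theta> / 2 * L + Q / (2 * \<theta>)"
  shows "D\<^sup>2 \<le> L * Q"
proof -
  have *: "D\<^sup>2 \<le> (L + \<epsilon>) * (Q + \<epsilon>)" if "\<epsilon> > 0" for \<epsilon>
  proof -
    define \<theta> where "\<theta> = sqrt ((Q + \<epsilon>) / (L + \<epsilon>))"
    have pos: "0 < L + \<epsilon>" "0 < Q + \<epsilon>" using assms that by auto
    then have th: "\<theta> > 0" unfolding \<theta>_def by auto
    have e1: "\<theta> * (L + \<epsilon>) = sqrt ((L + \<epsilon>) * (Q + \<epsilon>))"
    proof -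
      have "sqrt (Q + \<epsilon>) / sqrt (L + \<epsilon>) * (sqrt (L + \<epsilon>))\<^sup>2 = sqrt (L + \<epsilon>) * sqrt (Q + \<epsilon>)"
        using pos by (simp add: power2_eq_square del: real_sqrt_mult_self)
      then show ?thesis unfolding \<theta>_def real_sqrt_divide real_sqrt_mult
        using pos by simp
    qed
    have e2: "(Q + \<epsilon>) / \<theta> = sqrt ((L + \<epsilon>) * (Q + \<epsilon>))"
    proof -
      have "(sqrt (Q + \<epsilon>))\<^sup>2 / (sqrt (Q + \<epsilon>) / sqrt (L + \<epsilon>)) = sqrt (L + \<epsilon>) * sqrt (Q + \<epsilon>)"
        using pos by (simp add: power2_eq_square del: real_sqrt_mult_self)
      then show ?thesis unfolding \<theta>_def real_sqrt_divide real_sqrt_mult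
        using pos by simp
    qed
    have "D \<le> \<theta> / 2 * L + Q / (2 * \<theta>)" using b th by auto
    also have "\<dots> \<le> \<theta> / 2 * (L + \<epsilon>) + (Q + \<epsilon>) / (2 * \<theta>)"
      using th that by (intro add_mono mult_left_mono divide_right_mono) auto
    also have "\<dots> = sqrt ((L + \<epsilon>) * (Q + \<epsilon>))"
      using e1 e2 by simp
    finally have "D\<^sup>2 \<le> (sqrt ((L + \<epsilon>) * (Q + \<epsilon>)))\<^sup>2"
      using assms(1) by (intro power_mono)
    then show ?thesis using pos by simp
  qed
  have "((\<lambda>\<epsilon>. (L + \<epsilon>) * (Q + \<epsilon>)) \<longlongrightarrow> (L + 0) * (Q + 0)) (at_right 0)"
    by (intro tendsto_intros)
  then show ?thesis
    using * tendsto_lowerbound[of "\<lambda>\<epsilon>. (L + \<epsilon>) * (Q + \<epsilon>)" _ "at_right 0" "D\<^sup>2"]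
    by (simp add: eventually_at_right_less eventually_at_right_field exI[of _ 1])
qed

text \<open>The time that the segment from \<open>p\<close> to \<open>y\<close> spends in \<open>T\<close>, weighted by \<open>t\<^sup>n\<close>; the part close to \<open>p\<close> is cut off.\<close>

definition ray_weight :: "'a::euclidean_space \<Rightarrow> nat \<Rightarrow> real \<Rightarrow> 'a set \<Rightarrow> 'a \<Rightarrow> real" where
  "ray_weight p n \<epsilon> T y = integral {\<epsilon>..1} (\<lambda>t. t ^ n * indicator T (p + t *\<^sub>R (y - p)))"

lemma has_integral_ray_weight:
  fixes p y :: "'a::euclidean_space"
  assumes "compact T" "convex T"
  shows "((\<lambda>t. t ^ n * indicator T (p + t *\<^sub>R (y - p))) has_integral ray_weight p n \<epsilon> T y) {\<epsilon>..1}"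
proof -
  define l where "l t = p + t *\<^sub>R (y - p)" for t
  define I where "I = {\<epsilon>..1} \<inter> l -` T"
  obtain a b where ab: "I = {a..b}"
    using line_preimage_is_interval[OF assms, of \<epsilon> p y] unfolding I_def l_def by auto
  have "(\<lambda>t::real. t ^ n) integrable_on {a..b}"
    by (intro integrable_continuous_interval continuous_intros)
  then have "(\<lambda>t. t ^ n) integrable_on ((l -` T) \<inter> {\<epsilon>..1})"
    using ab unfolding I_def by (simp add: Int_commute)
  then have "(\<lambda>t. if t \<in> l -` T then t ^ n else 0) integrable_on {\<epsilon>..1}"
    by (subst integrable_restrict_Int)
  moreover have "(\<lambda>t. if t \<in> l -` T then t ^ n else 0) = (\<lambda>t. t ^ n * indicator T (p + t *\<^sub>R (y - p)))"
    by (auto simp: l_def fun_eq_iff indicator_def)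
  ultimately show ?thesis unfolding ray_weight_def by (simp add: integrable_integral)
qed

lemma ray_weight_nonneg: "0 \<le> \<epsilon> \<Longrightarrow> 0 \<le> ray_weight p n \<epsilon> T y"
  unfolding ray_weight_def
  by (cases "(\<lambda>t. t ^ n * indicator T (p + t *\<^sub>R (y - p))) integrable_on {\<epsilon>..1}")
     (auto intro!: integral_nonneg simp: not_integrable_integral)

lemma nn_integral_ray_weight:
  fixes p y :: "'a::euclidean_space"
  assumes T: "compact T" "convex T" and \<epsilon>: "0 < \<epsilon>"
  shows "(\<integral>\<^sup>+t. ennreal (indicator {\<epsilon>..1} t * (t ^ n * indicator T (p + t *\<^sub>R (y - p)))) \<partial>lborel)
    = ennreal (ray_weight p n \<epsilon> T y)"
proof -
  have [measurable]: "T \<in> sets borel" using T by (simp add: compact_imp_closed borel_closed)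
  have "(\<lambda>t. indicator {\<epsilon>..1} t * (t ^ n * indicator T (p + t *\<^sub>R (y - p))))
      = (\<lambda>t. if t \<in> {\<epsilon>..1} then t ^ n * indicator T (p + t *\<^sub>R (y - p)) else (0::real))"
    by (auto simp: fun_eq_iff indicator_def)
  then have h: "((\<lambda>t. indicator {\<epsilon>..1} t * (t ^ n * indicator T (p + t *\<^sub>R (y - p)))) has_integral
      ray_weight p n \<epsilon> T y) UNIV"
    using has_integral_ray_weight[OF T, of n p y \<epsilon>] by (simp only: has_integral_restrict_UNIV)
  show ?thesis
  proof (rule nn_integral_has_integral_lborel[OF _ _ h])
    show "(\<lambda>t. indicator {\<epsilon>..1} t * (t ^ n * indicator T (p + t *\<^sub>R (y - p)))) \<in> borel_measurable borel"
      by measurable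
  qed (use \<epsilon> in \<open>auto simp: indicator_def\<close>)
qed

text \<open>Cauchy-Schwarz for the derivative of \<open>v\<close> along the segment, with the weights \<open>t\<^sup>n\<close> and \<open>1 / t\<^sup>n\<close>.\<close>

lemma weighted_segment_inequality:
  fixes p y :: "'a::euclidean_space" and v :: "'a \<Rightarrow> real"
  assumes fin: "finite \<T>" and comp: "\<And>T. T \<in> \<T> \<Longrightarrow> compact T \<and> convex T"
    and seg: "closed_segment p y \<subseteq> \<Union>\<T>" and cont: "continuous_on (\<Union>\<T>) v"
    and aff: "\<And>T. T \<in> \<T> \<Longrightarrow> \<exists>b. \<forall>x\<in>T. v x = inner (g T) x + b"
    and \<epsilon>: "0 < \<epsilon>" "\<epsilon> \<le> 1" and L: "((\<lambda>t. 1 / t ^ n) has_integral L) {\<epsilon>..1}"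
  shows "(v y - v (p + \<epsilon> *\<^sub>R (y - p)))\<^sup>2
           \<le> L * ((norm (y - p))\<^sup>2 * (\<Sum>T\<in>\<T>. (norm (g T))\<^sup>2 * ray_weight p n \<epsilon> T y))"
proof -
  obtain f' where f': "\<And>s t. 0 \<le> s \<Longrightarrow> s \<le> t \<Longrightarrow> t \<le> 1 \<Longrightarrow>
       (f' has_integral (v (p + t *\<^sub>R (y - p)) - v (p + s *\<^sub>R (y - p)))) {s..t}"
    "\<And>t. f' t = 0 \<or> (\<exists>T\<in>\<T>. p + t *\<^sub>R (y - p) \<in> T \<and> f' t = inner (g T) (y - p))"
    using lines_of_affine_pieces_derivative[OF fin comp seg cont aff] by blast
  define D where "D = v y - v (p + \<epsilon> *\<^sub>R (y - p))"
  have fD: "(f' has_integral D) {\<epsilon>..1}" unfolding D_def using f'(1)[of \<epsilon> 1] \<epsilon> by simp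
  define q where "q t = (\<Sum>T\<in>\<T>. (norm (g T))\<^sup>2 * (t ^ n * indicator T (p + t *\<^sub>R (y - p))))" for t
  define Q where "Q = (\<Sum>T\<in>\<T>. (norm (g T))\<^sup>2 * ray_weight p n \<epsilon> T y)"
  have qQ: "(q has_integral Q) {\<epsilon>..1}"
    unfolding q_def Q_def using comp
    by (intro has_integral_sum[OF fin] has_integral_mult_right has_integral_ray_weight) auto
  have sq: "t ^ n * (f' t)\<^sup>2 \<le> (norm (y - p))\<^sup>2 * q t" if "t > 0" for t
  proof -
    have q0: "0 \<le> q t" unfolding q_def using that by (intro sum_nonneg) auto
    from f'(2)[of t] show ?thesis
    proof
      assume "\<exists>T\<in>\<T>. p + t *\<^sub>R (y - p) \<in> T \<and> f' t = inner (g T) (y - p)"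
      then obtain T where T: "T \<in> \<T>" "p + t *\<^sub>R (y - p) \<in> T" "f' t = inner (g T) (y - p)" by blast
      have "(f' t)\<^sup>2 \<le> (norm (g T))\<^sup>2 * (norm (y - p))\<^sup>2"
        unfolding T using Cauchy_Schwarz_ineq by (simp add: power2_norm_eq_inner)
      then have "t ^ n * (f' t)\<^sup>2 \<le> t ^ n * ((norm (g T))\<^sup>2 * (norm (y - p))\<^sup>2)"
        using that by (intro mult_left_mono) auto
      also have "\<dots> = (norm (y - p))\<^sup>2 * ((norm (g T))\<^sup>2 * (t ^ n * indicator T (p + t *\<^sub>R (y - p))))"
        using T by simp
      also have "\<dots> \<le> (norm (y - p))\<^sup>2 * q t"
        unfolding q_def using that
        by (intro mult_left_mono member_le_sum[OF T(1)] fin) auto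
      finally show ?thesis .
    qed (use q0 in auto)
  qed
  have young: "\<bar>D\<bar> \<le> \<theta> / 2 * L + (norm (y - p))\<^sup>2 * Q / (2 * \<theta>)" if th: "\<theta> > 0" for \<theta>
  proof -
    define F where "F t = \<theta> / 2 * (1 / t ^ n) + 1 / (2 * \<theta>) * ((norm (y - p))\<^sup>2 * q t)" for t
    have F: "(F has_integral (\<theta> / 2 * L + 1 / (2 * \<theta>) * ((norm (y - p))\<^sup>2 * Q))) {\<epsilon>..1}"
      unfolding F_def by (intro has_integral_add has_integral_mult_right L qQ)
    have le: "\<bar>f' t\<bar> \<le> F t" if "t \<in> {\<epsilon>..1}" for t
    proof -
      have t: "t > 0" using that \<epsilon> by auto
      define w where "w = t ^ n"
      have w: "w > 0" unfolding w_def using t by simp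
      have "\<theta> / 2 * (1 / w) + 1 / (2 * \<theta>) * (w * \<bar>f' t\<bar>\<^sup>2) - \<bar>f' t\<bar> = (\<theta> - w * \<bar>f' t\<bar>)\<^sup>2 / (2 * \<theta> * w)"
        using w th by (simp add: field_simps power2_eq_square)
      moreover have "0 \<le> (\<theta> - w * \<bar>f' t\<bar>)\<^sup>2 / (2 * \<theta> * w)" using w th by simp
      ultimately have "\<bar>f' t\<bar> \<le> \<theta> / 2 * (1 / t ^ n) + 1 / (2 * \<theta>) * (t ^ n * (f' t)\<^sup>2)"
        unfolding w_def power2_abs by linarith
      also have "\<dots> \<le> F t" unfolding F_def
        using sq[OF t] th by (intro add_left_mono mult_left_mono) auto
      finally show ?thesis .
    qed
    have "D \<le> \<theta> / 2 * L + 1 / (2 * \<theta>) * ((norm (y - p))\<^sup>2 * Q)"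
      using le by (intro has_integral_le[OF fD F]) force
    moreover have "- D \<le> \<theta> / 2 * L + 1 / (2 * \<theta>) * ((norm (y - p))\<^sup>2 * Q)"
      using le by (intro has_integral_le[OF has_integral_neg[OF fD] F]) force
    ultimately show ?thesis by (auto simp: field_simps)
  qed
  have "0 \<le> L" using \<epsilon> by (intro has_integral_nonneg[OF L]) auto
  moreover have "0 \<le> Q"
    using \<epsilon> unfolding q_def by (intro has_integral_nonneg[OF qQ]) (auto simp: q_def intro!: sum_nonneg)
  ultimately have "\<bar>D\<bar>\<^sup>2 \<le> L * ((norm (y - p))\<^sup>2 * Q)"
    using young by (intro square_le_of_weighted_bounds) auto
  then show ?thesis unfolding D_def Q_def by simp
qed

text \<open>This controls the part of the segment near \<open>p\<close>, where the weighted inequality degenerates.\<close>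

lemma lipschitz_along_segment:
  fixes p y :: "'a::euclidean_space" and v :: "'a \<Rightarrow> real"
  assumes fin: "finite \<T>" and comp: "\<And>T. T \<in> \<T> \<Longrightarrow> compact T \<and> convex T"
    and seg: "closed_segment p y \<subseteq> \<Union>\<T>" and cont: "continuous_on (\<Union>\<T>) v"
    and aff: "\<And>T. T \<in> \<T> \<Longrightarrow> \<exists>b. \<forall>x\<in>T. v x = inner (g T) x + b"
    and \<epsilon>: "0 \<le> \<epsilon>" "\<epsilon> \<le> 1" and B: "\<And>T. T \<in> \<T> \<Longrightarrow> norm (g T) \<le> B" "0 \<le> B"
  shows "\<bar>v (p + \<epsilon> *\<^sub>R (y - p)) - v p\<bar> \<le> B * (\<epsilon> * norm (y - p))"
proof -
  obtain f' where f': "\<And>s t. 0 \<le> s \<Longrightarrow> s \<le> t \<Longrightarrow> t \<le> 1 \<Longrightarrow>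
       (f' has_integral (v (p + t *\<^sub>R (y - p)) - v (p + s *\<^sub>R (y - p)))) {s..t}"
    "\<And>t. f' t = 0 \<or> (\<exists>T\<in>\<T>. p + t *\<^sub>R (y - p) \<in> T \<and> f' t = inner (g T) (y - p))"
    using lines_of_affine_pieces_derivative[OF fin comp seg cont aff] by blast
  have "norm (f' t) \<le> B * norm (y - p)" for t
  proof -
    have "\<bar>inner (g T) (y - p)\<bar> \<le> B * norm (y - p)" if "T \<in> \<T>" for T
      using Cauchy_Schwarz_ineq2[of "g T" "y - p"] B(1)[OF that]
      by (meson mult_right_mono norm_ge_zero order_trans)
    then show ?thesis using f'(2)[of t] B(2) by auto
  qed
  then have "norm (v (p + \<epsilon> *\<^sub>R (y - p)) - v (p + 0 *\<^sub>R (y - p))) \<le> B * norm (y - p) * measure lborel {0..\<epsilon>}"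
    using B(2) f'(1)[of 0 \<epsilon>] \<epsilon> by (intro has_integral_bound_real[where f = f']) auto
  then show ?thesis using \<epsilon> by (simp add: mult_ac)
qed

lemma nn_integral_affine_change:
  fixes p :: "'a::euclidean_space"
  assumes [measurable]: "F \<in> borel_measurable borel" and t: "0 < t"
  shows "ennreal (t ^ DIM('a)) * (\<integral>\<^sup>+y. F (p + t *\<^sub>R (y - p)) \<partial>lborel) = (\<integral>\<^sup>+z. F z \<partial>lborel)"
proof -
  have "(\<integral>\<^sup>+z. F z \<partial>lborel) = (\<integral>\<^sup>+z. F z \<partial>(density (distr lborel borel (\<lambda>x. (p - t *\<^sub>R p) + t *\<^sub>R x)) (\<lambda>_. ennreal (\<bar>t\<bar>^DIM('a)))))"
    using lborel_affine[of t "p - t *\<^sub>R p"] t by simp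
  also have "\<dots> = ennreal (t ^ DIM('a)) * (\<integral>\<^sup>+y. F ((p - t *\<^sub>R p) + t *\<^sub>R y) \<partial>lborel)"
    using t by (simp add: nn_integral_density nn_integral_distr nn_integral_cmult)
  also have "(\<lambda>y. F ((p - t *\<^sub>R p) + t *\<^sub>R y)) = (\<lambda>y. F (p + t *\<^sub>R (y - p)))"
    by (simp add: algebra_simps)
  finally show ?thesis by simp
qed

text \<open>This is integration in polar coordinates around \<open>p\<close>. After the substitution \<open>z = p + t (y - p)\<close> the
  weight \<open>t\<close> to the power \<open>DIM('a) - 1\<close> leaves \<open>1 / t\<close> of the Jacobian. A point \<open>z\<close> is reached
  from \<open>B\<close> only for parameters \<open>t\<close> between \<open>norm (z - p) / R\<close> and \<open>norm (z - p) / r\<close>, over which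
  \<open>1 / t\<close> has a bounded integral. So averaging over \<open>y\<close> turns weighted line integrals into a
  multiple of the volume integral.\<close>

lemma nn_integral_ray_weight_le:
  fixes p :: "'a::euclidean_space"
  assumes T: "compact T" "convex T" and B: "B \<in> sets borel"
    and r: "0 < r" "0 < R" and Br: "\<And>y. y \<in> B \<Longrightarrow> r \<le> norm (y - p) \<and> norm (y - p) \<le> R"
    and \<epsilon>: "0 < \<epsilon>"
  shows "(\<integral>\<^sup>+y. indicator B y * ennreal (ray_weight p (DIM('a) - 1) \<epsilon> T y) \<partial>lborel)
           \<le> ennreal (R / r) * emeasure lborel T"
proof -
  define d where "d = DIM('a)"
  have d: "d \<ge> 1" unfolding d_def using DIM_positive[where 'a='a] by linarith
  define G where "G y t = indicator B y * (indicator {\<epsilon>..1} t * (ennreal (t ^ (d - 1)) * indicator T (p + t *\<^sub>R (y - p))))"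
    for y :: 'a and t :: real
  have [measurable]: "T \<in> sets borel" using T by (simp add: compact_imp_closed borel_closed)
  note [measurable] = B
  have meas: "(\<lambda>(y, t). G y t) \<in> borel_measurable (lborel \<Otimes>\<^sub>M lborel)"
    unfolding G_def by measurable
  have w: "(\<integral>\<^sup>+t. G y t \<partial>lborel) = indicator B y * ennreal (ray_weight p (d - 1) \<epsilon> T y)" for y
  proof -
    note nn_integral_ray_weight[OF T \<epsilon>, of "d - 1" p y]
    moreover have "G y t = indicator B y * ennreal (indicator {\<epsilon>..1} t * (t ^ (d - 1) * indicator T (p + t *\<^sub>R (y - p))))" for t
      using \<epsilon> by (auto simp: G_def indicator_def)
    ultimately show ?thesis by (simp add: nn_integral_cmult)
  qed
  have inner_y: "(\<integral>\<^sup>+y. G y t \<partial>lborel) = (\<integral>\<^sup>+z. indicator T z * (indicator {\<epsilon>..1} t * (ennreal (1 / t) * indicator B (p + (1 / t) *\<^sub>R (z - p)))) \<partial>lborel)" for t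
  proof (cases "t \<in> {\<epsilon>..1}")
    case True
    then have t: "t > 0" using \<epsilon> by auto
    define F where "F z = (indicator T z * (ennreal (1 / t) * indicator B (p + (1 / t) *\<^sub>R (z - p))))" for z
    have F: "F (p + t *\<^sub>R (y - p)) = ennreal (1 / t) * (indicator B y * indicator T (p + t *\<^sub>R (y - p)))" for y
      using t unfolding F_def by (simp add: mult_ac)
    have [measurable]: "F \<in> borel_measurable borel" unfolding F_def by measurable
    have td: "t ^ d * (1 / t) = t ^ (d - 1)" using d t by (cases d) auto
    have "(\<integral>\<^sup>+z. F z \<partial>lborel) = ennreal (t ^ d) * (\<integral>\<^sup>+y. ennreal (1 / t) * (indicator B y * indicator T (p + t *\<^sub>R (y - p))) \<partial>lborel)"
      using nn_integral_affine_change[of F t p] t unfolding F d_def by simp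
    also have "\<dots> = (\<integral>\<^sup>+y. ennreal (t ^ d) * (ennreal (1 / t) * (indicator B y * indicator T (p + t *\<^sub>R (y - p)))) \<partial>lborel)"
      by (subst nn_integral_cmult) auto
    also have "\<dots> = (\<integral>\<^sup>+y. G y t \<partial>lborel)"
      unfolding G_def using True t td
      by (intro nn_integral_cong) (simp add: mult.assoc[symmetric] ennreal_mult'[symmetric] indicator_def)
    finally show ?thesis using True unfolding F_def by simp
  qed (simp add: G_def)
  have inner_t: "(\<integral>\<^sup>+t. indicator {\<epsilon>..1} t * (ennreal (1 / t) * indicator B (p + (1 / t) *\<^sub>R (z - p))) \<partial>lborel)
      \<le> ennreal (R / r)" (is "?I \<le> _") for z
  proof (cases "z = p")
    case True
    then have "p \<notin> B" using Br[of p] r by auto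
    then show ?thesis using True by simp
  next
    case False
    define m where "m = norm (z - p)"
    have m: "m > 0" using False unfolding m_def by simp
    \<comment> \<open>The exact value of the integral is at most \<open>ln (R / r)\<close>; bounding \<open>1 / t\<close> by its largest value gives \<open>R / r\<close>.\<close>
    have pt: "indicator {\<epsilon>..1} t * (ennreal (1 / t) * indicator B (p + (1 / t) *\<^sub>R (z - p)))
          \<le> ennreal (R / m) * indicator {0..m / r} t" for t
    proof (cases "t \<in> {\<epsilon>..1} \<and> p + (1 / t) *\<^sub>R (z - p) \<in> B")
      case True
      then have t: "t > 0" using \<epsilon> by auto
      have "r \<le> m / t" "m / t \<le> R"
        using Br[of "p + (1 / t) *\<^sub>R (z - p)"] True t unfolding m_def by auto
      then have "t \<le> m / r" "1 / t \<le> R / m"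
        using t m r by (auto simp: field_simps)
      then show ?thesis using t True by (auto simp: indicator_def intro!: ennreal_leI)
    qed (auto simp: indicator_def)
    have "?I \<le> (\<integral>\<^sup>+t. ennreal (R / m) * indicator {0..m / r} t \<partial>lborel)"
      by (intro nn_integral_mono pt)
    also have "\<dots> = ennreal (R / m) * ennreal (m / r)"
      using m r by (subst nn_integral_cmult_indicator) auto
    also have "\<dots> = ennreal (R / r)"
      using m r by (simp add: ennreal_mult'[symmetric])
    finally show ?thesis .
  qed
  have "(\<integral>\<^sup>+y. indicator B y * ennreal (ray_weight p (d - 1) \<epsilon> T y) \<partial>lborel)
      = (\<integral>\<^sup>+y. (\<integral>\<^sup>+t. G y t \<partial>lborel) \<partial>lborel)"
    unfolding w ..
  also have "\<dots> = (\<integral>\<^sup>+t. (\<integral>\<^sup>+y. G y t \<partial>lborel) \<partial>lborel)"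
    using lborel_pair.Fubini'[OF meas] by simp
  also have "\<dots> = (\<integral>\<^sup>+t. (\<integral>\<^sup>+z. indicator T z * (indicator {\<epsilon>..1} t * (ennreal (1 / t) * indicator B (p + (1 / t) *\<^sub>R (z - p)))) \<partial>lborel) \<partial>lborel)"
    unfolding inner_y ..
  also have "\<dots> = (\<integral>\<^sup>+z. (\<integral>\<^sup>+t. indicator T z * (indicator {\<epsilon>..1} t * (ennreal (1 / t) * indicator B (p + (1 / t) *\<^sub>R (z - p)))) \<partial>lborel) \<partial>lborel)"
    by (intro lborel_pair.Fubini') measurable
  also have "\<dots> = (\<integral>\<^sup>+z. indicator T z * (\<integral>\<^sup>+t. (indicator {\<epsilon>..1} t * (ennreal (1 / t) * indicator B (p + (1 / t) *\<^sub>R (z - p)))) \<partial>lborel) \<partial>lborel)"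
    by (intro nn_integral_cong nn_integral_cmult) measurable
  also have "\<dots> \<le> (\<integral>\<^sup>+z. ennreal (R / r) * indicator T z \<partial>lborel)"
    by (subst mult.commute[of "ennreal (R / r)"]) (intro nn_integral_mono mult_left_mono inner_t zero_le)
  also have "\<dots> = ennreal (R / r) * emeasure lborel T"
    by (subst nn_integral_cmult_indicator) auto
  finally show ?thesis unfolding d_def .
qed

lemma ray_weight_measurable:
  fixes p :: "'a::euclidean_space"
  assumes T: "compact T" "convex T" and \<epsilon>: "0 < \<epsilon>"
  shows "ray_weight p n \<epsilon> T \<in> borel_measurable borel"
proof -
  have [measurable]: "T \<in> sets borel" using T by (simp add: compact_imp_closed borel_closed)
  have eq: "ray_weight p n \<epsilon> T y = enn2real (\<integral>\<^sup>+t. ennreal (indicator {\<epsilon>..1} t * (t ^ n * indicator T (p + t *\<^sub>R (y - p)))) \<partial>lborel)" for y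
    using nn_integral_ray_weight[OF T \<epsilon>, of n p y] \<epsilon> by (simp add: ray_weight_nonneg)
  show ?thesis unfolding eq[abs_def] by measurable
qed

text \<open>Both points are joined to a common point \<open>y\<close> of the ball with half the radius. On average over \<open>y\<close>
  the weighted energy along the two segments is bounded by the total energy, so some \<open>y\<close> is good for
  both. The last pieces of relative length \<open>h / H\<close> at \<open>p\<close> and \<open>c\<close> are short and are treated with the
  largest gradient \<open>B\<close>. The growth in \<open>H / h\<close> sits in \<open>L\<close>: for the dimensions 2 and 3 it is
  \<open>ln (H / h)\<close> and \<open>H / h - 1\<close>.\<close>

lemma discrete_sobolev_difference:
  fixes K :: "'a::euclidean_space set" and v :: "'a \<Rightarrow> real"
  assumes fin: "finite \<T>" and comp: "\<And>T. T \<in> \<T> \<Longrightarrow> compact T \<and> convex T"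
    and K: "convex K" "K \<subseteq> \<Union>\<T>" and ball: "0 < \<rho>" "cball x0 \<rho> \<subseteq> K"
    and diam: "\<And>x y. x \<in> K \<Longrightarrow> y \<in> K \<Longrightarrow> dist x y \<le> H"
    and cont: "continuous_on (\<Union>\<T>) v"
    and aff: "\<And>T. T \<in> \<T> \<Longrightarrow> \<exists>b. \<forall>x\<in>T. v x = inner (g T) x + b"
    and pc: "p \<in> K" "c \<in> K" "\<rho> \<le> dist x0 p" "\<rho> \<le> dist x0 c"
    and h: "0 < h" "h \<le> H"
    and L: "((\<lambda>t. 1 / t ^ (DIM('a) - 1)) has_integral L) {h / H..1}"
    and B: "\<And>T. T \<in> \<T> \<Longrightarrow> norm (g T) \<le> B" "0 \<le> B"
    and E: "E = (\<Sum>T\<in>\<T>. (norm (g T))\<^sup>2 * measure lborel T)"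
  shows "(v p - v c)\<^sup>2 \<le> 8 * (h * B)\<^sup>2
     + 16 * L * H\<^sup>2 * (H / \<rho>) * E / measure lborel (ball x0 (\<rho> / 2))"
proof -
  define d where "d = DIM('a)"
  define \<epsilon> where "\<epsilon> = h / H"
  have H: "H > 0" using h by auto
  have \<epsilon>: "0 < \<epsilon>" "\<epsilon> \<le> 1" unfolding \<epsilon>_def using h by auto
  \<comment> \<open>Points of \<open>U\<close> keep the distance \<open>\<rho> / 2\<close> from \<open>p\<close> and \<open>c\<close>, which polar coordinates require.\<close>
  define U where "U = ball x0 (\<rho> / 2)"
  have UK: "U \<subseteq> K" using ball unfolding U_def by auto
  have L0: "0 \<le> L" using \<epsilon> unfolding \<epsilon>_def[symmetric]
    by (intro has_integral_nonneg[OF L]) (auto simp: \<epsilon>_def[symmetric])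
  define \<mu> where "\<mu> = measure lborel U"
  have \<mu>: "\<mu> > 0" unfolding \<mu>_def U_def using ball by simp
  have emU: "emeasure lborel U = ennreal \<mu>" unfolding \<mu>_def U_def
    using emeasure_lborel_ball_finite[of x0 "\<rho> / 2"] by (intro emeasure_eq_ennreal_measure) (simp add: less_top)
  define Q where "Q z y = (\<Sum>T\<in>\<T>. (norm (g T))\<^sup>2 * ray_weight z (d - 1) \<epsilon> T y)" for z y
  have Q0: "0 \<le> Q z y" for z y
    unfolding Q_def using \<epsilon> by (intro sum_nonneg mult_nonneg_nonneg ray_weight_nonneg) auto
  have Qm[measurable]: "Q z \<in> borel_measurable borel" for z
    unfolding Q_def using \<epsilon> comp by (auto intro!: borel_measurable_sum borel_measurable_times ray_weight_measurable)
  have E0: "0 \<le> E" unfolding E by (intro sum_nonneg) auto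
  have [measurable]: "U \<in> sets borel" unfolding U_def by simp
  have Qint: "(\<integral>\<^sup>+y. indicator U y * ennreal (Q z y) \<partial>lborel) \<le> ennreal (2 * H / \<rho> * E)"
    if z: "z \<in> K" "\<rho> \<le> dist x0 z" for z
  proof -
    have far: "\<rho> / 2 \<le> norm (y - z) \<and> norm (y - z) \<le> H" if "y \<in> U" for y
    proof -
      have "norm (y - z) = dist y z" by (simp add: dist_norm)
      moreover have "dist x0 z \<le> dist x0 y + dist y z" by (rule dist_triangle)
      moreover have "dist x0 y < \<rho> / 2" using that unfolding U_def by simp
      moreover have "dist y z \<le> H" using diam UK z that by auto
      ultimately show ?thesis using z by simp
    qed
    have "(\<integral>\<^sup>+y. indicator U y * ennreal (Q z y) \<partial>lborel)
        = (\<integral>\<^sup>+y. (\<Sum>T\<in>\<T>. ennreal ((norm (g T))\<^sup>2) * (indicator U y * ennreal (ray_weight z (d - 1) \<epsilon> T y))) \<partial>lborel)"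
      unfolding Q_def using \<epsilon>
      by (intro nn_integral_cong)
         (simp add: sum_ennreal[symmetric] ray_weight_nonneg ennreal_mult' sum_distrib_left mult_ac)
    also have "\<dots> = (\<Sum>T\<in>\<T>. ennreal ((norm (g T))\<^sup>2) * (\<integral>\<^sup>+y. indicator U y * ennreal (ray_weight z (d - 1) \<epsilon> T y) \<partial>lborel))"
    proof -
      have m: "(\<lambda>y. indicator U y * ennreal (ray_weight z (d - 1) \<epsilon> T y)) \<in> borel_measurable lborel"
        if "T \<in> \<T>" for T
      proof -
        have [measurable]: "ray_weight z (d - 1) \<epsilon> T \<in> borel_measurable borel"
          using \<epsilon> comp[OF that] by (intro ray_weight_measurable) auto
        show ?thesis by measurable
      qed
      show ?thesis using m
        by (subst nn_integral_sum) (auto intro!: sum.cong nn_integral_cmult)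
    qed
    also have "\<dots> \<le> (\<Sum>T\<in>\<T>. ennreal ((norm (g T))\<^sup>2) * (ennreal (H / (\<rho> / 2)) * emeasure lborel T))"
      unfolding d_def using comp far ball H \<epsilon>
      by (intro sum_mono mult_left_mono nn_integral_ray_weight_le) auto
    also have "\<dots> = (\<Sum>T\<in>\<T>. ennreal (2 * H / \<rho> * ((norm (g T))\<^sup>2 * measure lborel T)))"
    proof (intro sum.cong refl)
      fix T assume "T \<in> \<T>"
      then have "emeasure lborel T = ennreal (measure lborel T)"
        using comp emeasure_lborel_cbox_finite emeasure_compact_finite[of T]
        by (intro emeasure_eq_ennreal_measure) (auto simp: less_top)
      then show "ennreal ((norm (g T))\<^sup>2) * (ennreal (H / (\<rho> / 2)) * emeasure lborel T)
          = ennreal (2 * H / \<rho> * ((norm (g T))\<^sup>2 * measure lborel T))"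
        using H ball by (simp add: ennreal_mult'[symmetric] mult_ac)
    qed
    also have "\<dots> = ennreal (2 * H / \<rho> * E)"
      unfolding E using H ball by (subst sum_ennreal) (auto simp: sum_distrib_left)
    finally show ?thesis .
  qed
  define M where "M = 4 * H / \<rho> * E / \<mu>"
  have M0: "0 \<le> M" unfolding M_def using H ball E0 \<mu> by simp
  have ex: "\<exists>y\<in>U. Q p y + Q c y \<le> M + \<delta>" if \<delta>: "\<delta> > 0" for \<delta>
  proof (rule ccontr)
    assume "\<not> ?thesis"
    then have gt: "M + \<delta> \<le> Q p y + Q c y" if "y \<in> U" for y using that by force
    have "ennreal ((M + \<delta>) * \<mu>) = (\<integral>\<^sup>+y. ennreal (M + \<delta>) * indicator U y \<partial>lborel)"
      using M0 \<delta> \<mu> by (subst nn_integral_cmult_indicator) (auto simp: emU ennreal_mult')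
    also have "\<dots> \<le> (\<integral>\<^sup>+y. indicator U y * ennreal (Q p y) + indicator U y * ennreal (Q c y) \<partial>lborel)"
      using gt Q0 by (intro nn_integral_mono) (auto simp: indicator_def ennreal_plus[symmetric] simp del: ennreal_plus intro!: ennreal_leI)
    also have "\<dots> = (\<integral>\<^sup>+y. indicator U y * ennreal (Q p y) \<partial>lborel) + (\<integral>\<^sup>+y. indicator U y * ennreal (Q c y) \<partial>lborel)"
      by (intro nn_integral_add) measurable
    also have "\<dots> \<le> ennreal (2 * H / \<rho> * E) + ennreal (2 * H / \<rho> * E)"
      using pc by (intro add_mono Qint) auto
    also have "\<dots> = ennreal (M * \<mu>)"
      unfolding M_def using H ball E0 \<mu> by (subst ennreal_plus[symmetric]) (auto simp: field_simps)
    finally have "(M + \<delta>) * \<mu> \<le> M * \<mu>" using M0 \<mu> by (subst (asm) ennreal_le_iff) auto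
    then show False using \<delta> \<mu> by (simp add: algebra_simps mult_le_0_iff)
  qed
  have near: "\<bar>v (z + \<epsilon> *\<^sub>R (y - z)) - v z\<bar> \<le> h * B" 
    and mid: "(v y - v (z + \<epsilon> *\<^sub>R (y - z)))\<^sup>2 \<le> L * (H\<^sup>2 * Q z y)" if "z \<in> K" "y \<in> U" for z y
  proof -
    have seg: "closed_segment z y \<subseteq> \<Union>\<T>"
      using K UK that closed_segment_subset[of z K y] by auto
    have nyz: "norm (y - z) \<le> H" using diam[of y z] UK that by (auto simp: dist_norm)
    have "\<bar>v (z + \<epsilon> *\<^sub>R (y - z)) - v z\<bar> \<le> B * (\<epsilon> * norm (y - z))"
      using \<epsilon> by (intro lipschitz_along_segment[OF fin comp seg cont aff _ _ B]) auto
    also have "\<dots> \<le> B * (\<epsilon> * H)" using nyz B \<epsilon> by (intro mult_left_mono) auto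
    also have "\<dots> = h * B" unfolding \<epsilon>_def using H by simp
    finally show "\<bar>v (z + \<epsilon> *\<^sub>R (y - z)) - v z\<bar> \<le> h * B" .
    have "(v y - v (z + \<epsilon> *\<^sub>R (y - z)))\<^sup>2 \<le> L * ((norm (y - z))\<^sup>2 * Q z y)"
      unfolding Q_def d_def
      by (intro weighted_segment_inequality[OF fin comp seg cont aff \<epsilon>])
         (use L in \<open>auto simp: \<epsilon>_def\<close>)
    also have "\<dots> \<le> L * (H\<^sup>2 * Q z y)"
      using L0 Q0 nyz by (intro mult_left_mono mult_right_mono power_mono) auto
    finally show "(v y - v (z + \<epsilon> *\<^sub>R (y - z)))\<^sup>2 \<le> L * (H\<^sup>2 * Q z y)" .
  qed
  have main: "(v p - v c)\<^sup>2 \<le> 8 * (h * B)\<^sup>2 + 4 * L * H\<^sup>2 * (M + \<delta>)" if "\<delta> > 0" for \<delta>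
  proof -
    obtain y where y: "y \<in> U" "Q p y + Q c y \<le> M + \<delta>" using ex[OF \<open>\<delta> > 0\<close>] by auto
    define a1 where "a1 = v (p + \<epsilon> *\<^sub>R (y - p)) - v p"
    define a2 where "a2 = v y - v (p + \<epsilon> *\<^sub>R (y - p))"
    define a3 where "a3 = v (c + \<epsilon> *\<^sub>R (y - c)) - v c"
    define a4 where "a4 = v y - v (c + \<epsilon> *\<^sub>R (y - c))"
    have hB: "0 \<le> h * B" using h B by simp
    have "a1\<^sup>2 \<le> (h * B)\<^sup>2" "a3\<^sup>2 \<le> (h * B)\<^sup>2"
      using near pc y hB unfolding a1_def a3_def by (auto intro!: power2_le_iff_abs_le[THEN iffD2])
    moreover have "a2\<^sup>2 \<le> L * (H\<^sup>2 * Q p y)" "a4\<^sup>2 \<le> L * (H\<^sup>2 * Q c y)"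
      using mid pc y unfolding a2_def a4_def by auto
    moreover have "(v p - v c)\<^sup>2 = (a3 + a4 - a1 - a2)\<^sup>2" unfolding a1_def a2_def a3_def a4_def by simp
    moreover have "(a3 + a4 - a1 - a2)\<^sup>2 \<le> 4 * (a1\<^sup>2 + a2\<^sup>2 + a3\<^sup>2 + a4\<^sup>2)"
    proof -
      have "4 * (a1\<^sup>2 + a2\<^sup>2 + a3\<^sup>2 + a4\<^sup>2) - (a3 + a4 - a1 - a2)\<^sup>2
        = (a3 - a4)\<^sup>2 + (a3 + a1)\<^sup>2 + (a3 + a2)\<^sup>2 + (a4 + a1)\<^sup>2 + (a4 + a2)\<^sup>2 + (a1 - a2)\<^sup>2"
        by (simp add: power2_eq_square algebra_simps)
      then show ?thesis by (smt (verit) zero_le_power2)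
    qed
    moreover have "X \<le> 8 * e + 4 * (q1 + q2)"
      if "b1 \<le> e" "b3 \<le> e" "b2 \<le> q1" "b4 \<le> q2" "X = Y" "Y \<le> 4 * (b1 + b2 + b3 + b4)" for X Y b1 b2 b3 b4 e q1 q2 :: real
      using that by (simp add: algebra_simps)
    ultimately have "(v p - v c)\<^sup>2 \<le> 8 * (h * B)\<^sup>2 + 4 * (L * (H\<^sup>2 * Q p y) + L * (H\<^sup>2 * Q c y))" by blast
    also have "\<dots> = 8 * (h * B)\<^sup>2 + 4 * L * H\<^sup>2 * (Q p y + Q c y)" by (simp add: algebra_simps)
    also have "\<dots> \<le> 8 * (h * B)\<^sup>2 + 4 * L * H\<^sup>2 * (M + \<delta>)"
      using y L0 by (intro add_left_mono mult_left_mono) auto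
    finally show ?thesis .
  qed
  have "((\<lambda>\<delta>. 8 * (h * B)\<^sup>2 + 4 * L * H\<^sup>2 * (M + \<delta>)) \<longlongrightarrow> 8 * (h * B)\<^sup>2 + 4 * L * H\<^sup>2 * (M + 0)) (at_right 0)"
    by (intro tendsto_intros)
  then have "(v p - v c)\<^sup>2 \<le> 8 * (h * B)\<^sup>2 + 4 * L * H\<^sup>2 * (M + 0)"
  proof (rule tendsto_lowerbound)
    show "\<forall>\<^sub>F \<delta> in at_right 0. (v p - v c)\<^sup>2 \<le> 8 * (h * B)\<^sup>2 + 4 * L * H\<^sup>2 * (M + \<delta>)"
      using eventually_at_right_less[of "0::real"] by eventually_elim (rule main)
  qed simp
  then show ?thesis unfolding M_def \<mu>_def U_def by (simp add: mult_ac)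
qed

section \<open>Packing and counting elements\<close>

lemma packing_bound:
  fixes \<S> :: "'a::euclidean_space set set"
  assumes fin: "finite \<S>" and r: "0 \<le> r"
    and ball: "\<And>T. T \<in> \<S> \<Longrightarrow> \<exists>x. cball x r \<subseteq> T"
    and disj: "\<And>T T'. T \<in> \<S> \<Longrightarrow> T' \<in> \<S> \<Longrightarrow> T \<noteq> T' \<Longrightarrow> interior T \<inter> interior T' = {}"
    and W: "\<And>T. T \<in> \<S> \<Longrightarrow> T \<subseteq> W" "W \<in> lmeasurable"
  shows "real (card \<S>) * (unit_ball_vol (DIM('a)) * r ^ DIM('a)) \<le> measure lebesgue W"
proof -
  obtain x where x: "\<And>T. T \<in> \<S> \<Longrightarrow> cball (x T) r \<subseteq> T" using ball by metis
  have bi: "ball (x T) r \<subseteq> interior T" if "T \<in> \<S>" for T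
    using interior_maximal[OF order_trans[OF ball_subset_cball x[OF that]] open_ball] .
  have dis: "disjoint_family_on (\<lambda>T. ball (x T) r) \<S>"
    unfolding disjoint_family_on_def using bi disj by blast
  have eq: "measure lebesgue (\<Union>T\<in>\<S>. ball (x T) r) = (\<Sum>T\<in>\<S>. measure lebesgue (ball (x T) r))"
    by (intro measure_finite_Union fin dis) (use emeasure_lborel_ball_finite in \<open>auto simp: less_top\<close>)
  have sum: "(\<Sum>T\<in>\<S>. measure lebesgue (ball (x T) r)) = real (card \<S>) * (unit_ball_vol (DIM('a)) * r ^ DIM('a))"
    using r by (simp add: content_ball)
  have "measure lebesgue (\<Union>T\<in>\<S>. ball (x T) r) \<le> measure lebesgue W"
  proof (rule measure_mono_fmeasurable[OF _ _ W(2)])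
    show "(\<Union>T\<in>\<S>. ball (x T) r) \<subseteq> W" using bi W(1) interior_subset by blast
    show "(\<Union>T\<in>\<S>. ball (x T) r) \<in> sets lebesgue" using fin by auto
  qed
  then show ?thesis unfolding eq sum .
qed

text \<open>The layer lies in \<open>K\<close> dilated by \<open>1 + \<epsilon>\<close> about the centre of its inscribed ball, and it avoids \<open>K\<close>
  contracted by \<open>1 - \<epsilon>\<close>, for \<open>\<epsilon> = 2 h / \<rho>\<close>. The difference of the two volumes is of order \<open>\<epsilon>\<close>.\<close>

lemma boundary_layer_measure:
  fixes K :: "'a::euclidean_space set"
  assumes K: "compact K" "convex K" and \<rho>: "0 < \<rho>" "cball x0 \<rho> \<subseteq> K" and h: "0 < h"
    and e: "2 * h / \<rho> \<le> e" and d: "DIM('a) \<le> 3"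
  shows "(\<Union>q\<in>frontier K. cball q h) \<in> lmeasurable"
    and "measure lebesgue (\<Union>q\<in>frontier K. cball q h) \<le> 16 * (1 + e)\<^sup>2 * (h / \<rho>) * measure lebesgue K"
proof -
  \<comment> \<open>The factor 2 keeps points at distance exactly \<open>h\<close> strictly away from the contracted body.\<close>
  define \<epsilon> where "\<epsilon> = 2 * h / \<rho>"
  have \<epsilon>: "0 < \<epsilon>" "\<epsilon> * \<rho> = 2 * h" unfolding \<epsilon>_def using h \<rho> by auto
  define W where "W = (\<Union>q\<in>frontier K. cball q h)"
  define Z where "Z r = (\<lambda>x. r *\<^sub>R x + (1 - r) *\<^sub>R x0) ` K" for r
  have "compact W"
  proof -
    have "W = {x + y | x y. x \<in> frontier K \<and> y \<in> cball 0 h}"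
      unfolding W_def
    proof (intro Set.set_eqI iffI)
      fix z assume "z \<in> (\<Union>q\<in>frontier K. cball q h)"
      then obtain q where "q \<in> frontier K" "dist q z \<le> h" by auto
      then show "z \<in> {x + y | x y. x \<in> frontier K \<and> y \<in> cball 0 h}"
        by (intro CollectI exI[of _ q] exI[of _ "z - q"]) (auto simp: dist_norm norm_minus_commute)
    next
      fix z assume "z \<in> {x + y | x y. x \<in> frontier K \<and> y \<in> cball 0 h}"
      then obtain x y where "x \<in> frontier K" "norm y \<le> h" "z = x + y" by auto
      then show "z \<in> (\<Union>q\<in>frontier K. cball q h)"
        by (intro UN_I[of x]) (auto simp: dist_norm)
    qed
    moreover have "compact (frontier K)" using K by (simp add: compact_frontier)
    ultimately show ?thesis using compact_sums[of "frontier K" "cball (0::'a) h"] by simp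
  qed
  then show Wm: "(\<Union>q\<in>frontier K. cball q h) \<in> lmeasurable"
    unfolding W_def[symmetric] by (rule lmeasurable_compact)
  have Km: "K \<in> lmeasurable" using K by (intro lmeasurable_compact)
  have Zc: "compact (Z r)" for r
    unfolding Z_def using K by (intro compact_continuous_image continuous_intros)
  have Zm: "Z r \<in> lmeasurable" for r using Zc by (rule lmeasurable_compact)
  have Zmeas: "measure lebesgue (Z r) = r ^ DIM('a) * measure lebesgue K" if "0 \<le> r" for r
    unfolding Z_def using measure_lebesgue_affine[of r "(1 - r) *\<^sub>R x0" K] that by simp
  have outer: "W \<subseteq> Z (1 + \<epsilon>)"
  proof
    fix z assume "z \<in> W"
    then obtain q where q: "q \<in> frontier K" "dist q z \<le> h" unfolding W_def by auto
    have qK: "q \<in> K" using q(1) K frontier_subset_closed[OF compact_imp_closed] by auto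
    define w where "w = x0 + (1 / \<epsilon>) *\<^sub>R (z - q)"
    have "norm (w - x0) = norm (z - q) / \<epsilon>" unfolding w_def using \<epsilon> by simp
    also have "\<dots> \<le> h / \<epsilon>" using q(2) \<epsilon> by (intro divide_right_mono) (auto simp: dist_norm norm_minus_commute)
    also have "\<dots> \<le> \<rho>" unfolding \<epsilon>_def using h \<rho> by simp
    finally have wK: "w \<in> K" using \<rho>(2) by (auto simp: dist_norm norm_minus_commute)
    define k where "k = (1 / (1 + \<epsilon>)) *\<^sub>R q + (\<epsilon> / (1 + \<epsilon>)) *\<^sub>R w"
    have "k \<in> K" unfolding k_def using K(2) qK wK \<epsilon> by (intro convexD) (auto simp: field_simps)
    moreover have "z = (1 + \<epsilon>) *\<^sub>R k + (1 - (1 + \<epsilon>)) *\<^sub>R x0"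
    proof -
      have "(1 + \<epsilon>) *\<^sub>R k = q + \<epsilon> *\<^sub>R w" unfolding k_def using \<epsilon> by (simp add: scaleR_add_right)
      also have "\<dots> = z + \<epsilon> *\<^sub>R x0" unfolding w_def using \<epsilon> by (simp add: scaleR_add_right)
      finally show ?thesis by simp
    qed
    ultimately show "z \<in> Z (1 + \<epsilon>)" unfolding Z_def by blast
  qed
  have inner: "W \<inter> Z (1 - \<epsilon>) = {}" if "\<epsilon> < 1"
  proof (rule ccontr)
    assume "W \<inter> Z (1 - \<epsilon>) \<noteq> {}"
    then obtain z where zW: "z \<in> W" and zZ: "z \<in> Z (1 - \<epsilon>)" by blast
    obtain q where q: "q \<in> frontier K" "dist q z \<le> h" using zW unfolding W_def by auto
    obtain k where k: "k \<in> K" "z = (1 - \<epsilon>) *\<^sub>R k + \<epsilon> *\<^sub>R x0" using zZ unfolding Z_def by auto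
    note z = q k
    have "ball z (2 * h) \<subseteq> K"
    proof
      fix y assume y: "y \<in> ball z (2 * h)"
      define w where "w = x0 + (1 / \<epsilon>) *\<^sub>R (y - z)"
      have "norm (w - x0) = norm (y - z) / \<epsilon>" unfolding w_def using \<epsilon> by simp
      also have "\<dots> \<le> 2 * h / \<epsilon>" using y \<epsilon> by (intro divide_right_mono) (auto simp: dist_norm norm_minus_commute)
      also have "\<dots> = \<rho>" unfolding \<epsilon>_def using h \<rho> by simp
      finally have "w \<in> K" using \<rho>(2) by (auto simp: dist_norm norm_minus_commute)
      moreover have "y = (1 - \<epsilon>) *\<^sub>R k + \<epsilon> *\<^sub>R w" unfolding w_def z(4) using \<epsilon> by (simp add: scaleR_add_right)
      ultimately show "y \<in> K" using K(2) z(3) \<epsilon> that by (auto intro: convexD)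
    qed
    then have "ball z (2 * h) \<subseteq> interior K" by (simp add: interior_maximal)
    moreover have "q \<in> ball z (2 * h)" using z(2) h by (simp add: dist_commute)
    ultimately show False using z(1) by (auto simp: frontier_def)
  qed
  let ?k = "measure lebesgue K"
  have k0: "0 \<le> ?k" by simp
  have le1: "measure lebesgue W \<le> (1 + \<epsilon>) ^ DIM('a) * ?k"
    using measure_mono_fmeasurable[OF outer _ Zm] Wm Zmeas[of "1 + \<epsilon>"] \<epsilon> unfolding W_def[symmetric]
    by (auto simp: fmeasurableD)
  have dpos: "1 \<le> DIM('a)" using DIM_positive[where 'a='a] by linarith
  have \<epsilon>e: "\<epsilon> \<le> e" unfolding \<epsilon>_def by (rule e)
  have sq: "1 \<le> (1 + \<epsilon>)\<^sup>2" "(1 + \<epsilon>)\<^sup>2 \<le> (1 + e)\<^sup>2" using \<epsilon> \<epsilon>e by (auto intro: power_mono)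
  \<comment> \<open>For \<open>\<epsilon> \<ge> 1\<close> the volume of the dilated body alone is of order \<open>\<epsilon>\<close>, as \<open>\<epsilon> \<le> e\<close>.\<close>
  have "measure lebesgue W \<le> 8 * \<epsilon> * (1 + \<epsilon>)\<^sup>2 * ?k"
  proof (cases "\<epsilon> < 1")
    case False
    have "(1 + \<epsilon>) ^ DIM('a) \<le> (1 + \<epsilon>) ^ 3" using \<epsilon> d by (intro power_increasing) auto
    also have "\<dots> = (1 + \<epsilon>) * (1 + \<epsilon>)\<^sup>2" by (simp add: power3_eq_cube power2_eq_square)
    also have "\<dots> \<le> (8 * \<epsilon>) * (1 + \<epsilon>)\<^sup>2" using False by (intro mult_right_mono) auto
    finally have "(1 + \<epsilon>) ^ DIM('a) * ?k \<le> 8 * \<epsilon> * (1 + \<epsilon>)\<^sup>2 * ?k" using k0 by (rule mult_right_mono)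
    then show ?thesis using le1 by linarith
  next
    case True
    have "measure lebesgue W + measure lebesgue (Z (1 - \<epsilon>)) = measure lebesgue (W \<union> Z (1 - \<epsilon>))"
      using inner[OF True] Wm Zm unfolding W_def[symmetric]
      by (subst measure_Un3) auto
    also have "\<dots> \<le> measure lebesgue (Z (1 + \<epsilon>))"
    proof (intro measure_mono_fmeasurable)
      have "Z (1 - \<epsilon>) \<subseteq> Z (1 + \<epsilon>)"
      proof
        fix z assume "z \<in> Z (1 - \<epsilon>)"
        then obtain k where k: "k \<in> K" "z = (1 - \<epsilon>) *\<^sub>R k + \<epsilon> *\<^sub>R x0" unfolding Z_def by auto
        have x0: "x0 \<in> K" using \<rho> by auto
        define t where "t = (1 - \<epsilon>) / (1 + \<epsilon>)"
        have t: "0 \<le> t" "t \<le> 1" "(1 + \<epsilon>) * t = 1 - \<epsilon>" unfolding t_def using \<epsilon> True by auto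
        have tt: "(1 + \<epsilon>) * (1 - t) = 2 * \<epsilon>" using t(3) by (simp add: algebra_simps)
        have "t *\<^sub>R k + (1 - t) *\<^sub>R x0 \<in> K" using K(2) k x0 t by (intro convexD) auto
        moreover have "z = (1 + \<epsilon>) *\<^sub>R (t *\<^sub>R k + (1 - t) *\<^sub>R x0) + (1 - (1 + \<epsilon>)) *\<^sub>R x0"
          unfolding k(2) scaleR_add_right scaleR_scaleR t(3) tt by (simp add: algebra_simps scaleR_2[symmetric])
        ultimately show "z \<in> Z (1 + \<epsilon>)" unfolding Z_def by blast
      qed
      then show "W \<union> Z (1 - \<epsilon>) \<subseteq> Z (1 + \<epsilon>)" using outer by auto
      show "W \<union> Z (1 - \<epsilon>) \<in> sets lebesgue"
        using Wm Zm unfolding W_def[symmetric] by (auto dest: fmeasurableD)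
    qed (rule Zm)
    finally have "measure lebesgue W \<le> ((1 + \<epsilon>) ^ DIM('a) - (1 - \<epsilon>) ^ DIM('a)) * ?k"
      using Zmeas[of "1 - \<epsilon>"] Zmeas[of "1 + \<epsilon>"] \<epsilon> True by (simp add: algebra_simps)
    also have "(1 + \<epsilon>) ^ DIM('a) - (1 - \<epsilon>) ^ DIM('a) \<le> 8 * \<epsilon>"
    proof -
      have "\<epsilon> * (\<epsilon> * \<epsilon>) \<le> \<epsilon> * 1" using \<epsilon> True by (intro mult_left_mono mult_le_one) auto
      moreover have "DIM('a) = 1 \<or> DIM('a) = 2 \<or> DIM('a) = 3" using d dpos by linarith
      ultimately show ?thesis using \<epsilon> by (auto simp: power2_eq_square power3_eq_cube algebra_simps)
    qed
    also have "8 * \<epsilon> * ?k \<le> 8 * \<epsilon> * (1 + \<epsilon>)\<^sup>2 * ?k" using sq(1) \<epsilon> k0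
      by (intro mult_right_mono) auto
    finally show ?thesis using k0 by (simp add: mult_right_mono)
  qed
  also have "\<dots> \<le> 8 * \<epsilon> * (1 + e)\<^sup>2 * ?k" using sq(2) \<epsilon> k0 by (intro mult_right_mono mult_left_mono) auto
  also have "\<dots> = 16 * (1 + e)\<^sup>2 * (h / \<rho>) * ?k" unfolding \<epsilon>_def by simp
  finally show "measure lebesgue (\<Union>q\<in>frontier K. cball q h) \<le> 16 * (1 + e)\<^sup>2 * (h / \<rho>) * measure lebesgue K"
    unfolding W_def .
qed

text \<open>The extreme values on \<open>T\<close> are attained at vertices. Compare the two ends of the diameter of the
  inscribed ball in the direction of \<open>a\<close>.\<close>

lemma affine_gradient_bound:
  fixes T :: "'a::euclidean_space set"
  assumes T: "compact T" "convex T" and ball: "0 < r" "cball x0 r \<subseteq> T"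
    and s: "\<And>c. c extreme_point_of T \<Longrightarrow> \<bar>inner a c + b\<bar> \<le> s"
  shows "r * norm a \<le> s"
proof -
  have bd: "\<bar>inner a x + b\<bar> \<le> s" if "x \<in> T" for x
  proof -
    have "convex hull {x. x extreme_point_of T} \<subseteq> {x. inner a x \<le> s - b} \<inter> {x. inner a x \<ge> - s - b}"
      by (intro hull_minimal convex_Int convex_halfspace_le convex_halfspace_ge) (use s in force)
    then show ?thesis using Krein_Milman_Minkowski[OF T] that by force
  qed
  show ?thesis
  proof (cases "a = 0")
    case True
    have "x0 \<in> T" using ball by auto
    then have "0 \<le> s" using bd[of x0] by linarith
    then show ?thesis using True by simp
  next
    case False
    define u where "u = (r / norm a) *\<^sub>R a"
    have "norm u = r" unfolding u_def using False ball by simp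
    then have "x0 + u \<in> T" "x0 - u \<in> T" using ball by (auto simp: dist_norm subset_iff)
    then have "\<bar>inner a (x0 + u) + b\<bar> \<le> s" "\<bar>inner a (x0 - u) + b\<bar> \<le> s" using bd by auto
    then have "inner a u \<le> s" by (simp add: inner_simps abs_le_iff)
    moreover have "inner a u = r * norm a"
      unfolding u_def using False by (simp add: power2_norm_eq_inner[symmetric] power2_eq_square)
    ultimately show ?thesis by simp
  qed
qed

text \<open>One admissible decomposition. All constants derived below depend on \<open>\<sigma>\<close>, \<open>\<tau>\<close>, \<open>M\<close> and the dimension
  only; \<open>\<sigma>\<close> and \<open>\<tau>\<close> occur through their product, which bounds the ratio of the mesh size to the radius
  of the inscribed balls.\<close>

locale domain_decomposition =
  fixes \<sigma> \<tau> :: real and M :: nat and H h :: real and P :: "'a::euclidean_space decomposition"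
  assumes adm: "admissible_decomposition \<sigma> \<tau> M H h P"
    and dim: "DIM('a) = 2 \<or> DIM('a) = 3"
begin

abbreviation "n \<equiv> nsub P"
abbreviation "\<Omega> \<equiv> dom\<Omega> P"
abbreviation "sub \<equiv> subdomain P"
abbreviation "mesh \<equiv> fine_mesh P"

definition all_elements :: "'a set set" where "all_elements = (\<Union>j<n. mesh j)"

lemma h: "0 < h" "h \<le> H" "0 < H"
  using adm unfolding admissible_decomposition_def by auto

lemma domain: "open \<Omega>" "connected \<Omega>" "bounded \<Omega>" "\<Omega> \<noteq> {}" "\<Omega> = interior (closure \<Omega>)"
  using adm unfolding admissible_decomposition_def polyhedral_domain_def by auto

lemma subdomain:
  assumes "j < n"
  shows "open (sub j)" "connected (sub j)" "bounded (sub j)" "sub j \<noteq> {}" "sub j = interior (closure (sub j))"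
    "sub j \<subseteq> \<Omega>" "\<exists>\<K>. \<K> \<subseteq> coarse_mesh P \<and> card \<K> \<le> M \<and> closure (sub j) = \<Union>\<K>"
  using adm assms unfolding admissible_decomposition_def polyhedral_domain_def by auto

lemma subdomains_disjoint: "j < n \<Longrightarrow> k < n \<Longrightarrow> j \<noteq> k \<Longrightarrow> sub j \<inter> sub k = {}"
  using adm unfolding admissible_decomposition_def by auto

lemma closure_domain: "closure \<Omega> = (\<Union>j<n. closure (sub j))"
  using adm unfolding admissible_decomposition_def by auto

lemma mesh_covers: "j < n \<Longrightarrow> \<Union>(mesh j) = closure (sub j)"
  using adm unfolding admissible_decomposition_def by auto

lemma all_elements_cover: "\<Union>all_elements = closure \<Omega>"
proof -
  have "\<Union>all_elements = (\<Union>j<n. \<Union>(mesh j))" unfolding all_elements_def by blast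
  then show ?thesis unfolding closure_domain using mesh_covers by simp
qed

sublocale all_mesh: simplicial_mesh all_elements
proof
  have t: "triangulation all_elements"
    using adm unfolding admissible_decomposition_def all_elements_def by auto
  then show "finite all_elements" and "\<And>T T'. T \<in> all_elements \<Longrightarrow> T' \<in> all_elements \<Longrightarrow> T \<inter> T' face_of T"
    unfolding triangulation_def by auto
  show "\<And>T. T \<in> all_elements \<Longrightarrow> int DIM('a) simplex T"
    using adm unfolding admissible_decomposition_def all_elements_def by auto
qed

lemma mesh_subset: "j < n \<Longrightarrow> mesh j \<subseteq> all_elements"
  unfolding all_elements_def by auto

lemma local_mesh: "j < n \<Longrightarrow> simplicial_mesh (mesh j)"
  using mesh_subset[of j] all_mesh.full all_mesh.face finite_subset[OF _ all_mesh.fin]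
  by (unfold_locales; blast)

lemma size_parameters: 
  assumes "0 < \<rho>" "cball x \<rho> \<subseteq> K" "bounded K" "diameter K \<le> \<sigma> * \<rho>" "diameter K \<le> s" "s \<le> \<tau> * diameter K" "0 < s"
  shows "0 < \<sigma>" "0 < \<tau>" "s / (\<sigma> * \<tau>) \<le> \<rho>" "\<And>x y. x \<in> K \<Longrightarrow> y \<in> K \<Longrightarrow> dist x y \<le> s"
proof -
  have d0: "0 \<le> diameter K" using assms by (simp add: diameter_ge_0)
  have td: "0 < \<tau> * diameter K" using assms by linarith
  have d: "0 < diameter K"
  proof (rule ccontr)
    assume "\<not> 0 < diameter K"
    then have "diameter K = 0" using d0 by linarith
    then show False using td by simp
  qed
  show t: "0 < \<tau>" by (rule zero_less_mult_pos2[OF td d])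
  have sr: "0 < \<sigma> * \<rho>" using d assms(4) by linarith
  show s: "0 < \<sigma>" by (rule zero_less_mult_pos2[OF sr assms(1)])
  have "s \<le> \<tau> * (\<sigma> * \<rho>)" using assms(4,6) t by (meson mult_left_mono less_imp_le order_trans)
  then show "s / (\<sigma> * \<tau>) \<le> \<rho>" using s t by (simp add: field_simps)
  show "dist x y \<le> s" if "x \<in> K" "y \<in> K" for x y
    using diameter_bounded_bound[OF assms(3) that] assms(5) by linarith
qed

lemma element_ball:
  assumes "T \<in> all_elements"
  obtains x \<rho> where "0 < \<rho>" "cball x \<rho> \<subseteq> T" "0 < \<sigma>" "0 < \<tau>" "h / (\<sigma> * \<tau>) \<le> \<rho>"
    "\<And>x y. x \<in> T \<Longrightarrow> y \<in> T \<Longrightarrow> dist x y \<le> h"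
proof -
  obtain j where j: "j < n" "T \<in> mesh j" using assms unfolding all_elements_def by auto
  then have "shape_regular \<sigma> (mesh j)" "quasi_uniform \<tau> h (mesh j)"
    using adm unfolding admissible_decomposition_def by auto
  then obtain x \<rho> where T: "0 < \<rho>" "cball x \<rho> \<subseteq> T" "diameter T \<le> \<sigma> * \<rho>" "diameter T \<le> h" "h \<le> \<tau> * diameter T"
    using j unfolding shape_regular_def quasi_uniform_def by blast
  have "bounded T" using all_mesh.elem(1)[OF assms] compact_imp_bounded by auto
  note p = size_parameters[OF T(1,2) this T(3-5) h(1)]
  show ?thesis by (rule that[OF T(1,2) p])
qed

lemma coarse_element:
  assumes "K \<in> coarse_mesh P"
  shows "compact K" "convex K"
    and "\<exists>x \<rho>. 0 < \<rho> \<and> cball x \<rho> \<subseteq> K \<and> H / (\<sigma> * \<tau>) \<le> \<rho>"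
    and "\<And>x y. x \<in> K \<Longrightarrow> y \<in> K \<Longrightarrow> dist x y \<le> H"
proof -
  have "conforming_mesh (coarse_mesh P)" "shape_regular \<sigma> (coarse_mesh P)" "quasi_uniform \<tau> H (coarse_mesh P)"
    using adm unfolding admissible_decomposition_def by auto
  then obtain x \<rho> where K: "polytope K" "0 < \<rho>" "cball x \<rho> \<subseteq> K" "diameter K \<le> \<sigma> * \<rho>" "diameter K \<le> H" "H \<le> \<tau> * diameter K"
    using assms unfolding shape_regular_def quasi_uniform_def conforming_mesh_def by blast
  show "compact K" "convex K" using K by (auto simp: polytope_imp_compact polytope_imp_convex)
  then have "bounded K" by (simp add: compact_imp_bounded)
  note p = size_parameters[OF K(2,3) this K(4-6) h(3)]
  show "\<exists>x \<rho>. 0 < \<rho> \<and> cball x \<rho> \<subseteq> K \<and> H / (\<sigma> * \<tau>) \<le> \<rho>" using K p by blast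
  show "\<And>x y. x \<in> K \<Longrightarrow> y \<in> K \<Longrightarrow> dist x y \<le> H" using p by blast
qed

lemma elements_nonempty: "all_elements \<noteq> {}"
proof -
  have "closure \<Omega> \<noteq> {}" using domain by auto
  then show "all_elements \<noteq> {}" using all_elements_cover by (metis Union_empty)
qed

lemma regularity_pos: "0 < \<sigma>" "0 < \<tau>"
  using elements_nonempty element_ball by (meson all_not_in_conv)+

lemma element_measure:
  assumes "T \<in> all_elements"
  shows "unit_ball_vol (real DIM('a)) * (h / (\<sigma> * \<tau>)) ^ DIM('a) \<le> measure lborel T" "measure lborel T \<le> unit_ball_vol (real DIM('a)) * h ^ DIM('a)"
    and "\<And>x. x \<in> T \<Longrightarrow> T \<subseteq> cball x h" "\<exists>x. cball x (h / (\<sigma> * \<tau>)) \<subseteq> T"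
proof -
  obtain x \<rho> where T: "0 < \<rho>" "cball x \<rho> \<subseteq> T" "h / (\<sigma> * \<tau>) \<le> \<rho>"
    "\<And>x y. x \<in> T \<Longrightarrow> y \<in> T \<Longrightarrow> dist x y \<le> h" using element_ball[OF assms] by metis
  have c: "cball x (h / (\<sigma> * \<tau>)) \<subseteq> T" using T(2,3) by auto
  then show "\<exists>x. cball x (h / (\<sigma> * \<tau>)) \<subseteq> T" by blast
  show sub: "T \<subseteq> cball x h" if "x \<in> T" for x using T(4) that by auto
  have Tm: "T \<in> lmeasurable" "T \<in> sets borel" using all_mesh.elem[OF assms] by (auto intro: lmeasurable_compact)
  have r: "0 \<le> h / (\<sigma> * \<tau>)" using h regularity_pos by simp
  have "measure lebesgue (cball x (h / (\<sigma> * \<tau>))) \<le> measure lebesgue T"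
    using c Tm by (intro measure_mono_fmeasurable) auto
  then show "unit_ball_vol (real DIM('a)) * (h / (\<sigma> * \<tau>)) ^ DIM('a) \<le> measure lborel T"
    using r Tm by (simp add: content_cball)
  have "x \<in> T" using T by auto
  then have "measure lebesgue T \<le> measure lebesgue (cball x h)"
    using sub Tm by (intro measure_mono_fmeasurable) (auto dest: fmeasurableD)
  then show "measure lborel T \<le> unit_ball_vol (real DIM('a)) * h ^ DIM('a)" using h Tm by (simp add: content_cball)
qed

lemma card_elements_le:
  assumes "\<S> \<subseteq> all_elements" "\<And>T. T \<in> \<S> \<Longrightarrow> T \<subseteq> W" "W \<in> lmeasurable"
  shows "real (card \<S>) * (unit_ball_vol (real DIM('a)) * (h / (\<sigma> * \<tau>)) ^ DIM('a)) \<le> measure lebesgue W"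
proof (rule packing_bound)
  show "finite \<S>" using assms(1) all_mesh.fin finite_subset by blast
  show "0 \<le> h / (\<sigma> * \<tau>)" using h regularity_pos by simp
  show "\<exists>x. cball x (h / (\<sigma> * \<tau>)) \<subseteq> T" if "T \<in> \<S>" for T using element_measure(4) that assms(1) by blast
  show "interior T \<inter> interior T' = {}" if "T \<in> \<S>" "T' \<in> \<S>" "T \<noteq> T'" for T T'
    using all_mesh.disjoint_interiors that assms(1) by blast
qed (use assms in auto)

lemma card_elements_at_point:
  shows "real (card {T \<in> all_elements. p \<in> T}) \<le> (\<sigma> * \<tau>) ^ DIM('a)"
proof -
  have "real (card {T \<in> all_elements. p \<in> T}) * (unit_ball_vol (real DIM('a)) * (h / (\<sigma> * \<tau>)) ^ DIM('a)) \<le> measure lebesgue (cball p h)"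
    using element_measure(3) by (intro card_elements_le) auto
  also have "\<dots> = unit_ball_vol (real DIM('a)) * h ^ DIM('a)" using h by (simp add: content_cball)
  finally have "real (card {T \<in> all_elements. p \<in> T}) * h ^ DIM('a) \<le> (\<sigma> * \<tau>) ^ DIM('a) * h ^ DIM('a)"
    using regularity_pos unit_ball_vol_pos[of "real DIM('a)"] by (simp add: power_divide field_simps)
  then show ?thesis using h by simp
qed

lemma element_interior: 
  assumes "j < n" "T \<in> mesh j" shows "interior T \<subseteq> sub j"
proof -
  have "T \<subseteq> closure (sub j)" using assms mesh_covers by auto
  then show ?thesis using subdomain(5)[OF assms(1)] interior_mono by metis
qed

lemma meshes_disjoint:
  assumes "j < n" "k < n" "T \<in> mesh j" "T \<in> mesh k" shows "j = k"
proof (rule ccontr)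
  assume "j \<noteq> k"
  then have "interior T = {}" using subdomains_disjoint[OF assms(1,2)] element_interior assms by blast
  then show False using all_mesh.elem(4) mesh_subset assms by blast
qed

text \<open>Subdomains that share a node have different elements at that node.\<close>

lemma card_subdomains_at_node:
  "real (card {j. j < n \<and> p \<in> mesh_vertices (mesh j)}) \<le> (\<sigma> * \<tau>) ^ DIM('a)"
proof -
  let ?J = "{j. j < n \<and> p \<in> mesh_vertices (mesh j)}"
  have "\<exists>T. T \<in> mesh j \<and> p \<in> T" if "j \<in> ?J" for j
    using that unfolding mesh_vertices_def extreme_point_of_def by auto
  then obtain T where T: "\<And>j. j \<in> ?J \<Longrightarrow> T j \<in> mesh j \<and> p \<in> T j" by metis
  have "inj_on T ?J"
  proof (rule inj_onI)
    fix j k assume "j \<in> ?J" "k \<in> ?J" "T j = T k"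
    then show "j = k" using T[of j] T[of k] by (intro meshes_disjoint[of j k "T j"]) auto
  qed
  then have "card ?J \<le> card {T \<in> all_elements. p \<in> T}"
    using T mesh_subset all_mesh.fin by (intro card_inj_on_le[of T]) auto
  then show ?thesis using card_elements_at_point[of p] by linarith
qed

lemma finite_mesh_vertices: "j < n \<Longrightarrow> finite (mesh_vertices (mesh j))"
proof -
  assume j: "j < n"
  have "finite {p. p extreme_point_of T}" if "T \<in> mesh j" for T
    using all_mesh.vertices[of T] that mesh_subset[OF j] by (metis subsetD)
  moreover have "mesh_vertices (mesh j) = (\<Union>T\<in>mesh j. {p. p extreme_point_of T})"
    unfolding mesh_vertices_def by auto
  ultimately show ?thesis using finite_subset[OF mesh_subset[OF j] all_mesh.fin] by simp
qed

text \<open>The elements that touch the boundary of \<open>K\<close> lie in a layer of thickness \<open>h\<close>, whose volume is of order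
  \<open>h\<close> times \<open>H\<close> to the power \<open>DIM('a) - 1\<close>; each of them carries at most four nodes.\<close>

lemma card_nodes_on_coarse_boundary:
  assumes "K \<in> coarse_mesh P"
  shows "finite (frontier K \<inter> mesh_vertices all_elements)"
    and "real (card (frontier K \<inter> mesh_vertices all_elements))
       \<le> 64 * (\<sigma> * \<tau>) ^ (DIM('a) + 1) * (1 + 2 * \<sigma> * \<tau>)\<^sup>2 * (H / h) ^ (DIM('a) - 1)"
proof -
  let ?d = "DIM('a)"
  define s where "s = \<sigma> * \<tau>"
  have s: "0 < s" unfolding s_def using regularity_pos by simp
  obtain x \<rho> where K: "compact K" "convex K" "0 < \<rho>" "cball x \<rho> \<subseteq> K" "H / s \<le> \<rho>"
    "\<And>x y. x \<in> K \<Longrightarrow> y \<in> K \<Longrightarrow> dist x y \<le> H"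
    using coarse_element[OF assms] unfolding s_def by metis
  define \<S> where "\<S> = {T \<in> all_elements. T \<inter> frontier K \<noteq> {}}"
  define W where "W = (\<Union>q\<in>frontier K. cball q h)"
  have fS: "finite \<S>" unfolding \<S>_def using all_mesh.fin by auto
  have hr: "h / \<rho> \<le> s * (h / H)"
  proof -
    have "h / \<rho> \<le> h / (H / s)" using K(3,5) h s by (intro divide_left_mono) auto
    then show ?thesis by (simp add: mult.commute)
  qed
  also have "\<dots> \<le> s * 1" using s h by (intro mult_left_mono) auto
  finally have e: "2 * h / \<rho> \<le> 2 * s" by simp
  have d3: "?d \<le> 3" using dim by auto
  note layer = boundary_layer_measure[OF K(1-4) h(1) e d3, folded W_def]
  have Kvol: "measure lebesgue K \<le> unit_ball_vol (real DIM('a)) * H ^ ?d"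
  proof -
    have "x \<in> K" using K(3,4) by auto
    then have "K \<subseteq> cball x H" using K(6) by auto
    then have "measure lebesgue K \<le> measure lebesgue (cball x H)"
      using K(1) by (intro measure_mono_fmeasurable) (auto intro: fmeasurableD lmeasurable_compact)
    then show ?thesis using h by (simp add: content_cball)
  qed
  have "real (card \<S>) * (unit_ball_vol (real DIM('a)) * (h / s) ^ ?d) \<le> measure lebesgue W"
    unfolding s_def
  proof (rule card_elements_le[OF _ _ layer(1)])
    show "T \<subseteq> W" if "T \<in> \<S>" for T
      using that element_measure(3)[of T] unfolding \<S>_def W_def by blast
  qed (auto simp: \<S>_def)
  also have "\<dots> \<le> 16 * (1 + 2 * s)\<^sup>2 * (h / \<rho>) * measure lebesgue K" by (rule layer(2))
  also have "\<dots> \<le> 16 * (1 + 2 * s)\<^sup>2 * (s * (h / H)) * (unit_ball_vol (real DIM('a)) * H ^ ?d)"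
    using hr Kvol s h by (intro mult_mono mult_left_mono) auto
  finally have "unit_ball_vol (real ?d) * (real (card \<S>) * (h / s) ^ ?d)
      \<le> unit_ball_vol (real ?d) * (16 * (1 + 2 * s)\<^sup>2 * (s * (h / H)) * H ^ ?d)"
    by (simp only: mult_ac)
  then have le: "real (card \<S>) * (h / s) ^ ?d \<le> 16 * (1 + 2 * s)\<^sup>2 * (s * (h / H)) * H ^ ?d"
    by (rule mult_left_le_imp_le) simp
  have "real (card \<S>) \<le> 16 * s ^ (?d + 1) * (1 + 2 * s)\<^sup>2 * (H / h) ^ (?d - 1)"
  proof -
    have "real (card \<S>) = (real (card \<S>) * (h / s) ^ ?d) * (s / h) ^ ?d"
      using s h by (simp add: power_divide)
    also have "\<dots> \<le> (16 * (1 + 2 * s)\<^sup>2 * (s * (h / H)) * H ^ ?d) * (s / h) ^ ?d"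
      using le s h by (intro mult_right_mono) auto
    also have "\<dots> = 16 * s ^ (?d + 1) * (1 + 2 * s)\<^sup>2 * ((h / H) * (H / h) ^ ?d)"
      by (simp add: power_divide)
    also have "(h / H) * (H / h) ^ ?d = (H / h) ^ (?d - 1)"
      using h dim by (cases ?d) (auto simp: power_divide)
    finally show ?thesis .
  qed
  then have le4: "4 * real (card \<S>) \<le> 64 * s ^ (?d + 1) * (1 + 2 * s)\<^sup>2 * (H / h) ^ (?d - 1)" by linarith
  have fv: "finite {p. p extreme_point_of T} \<and> card {p. p extreme_point_of T} \<le> 4" if "T \<in> \<S>" for T
  proof -
    have "T \<in> all_elements" using that unfolding \<S>_def by auto
    then obtain C where "finite C" "card C = ?d + 1" "C = {x. x extreme_point_of T}"
      using all_mesh.vertices by metis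
    then show ?thesis using d3 by auto
  qed
  have sub: "frontier K \<inter> mesh_vertices all_elements \<subseteq> (\<Union>T\<in>\<S>. {p. p extreme_point_of T})"
    unfolding mesh_vertices_def \<S>_def by (auto simp: extreme_point_of_def)
  have fin: "finite (\<Union>T\<in>\<S>. {p. p extreme_point_of T})" using fS fv by auto
  show "finite (frontier K \<inter> mesh_vertices all_elements)" using finite_subset[OF sub fin] .
  have "card (frontier K \<inter> mesh_vertices all_elements) \<le> card (\<Union>T\<in>\<S>. {p. p extreme_point_of T})"
    by (rule card_mono[OF fin sub])
  also have "\<dots> \<le> (\<Sum>T\<in>\<S>. card {p. p extreme_point_of T})" by (rule card_UN_le[OF fS])
  also have "\<dots> \<le> (\<Sum>T\<in>\<S>. 4)" using fv by (intro sum_mono) auto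
  finally have "real (card (frontier K \<inter> mesh_vertices all_elements)) \<le> 4 * real (card \<S>)" by simp
  then have "real (card (frontier K \<inter> mesh_vertices all_elements))
      \<le> 64 * s ^ (?d + 1) * (1 + 2 * s)\<^sup>2 * (H / h) ^ (?d - 1)"
    using le4 by (rule order_trans)
  then show "real (card (frontier K \<inter> mesh_vertices all_elements))
       \<le> 64 * (\<sigma> * \<tau>) ^ (DIM('a) + 1) * (1 + 2 * \<sigma> * \<tau>)\<^sup>2 * (H / h) ^ (DIM('a) - 1)"
    unfolding s_def by (simp only: mult.assoc)
qed

end

section \<open>Energy, pointwise estimate and inverse inequality\<close>

lemma GDERIV_unique: "GDERIV f x :> a \<Longrightarrow> GDERIV f x :> b \<Longrightarrow> a = b"
proof -
  assume *: "GDERIV f x :> a" "GDERIV f x :> b"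
  have "(\<lambda>h. inner h a) = (\<lambda>h. inner h b)"
    using * unfolding gderiv_def by (rule has_derivative_unique)
  then have "inner (a - b) a = inner (a - b) b" by metis
  then have "inner (a - b) (a - b) = 0" by (simp add: inner_diff_right)
  then show "a = b" by simp
qed

lemma grad_in_element:
  assumes v: "\<And>x. x \<in> T \<Longrightarrow> v x = inner a x + b" and x: "x \<in> interior T"
  shows "grad v x = a"
proof -
  have "((\<lambda>x. inner a x + b) has_derivative (\<lambda>h. inner h a)) (at x)"
    by (auto intro!: derivative_eq_intros simp: inner_commute)
  then have "(v has_derivative (\<lambda>h. inner h a)) (at x)"
  proof (rule has_derivative_transform_within_open[OF _ open_interior x])
    fix y assume "y \<in> interior T"
    then show "inner a y + b = v y" using v interior_subset by (metis subsetD)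
  qed
  then have "GDERIV v x :> a" by (simp add: gderiv_def)
  then show ?thesis unfolding grad_def using GDERIV_unique by (intro the_equality) auto
qed

context simplicial_mesh
begin

lemma elem_grad_sum:
  assumes T: "T \<in> \<T>" and v: "\<And>i. i \<in> I \<Longrightarrow> \<exists>a b. \<forall>x\<in>T. v i x = inner a x + b"
  shows "elem_grad (\<lambda>x. \<Sum>i\<in>I. w i * v i x) T = (\<Sum>i\<in>I. w i *\<^sub>R elem_grad (v i) T)"
proof -
  obtain b where b: "\<forall>x\<in>T. (\<Sum>i\<in>I. w i * v i x) = inner (\<Sum>i\<in>I. w i *\<^sub>R elem_grad (v i) T) x + b"
    using affine_sum[of I T v w] v elem_grad by blast
  show ?thesis by (rule elem_grad_unique[OF elem(4)[OF T], where b = b]) (use b in blast)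
qed

text \<open>The boundaries of the elements form a null set, and off it the gradient is piecewise constant.\<close>

lemma integral_of_gradients:
  assumes D: "open D" "\<Union>\<T> = closure D" "\<And>T. T \<in> \<T> \<Longrightarrow> interior T \<subseteq> D"
    and u: "u \<in> P1_space \<T> D" and v: "v \<in> P1_space \<T> D"
  shows "set_lebesgue_integral lebesgue D (\<lambda>x. inner (grad u x) (grad v x))
         = (\<Sum>T\<in>\<T>. measure lborel T * inner (elem_grad u T) (elem_grad v T))"
proof -
  define c where "c T = inner (elem_grad u T) (elem_grad v T)" for T
  define N where "N = (\<Union>T\<in>\<T>. frontier T)"
  define F where "F x = (\<Sum>T\<in>\<T>. c T * indicator (interior T) x)" for x
  have N: "negligible N"
    unfolding N_def using fin elem by (intro negligible_Union) (auto intro: negligible_convex_frontier)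
  have im: "interior T \<in> lmeasurable" "measure lebesgue (interior T) = measure lborel T" if "T \<in> \<T>" for T
  proof -
    have b: "bounded T" using elem(1)[OF that] by (rule compact_imp_bounded)
    then show "interior T \<in> lmeasurable" by (intro lmeasurable_open) (auto intro: bounded_subset interior_subset)
    show "measure lebesgue (interior T) = measure lborel T"
      using measure_interior[OF b negligible_convex_frontier[OF elem(2)[OF that]]] elem(3)[OF that] by simp
  qed
  have eq: "inner (grad u x) (grad v x) = F x" if "x \<in> D - N" for x
  proof -
    have "x \<in> \<Union>\<T>" using that D(2) closure_subset by auto
    then obtain T where T: "T \<in> \<T>" "x \<in> T" by auto
    then have xT: "x \<in> interior T"
      using that elem(3)[OF T(1)] unfolding N_def frontier_def by auto
    have "F x = (\<Sum>T'\<in>\<T>. if T' = T then c T else 0)"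
      unfolding F_def using disjoint_interiors[OF T(1)] xT by (intro sum.cong) (auto simp: indicator_def)
    also have "\<dots> = c T" using fin T by simp
    finally show ?thesis unfolding c_def
      using P1_space_affine[OF u T(1)] P1_space_affine[OF v T(1)] grad_in_element[OF _ xT] by metis
  qed
  have Fe: "indicator D x *\<^sub>R F x = (\<Sum>T\<in>\<T>. c T * indicator (interior T) x)" for x
  proof (cases "x \<in> D")
    case False
    then have "x \<notin> interior T" if "T \<in> \<T>" for T using D(3)[OF that] by blast
    then show ?thesis by (simp add: False sum.neutral)
  qed (simp add: F_def)
  have Fi: "set_integrable lebesgue D F"
    unfolding set_integrable_def Fe using im
    by (intro Bochner_Integration.integrable_sum integrable_mult_right) (auto simp: fmeasurable_def)
  have fi: "set_integrable lebesgue D (\<lambda>x. inner (grad u x) (grad v x))"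
    by (rule absolutely_integrable_spike[OF Fi N eq])
  have "set_lebesgue_integral lebesgue D (\<lambda>x. inner (grad u x) (grad v x)) = integral D (\<lambda>x. inner (grad u x) (grad v x))"
    by (rule set_lebesgue_integral_eq_integral(2)[OF fi])
  also have "\<dots> = integral D F" using eq by (intro integral_spike[OF N]) auto
  also have "\<dots> = set_lebesgue_integral lebesgue D F" by (rule set_lebesgue_integral_eq_integral(2)[OF Fi, symmetric])
  also have "\<dots> = (\<Sum>T\<in>\<T>. c T * measure lborel T)"
  proof -
    have "integral\<^sup>L lebesgue (\<lambda>x. \<Sum>T\<in>\<T>. c T * indicator (interior T) x)
        = (\<Sum>T\<in>\<T>. integral\<^sup>L lebesgue (\<lambda>x. c T * indicator (interior T) x))"
      using im by (intro Bochner_Integration.integral_sum integrable_mult_right) (auto simp: fmeasurable_def)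
    also have "\<dots> = (\<Sum>T\<in>\<T>. c T * measure lborel T)"
      using im by (intro sum.cong) (auto simp: fmeasurable_def)
    finally show ?thesis unfolding set_lebesgue_integral_def Fe .
  qed
  finally show ?thesis unfolding c_def by (simp add: mult.commute)
qed

end

definition mesh_energy :: "'a::euclidean_space set set \<Rightarrow> ('a \<Rightarrow> real) \<Rightarrow> real" where
  "mesh_energy \<T> v = (\<Sum>T\<in>\<T>. (norm (elem_grad v T))\<^sup>2 * measure lborel T)"

lemma mesh_energy_nonneg: "0 \<le> mesh_energy \<T> v"
  unfolding mesh_energy_def by (intro sum_nonneg) auto

text \<open>The dimension-dependent factor of the squared pointwise estimate: logarithmic in the plane,
  \<open>1 / h\<close> in space.\<close>

definition log_factor :: "nat \<Rightarrow> real \<Rightarrow> real \<Rightarrow> real" where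
  "log_factor d H h = (if d = 2 then 1 + ln (H / h) else 1 / h)"

definition pointwise_const :: "nat \<Rightarrow> real \<Rightarrow> real" where
  "pointwise_const d s = (8 * s ^ d + 16 * s * (2 * s) ^ d) / unit_ball_vol (real d)"

definition inverse_const :: "nat \<Rightarrow> real \<Rightarrow> real" where
  "inverse_const d s = unit_ball_vol (real d) * s ^ (d + 2)"

context domain_decomposition
begin

lemma Xc_P1: "v \<in> Xc_space P \<Longrightarrow> j < n \<Longrightarrow> v j \<in> P1_space (mesh j) (sub j)"
  unfolding Xc_space_def by auto

lemma broken_form_eq:
  assumes "u \<in> Xc_space P" "v \<in> Xc_space P"
  shows "broken_form P u v = (\<Sum>j<n. \<Sum>T\<in>mesh j. measure lborel T * inner (elem_grad (u j) T) (elem_grad (v j) T))"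
  unfolding broken_form_def
proof (intro sum.cong refl)
  fix j assume "j \<in> {..<n}"
  then have j: "j < n" by simp
  interpret simplicial_mesh "mesh j" by (rule local_mesh[OF j])
  show "set_lebesgue_integral lebesgue (sub j) (\<lambda>x. inner (grad (u j) x) (grad (v j) x))
    = (\<Sum>T\<in>mesh j. measure lborel T * inner (elem_grad (u j) T) (elem_grad (v j) T))"
    using subdomain(1)[OF j] mesh_covers[OF j] element_interior[OF j] Xc_P1[OF _ j] assms
    by (intro integral_of_gradients) auto
qed

lemma broken_form_energy:
  assumes "v \<in> Xc_space P"
  shows "broken_form P v v = (\<Sum>j<n. mesh_energy (mesh j) (v j))"
  unfolding broken_form_eq[OF assms assms] mesh_energy_def
  by (simp add: power2_norm_eq_inner mult.commute)

lemma log_factor_pos: "0 < log_factor DIM('a) H h"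
  unfolding log_factor_def using h by (auto simp: add_pos_nonneg)

lemma C_upper_eq: "C_upper DIM('a) H h = (H / h) ^ (DIM('a) - 1) * log_factor DIM('a) H h"
  unfolding C_upper_def log_factor_def using dim by (auto simp: inverse_eq_divide)

lemma radial_integral:
  obtains L where "((\<lambda>t. 1 / t ^ (DIM('a) - 1)) has_integral L) {h / H..1}" "0 \<le> L"
    "L * H\<^sup>2 / H ^ DIM('a) \<le> log_factor DIM('a) H h"
proof -
  have pos: "0 < t" if "h / H \<le> t" for t using that h by (auto intro: less_le_trans[of 0 "h / H"])
  show ?thesis
  proof (cases "DIM('a) = 2")
    case True
    have "((\<lambda>t. 1 / t ^ 1) has_integral (ln 1 - ln (h / H))) {h / H..1}"
      using h by (intro fundamental_theorem_of_calculus)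
        (auto intro!: derivative_eq_intros simp: has_real_derivative_iff_has_vector_derivative[symmetric] dest: pos)
    moreover have "ln 1 - ln (h / H) = ln (H / h)" using h by (simp add: ln_div)
    ultimately show ?thesis
      using that[of "ln (H / h)"] True h unfolding log_factor_def by (simp add: power2_eq_square)
  next
    case False
    then have d: "DIM('a) = 3" using dim by auto
    have "((\<lambda>t. 1 / t ^ 2) has_integral (- 1 / 1 - - 1 / (h / H))) {h / H..1}"
      using h by (intro fundamental_theorem_of_calculus)
        (auto intro!: derivative_eq_intros simp: has_real_derivative_iff_has_vector_derivative[symmetric] power2_eq_square dest: pos)
    then have "((\<lambda>t. 1 / t ^ (DIM('a) - 1)) has_integral (H / h - 1)) {h / H..1}" using d h by simp
    moreover have "(H / h - 1) * H\<^sup>2 / H ^ DIM('a) \<le> log_factor DIM('a) H h"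
      unfolding log_factor_def using d h by (simp add: power2_eq_square power3_eq_cube field_simps)
    ultimately show ?thesis using that[of "H / h - 1"] h by simp
  qed
qed

lemma near_weight: "h\<^sup>2 / h ^ DIM('a) \<le> log_factor DIM('a) H h"
  unfolding log_factor_def using dim h by (auto simp: power2_eq_square power3_eq_cube)

text \<open>The inverse inequality bounds the gradient on a single element by the total energy, which supplies
  the Lipschitz constant in the discrete Sobolev inequality. The fine elements cover the coarse element but may
  cross its boundary; therefore the energy on the whole subdomain appears.\<close>

lemma pointwise_estimate:
  assumes K: "K \<in> coarse_mesh P" "K \<subseteq> closure (sub j)" and j: "j < n"
    and v: "v \<in> P1_space (mesh j) (sub j)" and pc: "p \<in> frontier K" "c \<in> frontier K"
  shows "(v p - v c)\<^sup>2 \<le> pointwise_const DIM('a) (\<sigma> * \<tau>) * log_factor DIM('a) H h * mesh_energy (mesh j) v"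
proof -
  let ?d = "DIM('a)" and ?\<omega> = "unit_ball_vol (real DIM('a))"
  interpret m: simplicial_mesh "mesh j" by (rule local_mesh[OF j])
  define s where "s = \<sigma> * \<tau>"
  have s: "0 < s" unfolding s_def using regularity_pos by simp
  obtain x \<rho> where K': "compact K" "convex K" "0 < \<rho>" "cball x \<rho> \<subseteq> K" "H / s \<le> \<rho>"
    "\<And>x y. x \<in> K \<Longrightarrow> y \<in> K \<Longrightarrow> dist x y \<le> H"
    using coarse_element[OF K(1)] unfolding s_def by metis
  obtain L where L: "((\<lambda>t. 1 / t ^ (?d - 1)) has_integral L) {h / H..1}" "0 \<le> L" "L * H\<^sup>2 / H ^ ?d \<le> log_factor DIM('a) H h"
    using radial_integral .
  define E where "E = mesh_energy (mesh j) v"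
  have E0: "0 \<le> E" unfolding E_def by (rule mesh_energy_nonneg)
  have \<omega>: "0 < ?\<omega>" by simp
  define V where "V = ?\<omega> * (h / s) ^ ?d"
  have V: "0 < V" unfolding V_def using h s \<omega> by simp
  define B where "B = sqrt (E / V)"
  have B2: "B\<^sup>2 = E / V" unfolding B_def using E0 V by simp
  have gB: "norm (elem_grad v T) \<le> B" if "T \<in> mesh j" for T
  proof -
    have "(norm (elem_grad v T))\<^sup>2 * V \<le> (norm (elem_grad v T))\<^sup>2 * measure lborel T"
      using element_measure(1)[of T] that mesh_subset[OF j] unfolding V_def s_def by (intro mult_left_mono) auto
    also have "\<dots> \<le> E" unfolding E_def mesh_energy_def using that m.fin
      by (intro member_le_sum[where f="\<lambda>T. (norm (elem_grad v T))\<^sup>2 * measure lborel T"]) auto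
    finally have "(norm (elem_grad v T))\<^sup>2 \<le> E / V" using V by (simp add: field_simps)
    then show ?thesis unfolding B_def by (simp add: real_le_rsqrt)
  qed
  have on: "q \<in> K \<and> \<rho> \<le> dist x q" if "q \<in> frontier K" for q
  proof -
    have "ball x \<rho> \<subseteq> interior K" using K'(4) ball_subset_cball[of x \<rho>] by (intro interior_maximal) auto
    moreover have "q \<notin> interior K" using that by (simp add: frontier_def)
    ultimately have "q \<notin> ball x \<rho>" by blast
    moreover have "q \<in> K" using that K'(1) frontier_subset_closed[OF compact_imp_closed] by auto
    ultimately show ?thesis by simp
  qed
  have vc: "continuous_on (\<Union>(mesh j)) v" using v mesh_covers[OF j] unfolding P1_space_def by simp
  have "(v p - v c)\<^sup>2 \<le> 8 * (h * B)\<^sup>2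
     + 16 * L * H\<^sup>2 * (H / \<rho>) * E / measure lborel (ball x (\<rho> / 2))"
  proof (rule discrete_sobolev_difference[where \<T> = "mesh j" and K = K and g = "elem_grad v"])
    show "\<And>T. T \<in> mesh j \<Longrightarrow> \<exists>b. \<forall>x\<in>T. v x = inner (elem_grad v T) x + b"
      using P1_space_affine[OF v] by auto
    show "0 \<le> B" unfolding B_def using E0 V by simp
    show "K \<subseteq> \<Union>(mesh j)" using K mesh_covers[OF j] by simp
    show "E = (\<Sum>T\<in>mesh j. (norm (elem_grad v T))\<^sup>2 * measure lborel T)" unfolding E_def mesh_energy_def ..
  qed (use m.fin m.elem K' vc on pc h L gB in auto)
  also have "8 * (h * B)\<^sup>2 = 8 * s ^ ?d / ?\<omega> * (h\<^sup>2 / h ^ ?d) * E"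
    unfolding power_mult_distrib B2 V_def by (simp add: power_divide)
  also have "\<dots> \<le> 8 * s ^ ?d / ?\<omega> * log_factor DIM('a) H h * E"
    using near_weight s \<omega> E0 by (intro mult_right_mono mult_left_mono) auto
  also have "16 * L * H\<^sup>2 * (H / \<rho>) * E / measure lborel (ball x (\<rho> / 2))
      \<le> 16 * s * (2 * s) ^ ?d / ?\<omega> * log_factor DIM('a) H h * E"
  proof -
    have Hr: "H / \<rho> \<le> s" using K'(3,5) s h by (simp add: field_simps)
    have 1: "1 / (\<rho> / 2) ^ ?d \<le> (2 * s) ^ ?d / H ^ ?d"
    proof -
      have "1 / (\<rho> / 2) ^ ?d = (2 / \<rho>) ^ ?d" by (simp add: power_divide)
      also have "\<dots> \<le> (2 * s / H) ^ ?d" using Hr K'(3) h by (intro power_mono) (auto simp: field_simps)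
      finally show ?thesis by (simp add: power_divide)
    qed
    have "16 * L * H\<^sup>2 * (H / \<rho>) * E / measure lborel (ball x (\<rho> / 2))
       = 16 * (L * H\<^sup>2) * (H / \<rho>) * (1 / (\<rho> / 2) ^ ?d) * E / ?\<omega>"
      using K'(3) by (simp add: content_ball mult_ac)
    also have "\<dots> \<le> 16 * (L * H\<^sup>2) * s * ((2 * s) ^ ?d / H ^ ?d) * E / ?\<omega>"
      using Hr 1 L(2) E0 \<omega> s h K'(3)
      by (intro divide_right_mono mult_right_mono mult_mono mult_nonneg_nonneg) auto
    also have "\<dots> = (16 * s * (2 * s) ^ ?d / ?\<omega>) * (L * H\<^sup>2 / H ^ ?d) * E" by (simp add: mult_ac)
    also have "\<dots> \<le> (16 * s * (2 * s) ^ ?d / ?\<omega>) * log_factor DIM('a) H h * E"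
      using L(3) s \<omega> E0 by (intro mult_right_mono mult_left_mono) auto
    finally show ?thesis .
  qed
  finally have "(v p - v c)\<^sup>2 \<le> 8 * s ^ ?d / ?\<omega> * log_factor DIM('a) H h * E + 16 * s * (2 * s) ^ ?d / ?\<omega> * log_factor DIM('a) H h * E" by simp
  also have "\<dots> = pointwise_const DIM('a) (\<sigma> * \<tau>) * log_factor DIM('a) H h * E"
    unfolding pointwise_const_def s_def by (simp add: add_divide_distrib distrib_right)
  finally show ?thesis unfolding E_def .
qed

lemma inverse_estimate_element:
  assumes T: "T \<in> all_elements" and v: "\<And>x. x \<in> T \<Longrightarrow> v x = inner a x + b"
  shows "(norm a)\<^sup>2 * measure lborel T \<le> unit_ball_vol (real DIM('a)) * (\<sigma> * \<tau>)\<^sup>2 * h ^ (DIM('a) - 2) * (\<Sum>c | c extreme_point_of T. (v c)\<^sup>2)"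
proof -
  let ?d = "DIM('a)" and ?\<omega> = "unit_ball_vol (real DIM('a))"
  define s where "s = \<sigma> * \<tau>"
  have s: "0 < s" unfolding s_def using regularity_pos by simp
  obtain C where C: "finite C" "C = {x. x extreme_point_of T}" using all_mesh.vertices[OF T] by metis
  define S where "S = (\<Sum>c\<in>C. (v c)\<^sup>2)"
  have S0: "0 \<le> S" unfolding S_def by (intro sum_nonneg) auto
  obtain x where x: "cball x (h / s) \<subseteq> T" using element_measure(4)[OF T] unfolding s_def by auto
  have "(h / s) * norm a \<le> sqrt S"
  proof (rule affine_gradient_bound[of T "h / s" x a b])
    fix c assume c: "c extreme_point_of T"
    then have "c \<in> T" by (simp add: extreme_point_of_def)
    then have "(inner a c + b)\<^sup>2 = (v c)\<^sup>2" using v by simp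
    also have "\<dots> \<le> S" unfolding S_def using c C by (intro member_le_sum[where f="\<lambda>c. (v c)\<^sup>2"]) auto
    finally show "\<bar>inner a c + b\<bar> \<le> sqrt S" using real_le_rsqrt by (metis power2_abs)
  qed (use all_mesh.elem[OF T] x h s in auto)
  then have "((h / s) * norm a)\<^sup>2 \<le> S" using h s S0 by (metis power_mono real_sqrt_pow2 mult_nonneg_nonneg norm_ge_zero divide_nonneg_pos less_imp_le)
  then have "(norm a)\<^sup>2 \<le> S * (s / h)\<^sup>2" using h s by (simp add: power_mult_distrib power_divide field_simps)
  then have "(norm a)\<^sup>2 * measure lborel T \<le> (S * (s / h)\<^sup>2) * (?\<omega> * h ^ ?d)"
    using element_measure(2)[OF T] S0 by (intro mult_mono) auto
  also have "\<dots> = ?\<omega> * s\<^sup>2 * (h ^ ?d / h\<^sup>2) * S" by (simp add: power_divide)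
  also have "h ^ ?d / h\<^sup>2 = h ^ (?d - 2)" using h dim by (auto simp: power2_eq_square power3_eq_cube)
  finally show ?thesis unfolding S_def C(2) s_def .
qed

text \<open>Each node belongs to a bounded number of elements, so summing the estimate on an element counts each
  nodal value boundedly often.\<close>

lemma inverse_estimate:
  assumes j: "j < n" and v: "v \<in> P1_space (mesh j) (sub j)"
  shows "mesh_energy (mesh j) v \<le> inverse_const DIM('a) (\<sigma> * \<tau>) * h ^ (DIM('a) - 2) * (\<Sum>c\<in>mesh_vertices (mesh j). (v c)\<^sup>2)"
proof -
  let ?d = "DIM('a)" and ?\<omega> = "unit_ball_vol (real DIM('a))"
  interpret m: simplicial_mesh "mesh j" by (rule local_mesh[OF j])
  define A where "A = ?\<omega> * (\<sigma> * \<tau>)\<^sup>2 * h ^ (?d - 2)"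
  have A: "0 \<le> A" unfolding A_def using regularity_pos h by simp
  have fV: "finite (mesh_vertices (mesh j))" by (rule finite_mesh_vertices[OF j])
  have "mesh_energy (mesh j) v \<le> (\<Sum>T\<in>mesh j. A * (\<Sum>c | c extreme_point_of T. (v c)\<^sup>2))"
    unfolding mesh_energy_def
  proof (rule sum_mono)
    fix T assume T: "T \<in> mesh j"
    obtain b where "\<forall>x\<in>T. v x = inner (elem_grad v T) x + b" using P1_space_affine[OF v T] by auto
    then show "(norm (elem_grad v T))\<^sup>2 * measure lborel T \<le> A * (\<Sum>c | c extreme_point_of T. (v c)\<^sup>2)"
      unfolding A_def using T mesh_subset[OF j] by (intro inverse_estimate_element) auto
  qed
  also have "\<dots> = A * (\<Sum>T\<in>mesh j. \<Sum>c | c extreme_point_of T. (v c)\<^sup>2)" by (simp add: sum_distrib_left)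
  also have "(\<Sum>T\<in>mesh j. \<Sum>c | c extreme_point_of T. (v c)\<^sup>2)
      = (\<Sum>T\<in>mesh j. \<Sum>c\<in>mesh_vertices (mesh j). if c extreme_point_of T then (v c)\<^sup>2 else 0)"
  proof (rule sum.cong[OF refl])
    fix T assume "T \<in> mesh j"
    then have "{c. c extreme_point_of T} = {c \<in> mesh_vertices (mesh j). c extreme_point_of T}"
      unfolding mesh_vertices_def by auto
    then show "(\<Sum>c | c extreme_point_of T. (v c)\<^sup>2) = (\<Sum>c\<in>mesh_vertices (mesh j). if c extreme_point_of T then (v c)\<^sup>2 else 0)"
      using fV by (simp add: sum.inter_filter)
  qed
  also have "\<dots> = (\<Sum>c\<in>mesh_vertices (mesh j). \<Sum>T\<in>mesh j. if c extreme_point_of T then (v c)\<^sup>2 else 0)"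
    by (rule sum.swap)
  also have "\<dots> = (\<Sum>c\<in>mesh_vertices (mesh j). real (card {T \<in> mesh j. c extreme_point_of T}) * (v c)\<^sup>2)"
    using m.fin by (intro sum.cong) (auto simp: sum.inter_filter[symmetric])
  also have "A * \<dots> \<le> A * (\<Sum>c\<in>mesh_vertices (mesh j). (\<sigma> * \<tau>) ^ ?d * (v c)\<^sup>2)"
  proof (intro mult_left_mono[OF _ A] sum_mono mult_right_mono)
    fix c
    have "card {T \<in> mesh j. c extreme_point_of T} \<le> card {T \<in> all_elements. c \<in> T}"
      using mesh_subset[OF j] all_mesh.fin by (intro card_mono) (auto simp: extreme_point_of_def)
    then show "real (card {T \<in> mesh j. c extreme_point_of T}) \<le> (\<sigma> * \<tau>) ^ ?d"
      using card_elements_at_point[of c] by linarith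
  qed auto
  also have "\<dots> = inverse_const DIM('a) (\<sigma> * \<tau>) * h ^ (?d - 2) * (\<Sum>c\<in>mesh_vertices (mesh j). (v c)\<^sup>2)"
    unfolding A_def inverse_const_def by (simp add: sum_distrib_left power_add power2_eq_square mult_ac)
  finally show ?thesis .
qed

end

section \<open>Corners and the nodal basis\<close>

context domain_decomposition
begin

lemma interior_not_in_closure:
  assumes "j < n" "k < n" "j \<noteq> k" "p \<in> sub j"
  shows "p \<notin> closure (sub k)"
proof -
  have "sub j \<inter> closure (sub k) = {}"
    using subdomains_disjoint[OF assms(1-3)] subdomain(1)[OF assms(1)] open_Int_closure_eq_empty by blast
  then show ?thesis using assms by auto
qed

lemma interior_not_in_frontier:
  assumes "j < n" "k < n" "p \<in> sub j"
  shows "p \<notin> frontier (sub k)"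
  using assms interior_not_in_closure[of j k p] subdomain(1)[of k]
  by (cases "j = k") (auto simp: frontier_def interior_open)

lemma shared_point_in_frontier:
  assumes "j < n" "k < n" "j \<noteq> k" "p \<in> closure (sub j)" "p \<in> closure (sub k)"
  shows "p \<in> frontier (sub j)"
proof -
  have "p \<notin> sub j" using interior_not_in_closure[OF assms(1-3)] assms(5) by blast
  then show ?thesis using assms(4) subdomain(1)[OF assms(1)] by (simp add: frontier_def interior_open)
qed

lemma corner_in_frontier:
  assumes "q \<in> corners P" "j < n" "q \<in> closure (sub j)"
  shows "q \<in> frontier (sub j)"
proof -
  obtain k where k: "k < n" "q \<in> frontier (sub k)" using assms(1) unfolding corners_def by auto
  have "q \<notin> sub j" using interior_not_in_frontier[OF assms(2) k(1)] k(2) by blast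
  then show ?thesis using assms(3) subdomain(1)[OF assms(2)] by (simp add: frontier_def interior_open)
qed

lemma corner_is_vertex:
  assumes "q \<in> corners P" "j < n" "q \<in> closure (sub j)"
  shows "q \<in> mesh_vertices (mesh j)"
proof -
  have "corners P \<inter> frontier (sub j) \<subseteq> mesh_vertices (mesh j)"
    using adm assms(2) unfolding admissible_decomposition_def by blast
  then show ?thesis using corner_in_frontier[OF assms] assms(1) by blast
qed

lemma frontier_of_coarse_element:
  assumes "j < n" "K \<subseteq> closure (sub j)" "closed K" "x \<in> K" "x \<in> frontier (sub j)"
  shows "x \<in> frontier K"
proof -
  have "interior K \<subseteq> sub j" using assms(2) subdomain(5)[OF assms(1)] interior_mono by metis
  moreover have "x \<notin> sub j" using assms(5) subdomain(1)[OF assms(1)] by (simp add: frontier_def interior_open)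
  ultimately show ?thesis using assms(3,4) by (auto simp: frontier_def)
qed

text \<open>The coarse elements at \<open>p\<close> on either side meet in a common face. A vertex of that face belongs to
  both subdomains, hence to the boundary of both, and so it is a corner.\<close>

lemma common_corner:
  assumes jk: "j < n" "k < n" "j \<noteq> k" and p: "p \<in> closure (sub j)" "p \<in> closure (sub k)"
  obtains K K' c where "K \<in> coarse_mesh P" "K \<subseteq> closure (sub j)" "K' \<in> coarse_mesh P" "K' \<subseteq> closure (sub k)"
    "p \<in> frontier K" "c \<in> frontier K" "p \<in> frontier K'" "c \<in> frontier K'"
    "c \<in> corners P" "c \<in> closure (sub j)" "c \<in> closure (sub k)"
proof -
  obtain K where K: "K \<in> coarse_mesh P" "K \<subseteq> closure (sub j)" "p \<in> K"
    using subdomain(7)[OF jk(1)] p(1) by blast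
  obtain K' where K': "K' \<in> coarse_mesh P" "K' \<subseteq> closure (sub k)" "p \<in> K'"
    using subdomain(7)[OF jk(2)] p(2) by blast
  have face: "K \<inter> K' face_of K" "K \<inter> K' face_of K'"
    using adm K(1) K'(1) unfolding admissible_decomposition_def conforming_mesh_def by auto
  have co: "compact K" "convex K" "compact K'" "convex K'" using coarse_element K(1) K'(1) by auto
  obtain c where c: "c extreme_point_of (K \<inter> K')"
    using extreme_point_exists_convex[of "K \<inter> K'"] co K(3) K'(3) by (auto simp: convex_Int compact_Int)
  have cK: "c \<in> K" "c \<in> K'" "c extreme_point_of K"
    using c extreme_point_of_face[OF face(1)] by (auto simp: extreme_point_of_def)
  have cc: "c \<in> closure (sub j)" "c \<in> closure (sub k)" using cK K(2) K'(2) by auto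
  note fr = shared_point_in_frontier[OF jk p] shared_point_in_frontier[OF jk(2,1) jk(3)[symmetric] p(2,1)]
    shared_point_in_frontier[OF jk cc] shared_point_in_frontier[OF jk(2,1) jk(3)[symmetric] cc(2,1)]
  have "c \<in> corners P" unfolding corners_def mesh_vertices_def using cK K(1) fr(3) jk(1) by auto
  moreover have "p \<in> frontier K" "c \<in> frontier K" "p \<in> frontier K'" "c \<in> frontier K'"
    using frontier_of_coarse_element[OF jk(1) K(2)] frontier_of_coarse_element[OF jk(2) K'(2)]
      compact_imp_closed co K(3) K'(3) cK fr by auto
  ultimately show ?thesis using that K K' cc by blast
qed

lemma nodal_function_exists_unique:
  fixes w :: "nat \<Rightarrow> 'a \<Rightarrow> real"
  assumes zero: "\<And>j q. j < n \<Longrightarrow> q \<in> frontier \<Omega> \<Longrightarrow> w j q = 0"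
    and corner: "\<And>j k q. j < n \<Longrightarrow> k < n \<Longrightarrow> q \<in> corners P \<Longrightarrow> w j q = w k q"
  shows "\<exists>!\<phi>. \<phi> \<in> Xc_space P \<and> (\<forall>j<n. \<forall>q\<in>mesh_vertices (mesh j). \<phi> j q = w j q)"
proof (rule ex_ex1I)
  have "\<exists>v. v \<in> P1_space (mesh j) (sub j) \<and> (\<forall>q\<in>mesh_vertices (mesh j). v q = w j q)" if j: "j < n" for j
    using simplicial_mesh.interpolation_exists[OF local_mesh[OF j] mesh_covers[OF j], of "w j"] by blast
  then obtain v where v: "\<And>j. j < n \<Longrightarrow> v j \<in> P1_space (mesh j) (sub j)"
    "\<And>j q. j < n \<Longrightarrow> q \<in> mesh_vertices (mesh j) \<Longrightarrow> v j q = w j q" by metis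
  define \<phi> where "\<phi> j = (if j < n then v j else (\<lambda>_. 0))" for j
  have "\<phi> j x = 0" if j: "j < n" and x: "x \<in> frontier \<Omega> \<inter> closure (sub j)" for j x
  proof -
    obtain T where T: "T \<in> mesh j" "x \<in> T" using x mesh_covers[OF j] by auto
    obtain b where b: "\<forall>x\<in>T. v j x = inner (elem_grad (v j) T) x + b"
      using P1_space_affine[OF v(1)[OF j] T(1)] by blast
    have TA: "T \<in> all_elements" using T mesh_subset[OF j] by auto
    have "v j x = 0"
    proof (rule all_mesh.vanishes_on_frontier[OF domain(1) all_elements_cover domain(5) TA T(2)])
      show "x \<in> frontier \<Omega>" using x by auto
      show "v j x = inner (elem_grad (v j) T) x + b" if "x \<in> T" for x using b that by auto
      fix c assume c: "c extreme_point_of T" "c \<in> frontier \<Omega>"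
      then have "c \<in> mesh_vertices (mesh j)" using T unfolding mesh_vertices_def by auto
      then show "v j c = 0" using v(2)[OF j] zero[OF j c(2)] by simp
    qed
    then show ?thesis using j unfolding \<phi>_def by simp
  qed
  moreover have "\<phi> j q = \<phi> k q" if "q \<in> corners P" "j < n" "k < n" "q \<in> closure (sub j) \<inter> closure (sub k)" for j k q
  proof -
    have "v j q = w j q" "v k q = w k q" using v(2) corner_is_vertex that by auto
    then show ?thesis using corner[OF that(2,3,1)] that(2,3) unfolding \<phi>_def by simp
  qed
  moreover have "\<phi> j \<in> P1_space (mesh j) (sub j)" if "j < n" for j using v(1) that unfolding \<phi>_def by simp
  moreover have "\<phi> j = (\<lambda>_. 0)" if "j \<ge> n" for j using that unfolding \<phi>_def by simp
  ultimately have "\<phi> \<in> Xc_space P" unfolding Xc_space_def by blast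
  moreover have "\<forall>j<n. \<forall>q\<in>mesh_vertices (mesh j). \<phi> j q = w j q" using v(2) unfolding \<phi>_def by simp
  ultimately show "\<exists>\<phi>. \<phi> \<in> Xc_space P \<and> (\<forall>j<n. \<forall>q\<in>mesh_vertices (mesh j). \<phi> j q = w j q)" by blast
next
  fix \<phi> \<psi> assume *: "\<phi> \<in> Xc_space P \<and> (\<forall>j<n. \<forall>q\<in>mesh_vertices (mesh j). \<phi> j q = w j q)"
    "\<psi> \<in> Xc_space P \<and> (\<forall>j<n. \<forall>q\<in>mesh_vertices (mesh j). \<psi> j q = w j q)"
  show "\<phi> = \<psi>"
  proof
    fix j show "\<phi> j = \<psi> j"
    proof (cases "j < n")
      case True
      then show ?thesis
        using * simplicial_mesh.interpolation_unique[OF local_mesh[OF True] mesh_covers[OF True], of "\<phi> j" "\<psi> j"] Xc_P1[of _ j]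
        by simp
    next
      case False
      then show ?thesis using * unfolding Xc_space_def by simp
    qed
  qed
qed

definition dofs :: "'a dof set" where
  "dofs = interior_dofs P \<union> corner_dofs P \<union> dual_dofs P"

lemma local_dof_not_corner:
  assumes "Local j p \<in> dofs"
  shows "j < n" "p \<in> mesh_vertices (mesh j)" "p \<notin> corners P" "p \<notin> frontier \<Omega>"
proof -
  show j: "j < n" "p \<in> mesh_vertices (mesh j)"
    using assms unfolding dofs_def interior_dofs_def dual_dofs_def corner_dofs_def by auto
  have "p \<notin> corners P \<and> p \<notin> frontier \<Omega>"
  proof (cases "Local j p \<in> dual_dofs P")
    case True
    then show ?thesis unfolding dual_dofs_def by auto
  next
    case False
    then have "p \<in> sub j" using assms unfolding dofs_def interior_dofs_def corner_dofs_def by auto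
    moreover have "p \<notin> frontier \<Omega>" using subdomain(6)[OF j(1)] \<open>p \<in> sub j\<close> domain(1) by (auto simp: frontier_def interior_open)
    ultimately show ?thesis using interior_not_in_frontier[OF j(1)] unfolding corners_def by auto
  qed
  then show "p \<notin> corners P" "p \<notin> frontier \<Omega>" by auto
qed

lemma corner_dof: "Corner p \<in> dofs \<Longrightarrow> p \<in> corners P \<and> p \<notin> frontier \<Omega>"
  unfolding dofs_def interior_dofs_def dual_dofs_def corner_dofs_def by auto

lemma nodal_basis:
  assumes "a \<in> dofs"
  shows "nodal_basis P a \<in> Xc_space P"
    and "\<And>j q. j < n \<Longrightarrow> q \<in> mesh_vertices (mesh j) \<Longrightarrow> nodal_basis P a j q = (if carries a j q then 1 else 0)"
proof -
  have "\<exists>!\<phi>. \<phi> \<in> Xc_space P \<and> (\<forall>j<n. \<forall>q\<in>mesh_vertices (mesh j). \<phi> j q = (if carries a j q then 1 else 0))"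
  proof (rule nodal_function_exists_unique)
    show "(if carries a j q then 1 else 0) = (0::real)" if jq: "j < n" "q \<in> frontier \<Omega>" for j q
    proof (cases a)
      case (Local i p)
      then have "p \<notin> frontier \<Omega>" using local_dof_not_corner(4)[of i p] assms by simp
      then have "p \<noteq> q" using jq(2) by metis
      then show ?thesis using Local by simp
    next
      case (Corner p)
      then have "p \<notin> frontier \<Omega>" using corner_dof[of p] assms by simp
      then have "p \<noteq> q" using jq(2) by metis
      then show ?thesis using Corner by simp
    qed
    show "(if carries a j q then 1 else 0) = (if carries a k q then 1 else (0::real))"
      if jkq: "j < n" "k < n" "q \<in> corners P" for j k q
    proof (cases a)
      case (Local i p)
      then have "p \<notin> corners P" using local_dof_not_corner(3)[of i p] assms by simp
      then have "p \<noteq> q" using jkq(3) by metis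
      then show ?thesis using Local by simp
    qed simp
  qed
  from theI'[OF this] show "nodal_basis P a \<in> Xc_space P"
    "\<And>j q. j < n \<Longrightarrow> q \<in> mesh_vertices (mesh j) \<Longrightarrow> nodal_basis P a j q = (if carries a j q then 1 else 0)"
    unfolding nodal_basis_def[symmetric] by blast+
qed

text \<open>At a suitable vertex, seen from a suitable subdomain, all basis functions but one vanish; so the
  coefficients of a combination can be read off.\<close>

lemma dof_location:
  assumes "a \<in> dofs"
  shows "\<exists>j p. j < n \<and> p \<in> mesh_vertices (mesh j) \<and> (\<forall>b\<in>dofs. carries b j p \<longleftrightarrow> b = a)"
proof (cases a)
  case (Local j p)
  then have "j < n" "p \<in> mesh_vertices (mesh j)" "p \<notin> corners P" using local_dof_not_corner assms by auto
  moreover have "carries b j p \<longleftrightarrow> b = a" if "b \<in> dofs" for b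
    using \<open>p \<notin> corners P\<close> corner_dof that Local by (cases b) (simp, metis carries.simps(2) dof.distinct(1))
  ultimately show ?thesis by blast
next
  case (Corner p)
  then have p: "p \<in> corners P" using corner_dof assms by auto
  then obtain j where j: "j < n" "p \<in> frontier (sub j)" unfolding corners_def by auto
  then have v: "p \<in> mesh_vertices (mesh j)" using corner_is_vertex[OF p j(1)] by (simp add: frontier_def)
  moreover have "carries b j p \<longleftrightarrow> b = a" if "b \<in> dofs" for b
    using p local_dof_not_corner(3) that Corner by (cases b) (metis carries.simps(1) dof.distinct(1), simp)
  ultimately show ?thesis using j by blast
qed

lemma P1_space_sum:
  assumes "\<And>i. i \<in> I \<Longrightarrow> \<phi> i \<in> P1_space \<T> D"
  shows "(\<lambda>x. \<Sum>i\<in>I. w i * \<phi> i x) \<in> P1_space \<T> D"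
proof -
  have "\<exists>a b. \<forall>x\<in>K. (\<Sum>i\<in>I. w i * \<phi> i x) = inner a x + b" if K: "K \<in> \<T>" for K
    using affine_sum[of I K \<phi> w] P1_space_affine[OF assms K] by blast
  moreover have "continuous_on (closure D) (\<lambda>x. \<Sum>i\<in>I. w i * \<phi> i x)"
    using assms unfolding P1_space_def by (intro continuous_intros) auto
  ultimately show ?thesis using assms unfolding P1_space_def by (auto intro!: sum.neutral)
qed

lemma Xc_corner:
  assumes "v \<in> Xc_space P" "p \<in> corners P" "j < n" "k < n" "p \<in> closure (sub j)" "p \<in> closure (sub k)"
  shows "v j p = v k p"
  using assms unfolding Xc_space_def by blast

lemma Xc_boundary:
  assumes "v \<in> Xc_space P" "j < n" "x \<in> frontier \<Omega>" "x \<in> closure (sub j)"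
  shows "v j x = 0"
  using assms unfolding Xc_space_def by blast

lemma Xc_outside:
  assumes "v \<in> Xc_space P" "n \<le> j"
  shows "v j = (\<lambda>_. 0)"
  using assms unfolding Xc_space_def by blast

lemma Xc_space_sum:
  assumes "\<And>i. i \<in> I \<Longrightarrow> \<phi> i \<in> Xc_space P"
  shows "(\<lambda>j x. \<Sum>i\<in>I. w i * \<phi> i j x) \<in> Xc_space P"
proof -
  have "(\<lambda>x. \<Sum>i\<in>I. w i * \<phi> i j x) \<in> P1_space (mesh j) (sub j)" if "j < n" for j
    using Xc_P1[OF assms that] by (intro P1_space_sum)
  moreover have "(\<Sum>i\<in>I. w i * \<phi> i j p) = (\<Sum>i\<in>I. w i * \<phi> i k p)"
    if c: "p \<in> corners P" "j < n" "k < n" "p \<in> closure (sub j) \<inter> closure (sub k)" for j k p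
    using Xc_corner[OF assms c(1-3)] c(4) by (intro sum.cong refl) simp
  moreover have "(\<Sum>i\<in>I. w i * \<phi> i j x) = 0" if x: "j < n" "x \<in> frontier \<Omega> \<inter> closure (sub j)" for j x
    using Xc_boundary[OF assms x(1)] x(2) by (intro sum.neutral ballI) simp
  moreover have "(\<lambda>x. \<Sum>i\<in>I. w i * \<phi> i j x) = (\<lambda>_. 0)" if j: "j \<ge> n" for j
    using Xc_outside[OF assms j] by (intro ext sum.neutral ballI) simp
  ultimately show ?thesis unfolding Xc_space_def by blast
qed

lemma broken_form_commute:
  assumes "u \<in> Xc_space P" "v \<in> Xc_space P"
  shows "broken_form P u v = broken_form P v u"
  unfolding broken_form_eq[OF assms] broken_form_eq[OF assms(2,1)] by (simp add: inner_commute)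

lemma broken_form_sum_left:
  assumes \<phi>: "\<And>i. i \<in> I \<Longrightarrow> \<phi> i \<in> Xc_space P" and v: "v \<in> Xc_space P"
  shows "broken_form P (\<lambda>j x. \<Sum>i\<in>I. w i * \<phi> i j x) v = (\<Sum>i\<in>I. w i * broken_form P (\<phi> i) v)"
proof -
  have g: "elem_grad (\<lambda>x. \<Sum>i\<in>I. w i * \<phi> i j x) T = (\<Sum>i\<in>I. w i *\<^sub>R elem_grad (\<phi> i j) T)" if j: "j < n" and T: "T \<in> mesh j" for j T
  proof (rule simplicial_mesh.elem_grad_sum[OF local_mesh[OF j] T])
    show "\<exists>a b. \<forall>x\<in>T. \<phi> i j x = inner a x + b" if "i \<in> I" for i
      using P1_space_affine[OF Xc_P1[OF \<phi>[OF that] j] T] by blast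
  qed
  have "broken_form P (\<lambda>j x. \<Sum>i\<in>I. w i * \<phi> i j x) v
      = (\<Sum>j<n. \<Sum>T\<in>mesh j. measure lborel T * inner (\<Sum>i\<in>I. w i *\<^sub>R elem_grad (\<phi> i j) T) (elem_grad (v j) T))"
  proof -
    have s: "(\<lambda>j x. \<Sum>i\<in>I. w i * \<phi> i j x) \<in> Xc_space P" by (rule Xc_space_sum[OF \<phi>])
    show ?thesis unfolding broken_form_eq[OF s v] using g by (intro sum.cong refl) simp
  qed
  also have "\<dots> = (\<Sum>j<n. \<Sum>T\<in>mesh j. \<Sum>i\<in>I. w i * (measure lborel T * inner (elem_grad (\<phi> i j) T) (elem_grad (v j) T)))"
    by (simp add: inner_sum_left sum_distrib_left mult_ac)
  also have "\<dots> = (\<Sum>j<n. \<Sum>i\<in>I. \<Sum>T\<in>mesh j. w i * (measure lborel T * inner (elem_grad (\<phi> i j) T) (elem_grad (v j) T)))"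
    by (intro sum.cong refl sum.swap)
  also have "\<dots> = (\<Sum>i\<in>I. \<Sum>j<n. \<Sum>T\<in>mesh j. w i * (measure lborel T * inner (elem_grad (\<phi> i j) T) (elem_grad (v j) T)))"
    by (rule sum.swap)
  also have "\<dots> = (\<Sum>i\<in>I. w i * broken_form P (\<phi> i) v)"
    using \<phi> v by (intro sum.cong) (auto simp: broken_form_eq sum_distrib_left)
  finally show ?thesis .
qed

lemma broken_form_sum_right:
  assumes \<phi>: "\<And>i. i \<in> I \<Longrightarrow> \<phi> i \<in> Xc_space P" and v: "v \<in> Xc_space P"
  shows "broken_form P v (\<lambda>j x. \<Sum>i\<in>I. w i * \<phi> i j x) = (\<Sum>i\<in>I. w i * broken_form P v (\<phi> i))"
proof -
  have "broken_form P v (\<lambda>j x. \<Sum>i\<in>I. w i * \<phi> i j x) = broken_form P (\<lambda>j x. \<Sum>i\<in>I. w i * \<phi> i j x) v"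
    using Xc_space_sum[OF \<phi>] v by (intro broken_form_commute)
  also have "\<dots> = (\<Sum>i\<in>I. w i * broken_form P (\<phi> i) v)" by (rule broken_form_sum_left[OF \<phi> v])
  also have "\<dots> = (\<Sum>i\<in>I. w i * broken_form P v (\<phi> i))"
    using broken_form_commute[OF \<phi> v] by (intro sum.cong refl) simp
  finally show ?thesis .
qed

lemma broken_form_nonneg: "v \<in> Xc_space P \<Longrightarrow> 0 \<le> broken_form P v v"
  by (simp add: broken_form_energy sum_nonneg mesh_energy_nonneg)

text \<open>Zero energy makes \<open>v\<close> constant on each subdomain. Subdomains that touch share a corner, so their
  constants agree; since the closure of \<open>\<Omega>\<close> is connected and covered by finitely many closed
  subdomains, there is only one constant. It is zero by the boundary condition.\<close>

lemma zero_energy_imp_zero: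
  assumes v: "v \<in> Xc_space P" and 0: "broken_form P v v = 0" and j: "j < n" and x: "x \<in> closure (sub j)"
  shows "v j x = 0"
proof -
  have "\<exists>c. \<forall>x\<in>closure (sub i). v i x = c" if i: "i < n" for i
  proof -
    interpret m: simplicial_mesh "mesh i" by (rule local_mesh[OF i])
    have "mesh_energy (mesh i) (v i) = 0"
      using 0 i unfolding broken_form_energy[OF v]
      by (subst (asm) sum_nonneg_eq_0_iff) (auto simp: mesh_energy_nonneg)
    then have g0: "elem_grad (v i) T = 0" if "T \<in> mesh i" for T
    proof -
      have "(norm (elem_grad (v i) T))\<^sup>2 * measure lborel T = 0"
        using \<open>mesh_energy (mesh i) (v i) = 0\<close> that m.fin unfolding mesh_energy_def
        by (subst (asm) sum_nonneg_eq_0_iff) auto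
      moreover have "0 < unit_ball_vol (real DIM('a)) * (h / (\<sigma> * \<tau>)) ^ DIM('a)" using h regularity_pos by simp
      then have "0 < measure lborel T" using element_measure(1)[of T] that mesh_subset[OF i] by fastforce
      ultimately show ?thesis by simp
    qed
    have "\<exists>b. \<forall>x\<in>T. v i x = b" if "T \<in> mesh i" for T
      using P1_space_affine[OF Xc_P1[OF v i] that] g0[OF that] by simp
    then obtain b where b: "\<And>T x. T \<in> mesh i \<Longrightarrow> x \<in> T \<Longrightarrow> v i x = b T" by metis
    have "v i ` closure (sub i) \<subseteq> b ` mesh i" using b mesh_covers[OF i] by blast
    then have "finite (v i ` closure (sub i))" using m.fin finite_subset by blast
    moreover have "connected (closure (sub i))" using subdomain(2)[OF i] by (rule connected_imp_connected_closure)
    moreover have "continuous_on (closure (sub i)) (v i)" using Xc_P1[OF v i] unfolding P1_space_def by simp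
    ultimately have "v i constant_on closure (sub i)" by (intro continuous_finite_range_constant)
    then show ?thesis unfolding constant_on_def by blast
  qed
  then obtain c where c: "\<And>i x. i < n \<Longrightarrow> x \<in> closure (sub i) \<Longrightarrow> v i x = c i" by metis
  have agree: "c i = c k" if ik: "i < n" "k < n" "x \<in> closure (sub i)" "x \<in> closure (sub k)" for i k x
  proof (cases "i = k")
    case False
    obtain q where q: "q \<in> corners P" "q \<in> closure (sub i)" "q \<in> closure (sub k)"
      using common_corner[OF ik(1,2) False ik(3,4)] by metis
    then have "v i q = v k q" using Xc_corner[OF v q(1) ik(1,2) q(2,3)] by blast
    then show ?thesis using c[OF ik(1) q(2)] c[OF ik(2) q(3)] by simp
  qed simp
  define pick where "pick x = (SOME i. i < n \<and> x \<in> closure (sub i))" for x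
  have pick: "pick x < n" "x \<in> closure (sub (pick x))" if "x \<in> closure \<Omega>" for x
    using someI_ex[of "\<lambda>i. i < n \<and> x \<in> closure (sub i)"] that closure_domain unfolding pick_def by auto
  define f where "f x = c (pick x)" for x
  have f: "f x = c i" if "i < n" "x \<in> closure (sub i)" for i x
  proof -
    have "x \<in> closure \<Omega>" using closure_domain that by auto
    then show ?thesis unfolding f_def using agree[OF pick(1) that(1) pick(2) that(2)] by simp
  qed
  have "continuous_on (\<Union>i\<in>{..<n}. closure (sub i)) f"
  proof (rule continuous_on_closed_Union)
    show "continuous_on (closure (sub i)) f" if "i \<in> {..<n}" for i
      using f that by (subst continuous_on_cong[OF refl, of _ _ "\<lambda>_. c i"]) auto
  qed auto
  then have "continuous_on (closure \<Omega>) f" unfolding closure_domain .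
  moreover have "f ` closure \<Omega> \<subseteq> c ` {..<n}" using f closure_domain by auto
  then have "finite (f ` closure \<Omega>)" using finite_subset by blast
  moreover have "connected (closure \<Omega>)" using domain(2) by (rule connected_imp_connected_closure)
  ultimately have "f constant_on closure \<Omega>" by (intro continuous_finite_range_constant)
  then obtain a where a: "\<And>x. x \<in> closure \<Omega> \<Longrightarrow> f x = a" unfolding constant_on_def by blast
  have "\<Omega> \<noteq> UNIV" using domain(3) not_bounded_UNIV by metis
  then have "frontier \<Omega> \<noteq> {}" using frontier_not_empty domain(4) by blast
  then obtain y where y: "y \<in> frontier \<Omega>" by auto
  then have yc: "y \<in> closure \<Omega>" by (simp add: frontier_def)
  then obtain i where i: "i < n" "y \<in> closure (sub i)" using closure_domain by auto
  have "v i y = 0" using Xc_boundary[OF v i(1) y i(2)] .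
  then have "a = 0" using a[OF yc] f[OF i] c[OF i] by simp
  moreover have "x \<in> closure \<Omega>" using closure_domain j x by auto
  ultimately show ?thesis using a f[OF j x] c[OF j x] by simp
qed

end

section \<open>Jumps across the interface\<close>

definition node_const :: "nat \<Rightarrow> real \<Rightarrow> real" where
  "node_const d s = 64 * s ^ (d + 1) * (1 + 2 * s)\<^sup>2"

definition jump_const :: "nat \<Rightarrow> real \<Rightarrow> nat \<Rightarrow> real" where
  "jump_const d s M = 4 * pointwise_const d s * s ^ d * real M * node_const d s"

fun dof_node :: "'a dof \<Rightarrow> 'a" where
  "dof_node (Local j p) = p"
| "dof_node (Corner p) = p"

context domain_decomposition
begin

definition boundary_nodes :: "nat \<Rightarrow> 'a set" where
  "boundary_nodes j = frontier (sub j) \<inter> mesh_vertices (mesh j)"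

lemma card_boundary_nodes:
  assumes j: "j < n"
  shows "real (card (boundary_nodes j)) \<le> real M * (node_const DIM('a) (\<sigma> * \<tau>) * (H / h) ^ (DIM('a) - 1))"
proof -
  let ?N = "node_const DIM('a) (\<sigma> * \<tau>) * (H / h) ^ (DIM('a) - 1)"
  have N0: "0 \<le> ?N" unfolding node_const_def using regularity_pos h by simp
  obtain \<K> where K: "\<K> \<subseteq> coarse_mesh P" "card \<K> \<le> M" "closure (sub j) = \<Union>\<K>"
    using subdomain(7)[OF j] by blast
  have "finite (coarse_mesh P)" using adm unfolding admissible_decomposition_def conforming_mesh_def by simp
  then have fK: "finite \<K>" using K(1) finite_subset by blast
  have fin: "finite (frontier K \<inter> mesh_vertices all_elements)"
    and le: "real (card (frontier K \<inter> mesh_vertices all_elements)) \<le> ?N" if "K \<in> \<K>" for K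
    using card_nodes_on_coarse_boundary[of K] that K(1) unfolding node_const_def by (auto simp: mult.assoc)
  have sub: "boundary_nodes j \<subseteq> (\<Union>K\<in>\<K>. frontier K \<inter> mesh_vertices all_elements)"
  proof
    fix p assume p: "p \<in> boundary_nodes j"
    then have "p \<in> closure (sub j)" unfolding boundary_nodes_def by (simp add: frontier_def)
    then obtain K where Kp: "K \<in> \<K>" "p \<in> K" using K(3) by auto
    have "K \<subseteq> closure (sub j)" using Kp(1) K(3) by auto
    moreover have "closed K" using coarse_element(1)[of K] Kp(1) K(1) compact_imp_closed by blast
    ultimately have "p \<in> frontier K"
      using frontier_of_coarse_element[OF j _ _ Kp(2)] p unfolding boundary_nodes_def by blast
    moreover have "p \<in> mesh_vertices all_elements"
      using p mesh_subset[OF j] unfolding boundary_nodes_def mesh_vertices_def by auto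
    ultimately show "p \<in> (\<Union>K\<in>\<K>. frontier K \<inter> mesh_vertices all_elements)" using Kp(1) by blast
  qed
  have "card (boundary_nodes j) \<le> card (\<Union>K\<in>\<K>. frontier K \<inter> mesh_vertices all_elements)"
    by (rule card_mono[OF finite_UN_I[OF fK fin] sub])
  also have "\<dots> \<le> (\<Sum>K\<in>\<K>. card (frontier K \<inter> mesh_vertices all_elements))" by (rule card_UN_le[OF fK])
  finally have "real (card (boundary_nodes j)) \<le> real (\<Sum>K\<in>\<K>. card (frontier K \<inter> mesh_vertices all_elements))"
    by (simp only: of_nat_le_iff)
  also have "\<dots> = (\<Sum>K\<in>\<K>. real (card (frontier K \<inter> mesh_vertices all_elements)))" by (rule of_nat_sum)
  also have "\<dots> \<le> (\<Sum>K\<in>\<K>. ?N)" using le by (intro sum_mono) auto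
  also have "\<dots> = real (card \<K>) * ?N" by simp
  also have "\<dots> \<le> real M * ?N" using K(2) N0 by (intro mult_right_mono) auto
  finally show ?thesis .
qed

lemma finite_boundary_nodes: "j < n \<Longrightarrow> finite (boundary_nodes j)"
  unfolding boundary_nodes_def using finite_mesh_vertices by blast

lemma dual_dof_node:
  assumes "Local j p \<in> dual_dofs P"
  shows "j < n" "p \<in> mesh_vertices (mesh j)" "p \<in> closure (sub j)" "p \<in> frontier (sub j)"
proof -
  show j: "j < n" "p \<in> mesh_vertices (mesh j)" using assms unfolding dual_dofs_def by auto
  then show c: "p \<in> closure (sub j)"
    using mesh_covers[OF j(1)] unfolding mesh_vertices_def extreme_point_of_def by auto
  have "p \<in> interface P" using assms unfolding dual_dofs_def by auto
  then obtain k where k: "k < n" "p \<in> frontier (sub k)" unfolding interface_def by auto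
  have "p \<notin> sub j" using interior_not_in_frontier[OF j(1) k(1)] k(2) by blast
  then show "p \<in> frontier (sub j)" using c subdomain(1)[OF j(1)] by (simp add: frontier_def interior_open)
qed

lemma interface_jump:
  assumes "(j, k, p) \<in> interface_jumps P"
  shows "j < k" "j < n" "k < n" "p \<in> boundary_nodes j" "p \<in> boundary_nodes k" "Local j p \<in> dual_dofs P" "Local k p \<in> dual_dofs P"
  using assms dual_dof_node unfolding interface_jumps_def boundary_nodes_def by auto

lemma interface_jumpI:
  assumes "Local j p \<in> dual_dofs P" "Local k p \<in> dual_dofs P" "j < k"
  shows "(j, k, p) \<in> interface_jumps P"
  using assms dual_dof_node[OF assms(1)] dual_dof_node[OF assms(2)] unfolding interface_jumps_def by simp

lemma finite_interface_jumps: "finite (interface_jumps P)"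
proof (rule finite_subset)
  show "interface_jumps P \<subseteq> {..<n} \<times> {..<n} \<times> (\<Union>j<n. boundary_nodes j)"
    using interface_jump by fastforce
  show "finite ({..<n} \<times> {..<n} \<times> (\<Union>j<n. boundary_nodes j))" using finite_boundary_nodes by auto
qed

lemma card_jumps_of_subdomain:
  assumes j: "j < n" and E: "E \<subseteq> interface_jumps P" and inj: "inj_on f E"
    and f: "\<And>e. e \<in> E \<Longrightarrow> f e \<in> Sigma (boundary_nodes j) (\<lambda>p. {k. k < n \<and> p \<in> mesh_vertices (mesh k)})"
  shows "real (card E) \<le> (\<sigma> * \<tau>) ^ DIM('a) * (real M * (node_const DIM('a) (\<sigma> * \<tau>) * (H / h) ^ (DIM('a) - 1)))"
proof -
  let ?A = "\<lambda>p. {k. k < n \<and> p \<in> mesh_vertices (mesh k)}"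
  have fA: "finite (Sigma (boundary_nodes j) ?A)" using finite_boundary_nodes[OF j] by (intro finite_SigmaI) auto
  have "card E \<le> card (Sigma (boundary_nodes j) ?A)" by (rule card_inj_on_le[OF inj image_subsetI[OF f] fA])
  also have "\<dots> = (\<Sum>p\<in>boundary_nodes j. card (?A p))" using finite_boundary_nodes[OF j] by (intro card_SigmaI) auto
  finally have "real (card E) \<le> real (\<Sum>p\<in>boundary_nodes j. card (?A p))" by (simp only: of_nat_le_iff)
  also have "\<dots> = (\<Sum>p\<in>boundary_nodes j. real (card (?A p)))" by (rule of_nat_sum)
  also have "\<dots> \<le> (\<Sum>p\<in>boundary_nodes j. (\<sigma> * \<tau>) ^ DIM('a))" by (intro sum_mono card_subdomains_at_node)
  also have "\<dots> = (\<sigma> * \<tau>) ^ DIM('a) * real (card (boundary_nodes j))" by simp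
  also have "\<dots> \<le> (\<sigma> * \<tau>) ^ DIM('a) * (real M * (node_const DIM('a) (\<sigma> * \<tau>) * (H / h) ^ (DIM('a) - 1)))"
    using card_boundary_nodes[OF j] regularity_pos by (intro mult_left_mono) auto
  finally show ?thesis .
qed

text \<open>At a common corner \<open>c\<close> the two sides have the same value. Hence the jump at \<open>p\<close> is the difference of
  \<open>v j p - v j c\<close> and \<open>v k p - v k c\<close>, and both are bounded by the pointwise estimate on a coarse element.
  Each subdomain takes part in at most a multiple of \<open>H / h\<close> to the power \<open>DIM('a) - 1\<close> of the jumps.\<close>

lemma jump_energy_bound:
  assumes v: "v \<in> Xc_space P"
  shows "(\<Sum>(j, k, p)\<in>interface_jumps P. (v j p - v k p)\<^sup>2)
           \<le> jump_const DIM('a) (\<sigma> * \<tau>) M * C_upper DIM('a) H h * broken_form P v v"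
proof -
  let ?IJ = "interface_jumps P"
  define a where "a = pointwise_const DIM('a) (\<sigma> * \<tau>) * log_factor DIM('a) H h"
  define E where "E j = mesh_energy (mesh j) (v j)" for j
  define Q where "Q = (\<sigma> * \<tau>) ^ DIM('a) * (real M * (node_const DIM('a) (\<sigma> * \<tau>) * (H / h) ^ (DIM('a) - 1)))"
  have a0: "0 \<le> a"
    unfolding a_def pointwise_const_def using regularity_pos log_factor_pos
    by (intro mult_nonneg_nonneg divide_nonneg_nonneg) auto
  have E0: "0 \<le> E j" for j unfolding E_def by (rule mesh_energy_nonneg)
  have single: "(v j p - v k p)\<^sup>2 \<le> 2 * a * E j + 2 * a * E k" if e: "(j, k, p) \<in> ?IJ" for j k p
  proof -
    note J = interface_jump[OF e]
    have pc: "p \<in> closure (sub j)" "p \<in> closure (sub k)"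
      using dual_dof_node(3) J(6,7) by auto
    have ne: "j \<noteq> k" using J(1) by simp
    obtain K K' c where K: "K \<in> coarse_mesh P" "K \<subseteq> closure (sub j)" "K' \<in> coarse_mesh P" "K' \<subseteq> closure (sub k)"
      "p \<in> frontier K" "c \<in> frontier K" "p \<in> frontier K'" "c \<in> frontier K'"
      "c \<in> corners P" "c \<in> closure (sub j)" "c \<in> closure (sub k)"
      using common_corner[OF J(2,3) ne pc] .
    have e1: "(v j p - v j c)\<^sup>2 \<le> a * E j"
      unfolding a_def E_def by (rule pointwise_estimate[OF K(1,2) J(2) Xc_P1[OF v J(2)] K(5,6)])
    have e2: "(v k p - v k c)\<^sup>2 \<le> a * E k"
      unfolding a_def E_def by (rule pointwise_estimate[OF K(3,4) J(3) Xc_P1[OF v J(3)] K(7,8)])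
    have eq: "v j c = v k c" by (rule Xc_corner[OF v K(9) J(2,3) K(10,11)])
    have "(x - y)\<^sup>2 \<le> 2 * x\<^sup>2 + 2 * y\<^sup>2" for x y :: real
      using zero_le_power2[of "x + y"] by (simp add: power2_sum power2_diff)
    from this[of "v j p - v j c" "v k p - v k c"] eq
    have "(v j p - v k p)\<^sup>2 \<le> 2 * (v j p - v j c)\<^sup>2 + 2 * (v k p - v k c)\<^sup>2" by simp
    then show ?thesis using e1 e2 by (simp add: mult.assoc)
  qed
  have fibre: "(\<Sum>e\<in>?IJ. E (g e)) \<le> Q * (\<Sum>j<n. E j)"
    if g: "\<And>e. e \<in> ?IJ \<Longrightarrow> g e < n" and c: "\<And>j. j < n \<Longrightarrow> real (card {e \<in> ?IJ. g e = j}) \<le> Q" for g :: "nat \<times> nat \<times> 'a \<Rightarrow> nat"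
  proof -
    have "(\<Sum>e\<in>?IJ. E (g e)) = (\<Sum>j<n. \<Sum>e\<in>{e \<in> ?IJ. g e = j}. E (g e))"
      using finite_interface_jumps g by (intro sum.group[symmetric]) auto
    also have "\<dots> = (\<Sum>j<n. real (card {e \<in> ?IJ. g e = j}) * E j)" by (intro sum.cong) auto
    also have "\<dots> \<le> (\<Sum>j<n. Q * E j)" using c E0 by (intro sum_mono mult_right_mono) auto
    finally show ?thesis by (simp add: sum_distrib_left)
  qed
  have f1: "(\<Sum>e\<in>?IJ. E (fst e)) \<le> Q * (\<Sum>j<n. E j)"
  proof (rule fibre)
    show "fst e < n" if "e \<in> ?IJ" for e using interface_jump(2) that by (cases e) auto
    show "real (card {e \<in> ?IJ. fst e = j}) \<le> Q" if j: "j < n" for j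
      unfolding Q_def
    proof (rule card_jumps_of_subdomain[OF j])
      show "inj_on (\<lambda>(j, k, p). (p, k)) {e \<in> ?IJ. fst e = j}" by (auto simp: inj_on_def)
      show "(\<lambda>(j, k, p). (p, k)) e \<in> Sigma (boundary_nodes j) (\<lambda>p. {k. k < n \<and> p \<in> mesh_vertices (mesh k)})"
        if "e \<in> {e \<in> ?IJ. fst e = j}" for e
        using that interface_jump dual_dof_node by (cases e) fastforce
    qed auto
  qed
  have f2: "(\<Sum>e\<in>?IJ. E (fst (snd e))) \<le> Q * (\<Sum>j<n. E j)"
  proof (rule fibre)
    show "fst (snd e) < n" if "e \<in> ?IJ" for e using interface_jump(3) that by (cases e) auto
    show "real (card {e \<in> ?IJ. fst (snd e) = j}) \<le> Q" if j: "j < n" for j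
      unfolding Q_def
    proof (rule card_jumps_of_subdomain[OF j])
      show "inj_on (\<lambda>(j, k, p). (p, j)) {e \<in> ?IJ. fst (snd e) = j}" by (auto simp: inj_on_def)
      show "(\<lambda>(j, k, p). (p, j)) e \<in> Sigma (boundary_nodes j) (\<lambda>p. {k. k < n \<and> p \<in> mesh_vertices (mesh k)})"
        if "e \<in> {e \<in> ?IJ. fst (snd e) = j}" for e
        using that interface_jump dual_dof_node by (cases e) fastforce
    qed auto
  qed
  have "(\<Sum>(j, k, p)\<in>?IJ. (v j p - v k p)\<^sup>2) \<le> (\<Sum>e\<in>?IJ. 2 * a * E (fst e) + 2 * a * E (fst (snd e)))"
    using single by (intro sum_mono) (auto split: prod.split)
  also have "\<dots> = 2 * a * (\<Sum>e\<in>?IJ. E (fst e)) + 2 * a * (\<Sum>e\<in>?IJ. E (fst (snd e)))"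
    by (simp add: sum.distrib sum_distrib_left)
  also have "\<dots> \<le> 2 * a * (Q * (\<Sum>j<n. E j)) + 2 * a * (Q * (\<Sum>j<n. E j))"
    using f1 f2 a0 by (intro add_mono mult_left_mono) auto
  also have "\<dots> = 4 * a * Q * broken_form P v v"
    unfolding broken_form_energy[OF v] E_def by (simp add: mult.assoc)
  also have "4 * a * Q = jump_const DIM('a) (\<sigma> * \<tau>) M * C_upper DIM('a) H h"
    unfolding a_def Q_def jump_const_def C_upper_eq by (simp add: mult_ac)
  finally show ?thesis .
qed

lemma finite_dual_dofs: "finite (dual_dofs P)"
proof (rule finite_subset)
  show "dual_dofs P \<subseteq> (\<lambda>(j, p). Local j p) ` Sigma {..<n} (\<lambda>j. mesh_vertices (mesh j))"
    unfolding dual_dofs_def by auto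
  show "finite ((\<lambda>(j, p). Local j p) ` Sigma {..<n} (\<lambda>j. mesh_vertices (mesh j)))"
    using finite_mesh_vertices by auto
qed

lemma card_dual_dofs_at_node: "real (card {a \<in> dual_dofs P. dof_node a = p}) \<le> (\<sigma> * \<tau>) ^ DIM('a)"
proof -
  have "{a \<in> dual_dofs P. dof_node a = p} \<subseteq> (\<lambda>j. Local j p) ` {j. j < n \<and> p \<in> mesh_vertices (mesh j)}"
    unfolding dual_dofs_def by auto
  then have "card {a \<in> dual_dofs P. dof_node a = p} \<le> card ((\<lambda>j. Local j p) ` {j. j < n \<and> p \<in> mesh_vertices (mesh j)})"
    by (intro card_mono) auto
  also have "\<dots> \<le> card {j. j < n \<and> p \<in> mesh_vertices (mesh j)}" by (intro card_image_le) auto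
  finally show ?thesis using card_subdomains_at_node[of p] by linarith
qed

lemma card_jumps_at_node:
  "real (card {e \<in> interface_jumps P. snd (snd e) = p}) \<le> ((\<sigma> * \<tau>) ^ DIM('a))\<^sup>2"
proof -
  let ?S = "{j. j < n \<and> p \<in> mesh_vertices (mesh j)}"
  have "card {e \<in> interface_jumps P. snd (snd e) = p} \<le> card (?S \<times> ?S)"
  proof (rule card_inj_on_le)
    show "inj_on (\<lambda>(j, k, p). (j, k)) {e \<in> interface_jumps P. snd (snd e) = p}" by (auto simp: inj_on_def)
    show "(\<lambda>(j, k, p). (j, k)) ` {e \<in> interface_jumps P. snd (snd e) = p} \<subseteq> ?S \<times> ?S"
      using interface_jump unfolding boundary_nodes_def by fastforce
  qed auto
  also have "\<dots> = card ?S * card ?S" by (rule card_cartesian_product)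
  finally have "real (card {e \<in> interface_jumps P. snd (snd e) = p}) \<le> real (card ?S * card ?S)"
    by (simp only: of_nat_le_iff)
  also have "\<dots> = real (card ?S) * real (card ?S)" by (rule of_nat_mult)
  also have "\<dots> \<le> (\<sigma> * \<tau>) ^ DIM('a) * (\<sigma> * \<tau>) ^ DIM('a)"
    using card_subdomains_at_node[of p] regularity_pos by (intro mult_mono) auto
  finally show ?thesis by (simp add: power2_eq_square)
qed

text \<open>For a threshold \<open>s\<close> strictly between the two values, the indicator of the values above \<open>s\<close> has a jump at
  \<open>p\<close>, so it has a jump that belongs to \<open>J\<close>. Hence the intervals spanned by the jumps in \<open>J\<close> cover all
  thresholds, and their lengths add up to at least the difference.\<close>

lemma difference_le_sum_of_jumps:
  fixes W :: "nat \<Rightarrow> 'a \<Rightarrow> real"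
  assumes J: "jump_constraints P J" and d: "Local i p \<in> dual_dofs P" "Local k p \<in> dual_dofs P"
  shows "W k p - W i p \<le> (\<Sum>e\<in>{e \<in> J. snd (snd e) = p}. \<bar>W (fst e) p - W (fst (snd e)) p\<bar>)"
proof (cases "W i p < W k p")
  case False
  then show ?thesis by (smt (verit) sum_nonneg abs_ge_zero)
next
  case True
  let ?Jp = "{e \<in> J. snd (snd e) = p}"
  have sub: "J \<subseteq> interface_jumps P" using J unfolding jump_constraints_def by auto
  then have fJ: "finite ?Jp" using finite_interface_jumps finite_subset by fastforce
  define I where "I e = {min (W (fst e) p) (W (fst (snd e)) p)..max (W (fst e) p) (W (fst (snd e)) p)}" for e :: "nat \<times> nat \<times> 'a"
  have "{W i p<..<W k p} \<subseteq> (\<Union>e\<in>?Jp. I e)"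
  proof
    fix s assume s: "s \<in> {W i p<..<W k p}"
    define w where "w j q = (if q = p \<and> s < W j p then 1 else (0::real))" for j and q :: 'a
    have ik: "i \<noteq> k" using True by auto
    have wne: "w i p \<noteq> w k p" using s unfolding w_def by auto
    have "\<exists>(j, l, q)\<in>interface_jumps P. w j q \<noteq> w l q"
    proof (cases "i < k")
      case True
      then have "(i, k, p) \<in> interface_jumps P" using interface_jumpI[OF d] by simp
      then show ?thesis using wne by blast
    next
      case False
      then have "(k, i, p) \<in> interface_jumps P" using interface_jumpI[OF d(2,1)] ik by simp
      then show ?thesis using wne by (metis (mono_tags, lifting) case_prodI)
    qed
    then have "\<not> (\<forall>(j, l, q)\<in>interface_jumps P. w j q = w l q)" by blast
    then have "\<not> (\<forall>(j, l, q)\<in>J. w j q = w l q)" using J unfolding jump_constraints_def by blast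
    then obtain j l q where e: "(j, l, q) \<in> J" "w j q \<noteq> w l q" by blast
    have q: "q = p" using e(2) unfolding w_def by (auto split: if_splits)
    have "s \<in> I (j, l, q)" using e(2) q unfolding w_def I_def by (auto split: if_splits)
    then show "s \<in> (\<Union>e\<in>?Jp. I e)" using e(1) q by force
  qed
  then have "measure lebesgue {W i p<..<W k p} \<le> measure lebesgue (\<Union>e\<in>?Jp. I e)"
    using fJ unfolding I_def by (intro measure_mono_fmeasurable fmeasurable.finite_UN) auto
  also have "\<dots> \<le> (\<Sum>e\<in>?Jp. measure lebesgue (I e))"
    using fJ unfolding I_def by (intro measure_UNION_le) auto
  also have "\<dots> = (\<Sum>e\<in>?Jp. \<bar>W (fst e) p - W (fst (snd e)) p\<bar>)"
    unfolding I_def by (intro sum.cong) (auto simp: min_def max_def)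
  finally show ?thesis using True by simp
qed

text \<open>At every node one adjacent subdomain is singled out. Subtracting its value from all values at the
  node does not change the jumps.\<close>

definition reference_subdomain :: "'a \<Rightarrow> nat" where
  "reference_subdomain p = (SOME i. Local i p \<in> dual_dofs P)"

text \<open>The jump constraints decouple into one connected graph for each node, of bounded size. So the values
  relative to the reference subdomain are bounded by the jumps, with a constant independent of the mesh.\<close>

lemma jump_graph_bound:
  fixes W :: "nat \<Rightarrow> 'a \<Rightarrow> real"
  assumes J: "jump_constraints P J"
  shows "(\<Sum>a\<in>dual_dofs P. case a of Local j p \<Rightarrow> (W j p - W (reference_subdomain p) p)\<^sup>2 | Corner p \<Rightarrow> 0)
           \<le> ((\<sigma> * \<tau>) ^ DIM('a)) ^ 3 * (\<Sum>(j, k, p)\<in>J. (W j p - W k p)\<^sup>2)"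
proof -
  define N where "N = (\<sigma> * \<tau>) ^ DIM('a)"
  have N0: "0 \<le> N" unfolding N_def using regularity_pos by simp
  have sub: "J \<subseteq> interface_jumps P" using J unfolding jump_constraints_def by auto
  have fJ: "finite J" using sub finite_interface_jumps finite_subset by blast
  define Jp where "Jp p = {e \<in> J. snd (snd e) = p}" for p
  define l where "l e = (W (fst e) (snd (snd e)) - W (fst (snd e)) (snd (snd e)))\<^sup>2" for e :: "nat \<times> nat \<times> 'a"
  have l0: "0 \<le> l e" for e unfolding l_def by simp
  have fJp: "finite (Jp p)" for p unfolding Jp_def using fJ by simp
  have single: "(case a of Local j p \<Rightarrow> (W j p - W (reference_subdomain p) p)\<^sup>2 | Corner p \<Rightarrow> 0) \<le> N\<^sup>2 * (\<Sum>e\<in>Jp (dof_node a). l e)"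
    if a: "a \<in> dual_dofs P" for a
  proof (cases a)
    case (Corner p)
    then show ?thesis using l0 N0 by (simp add: sum_nonneg)
  next
    case (Local j p)
    then have d1: "Local j p \<in> dual_dofs P" using a by simp
    have d2: "Local (reference_subdomain p) p \<in> dual_dofs P"
      unfolding reference_subdomain_def using d1 by (rule someI)
    let ?s = "\<Sum>e\<in>Jp p. \<bar>W (fst e) p - W (fst (snd e)) p\<bar>"
    have "W j p - W (reference_subdomain p) p \<le> ?s" "W (reference_subdomain p) p - W j p \<le> ?s"
      using difference_le_sum_of_jumps[OF J d1 d2] difference_le_sum_of_jumps[OF J d2 d1] unfolding Jp_def by blast+
    then have "\<bar>W j p - W (reference_subdomain p) p\<bar> \<le> ?s" by (intro abs_leI) auto
    then have "\<bar>W j p - W (reference_subdomain p) p\<bar>\<^sup>2 \<le> ?s\<^sup>2" by (rule power_mono) simp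
    then have "(W j p - W (reference_subdomain p) p)\<^sup>2 \<le> ?s\<^sup>2" unfolding power2_abs .
    also have "\<dots> \<le> (\<Sum>e\<in>Jp p. \<bar>W (fst e) p - W (fst (snd e)) p\<bar>\<^sup>2) * real (card (Jp p))"
      by (rule sum_squared_le_sum_of_squares)
    also have "(\<Sum>e\<in>Jp p. \<bar>W (fst e) p - W (fst (snd e)) p\<bar>\<^sup>2) = (\<Sum>e\<in>Jp p. l e)"
      unfolding power2_abs by (rule sum.cong) (auto simp: l_def Jp_def)
    also have "(\<Sum>e\<in>Jp p. l e) * real (card (Jp p)) \<le> (\<Sum>e\<in>Jp p. l e) * N\<^sup>2"
    proof (rule mult_left_mono)
      have "card (Jp p) \<le> card {e \<in> interface_jumps P. snd (snd e) = p}"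
        unfolding Jp_def using sub finite_interface_jumps by (intro card_mono) auto
      then show "real (card (Jp p)) \<le> N\<^sup>2" using card_jumps_at_node[of p] unfolding N_def by linarith
    qed (simp add: l0 sum_nonneg)
    finally show ?thesis using Local by (simp add: mult.commute)
  qed
  have "(\<Sum>a\<in>dual_dofs P. case a of Local j p \<Rightarrow> (W j p - W (reference_subdomain p) p)\<^sup>2 | Corner p \<Rightarrow> 0)
      \<le> (\<Sum>a\<in>dual_dofs P. N\<^sup>2 * (\<Sum>e\<in>Jp (dof_node a). l e))" by (intro sum_mono single)
  also have "\<dots> = N\<^sup>2 * (\<Sum>a\<in>dual_dofs P. \<Sum>e\<in>J. if snd (snd e) = dof_node a then l e else 0)"
    unfolding Jp_def using fJ by (simp add: sum_distrib_left sum.inter_filter)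
  also have "(\<Sum>a\<in>dual_dofs P. \<Sum>e\<in>J. if snd (snd e) = dof_node a then l e else 0)
      = (\<Sum>e\<in>J. \<Sum>a\<in>dual_dofs P. if snd (snd e) = dof_node a then l e else 0)" by (rule sum.swap)
  also have "\<dots> = (\<Sum>e\<in>J. real (card {a \<in> dual_dofs P. dof_node a = snd (snd e)}) * l e)"
    using finite_dual_dofs by (intro sum.cong) (auto simp: sum.inter_filter[symmetric] eq_commute)
  also have "N\<^sup>2 * \<dots> \<le> N\<^sup>2 * (\<Sum>e\<in>J. N * l e)"
    using card_dual_dofs_at_node l0 unfolding N_def by (intro mult_left_mono sum_mono mult_right_mono) auto
  also have "\<dots> = N ^ 3 * (\<Sum>e\<in>J. l e)" by (simp add: sum_distrib_left power2_eq_square power3_eq_cube mult.assoc)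
  also have "(\<Sum>e\<in>J. l e) = (\<Sum>(j, k, p)\<in>J. (W j p - W k p)\<^sup>2)"
    unfolding l_def by (intro sum.cong) auto
  finally show ?thesis unfolding N_def .
qed

end

section \<open>The FETI-DP matrices\<close>

text \<open>Enumerations of the unknowns and of the constraints turn the forms into matrices.\<close>

locale fetidp_problem = domain_decomposition +
  fixes rs ds :: "'a dof list" and js :: "(nat \<times> nat \<times> 'a) list"
  assumes rs: "distinct rs" "set rs = interior_dofs P \<union> corner_dofs P"
    and ds: "distinct ds" "set ds = dual_dofs P"
    and js: "distinct js" "jump_constraints P (set js)"
begin

text \<open>The finite element function with the coefficient vector \<open>w\<close> in the basis enumerated by \<open>xs\<close>.\<close>

definition dof_combination :: "'a dof list \<Rightarrow> real Matrix.vec \<Rightarrow> nat \<Rightarrow> 'a \<Rightarrow> real" where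
  "dof_combination xs w = (\<lambda>j x. \<Sum>i<length xs. vec_index w i * nodal_basis P (xs ! i) j x)"

lemma rs_dofs: "set rs \<subseteq> dofs" and ds_dofs: "set ds \<subseteq> dofs"
  unfolding dofs_def using rs ds by auto

lemma rs_ds_disjoint: "set rs \<inter> set ds = {}"
proof -
  have "Local j p \<notin> dual_dofs P" if "Local j p \<in> interior_dofs P" for j p
  proof
    assume "Local j p \<in> dual_dofs P"
    then have "p \<in> frontier (sub j)" "j < n" using dual_dof_node by auto
    moreover have "p \<in> sub j" using that unfolding interior_dofs_def by auto
    ultimately show False using interior_not_in_frontier by blast
  qed
  note loc = this
  have "a \<notin> set rs" if a: "a \<in> set ds" for a
  proof -
    have ad: "a \<in> dual_dofs P" using a by (simp only: ds(2))
    then obtain j p where "a = Local j p" unfolding dual_dofs_def by auto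
    then have "a \<notin> interior_dofs P" "a \<notin> corner_dofs P" using loc ad unfolding corner_dofs_def by auto
    then show ?thesis unfolding rs(2) by simp
  qed
  then show ?thesis by blast
qed

lemma nodal_basis_nth: "set xs \<subseteq> dofs \<Longrightarrow> i < length xs \<Longrightarrow> nodal_basis P (xs ! i) \<in> Xc_space P"
  by (rule nodal_basis(1)) (use nth_mem in blast)

lemma dof_combination_in_Xc:
  assumes "set xs \<subseteq> dofs"
  shows "dof_combination xs w \<in> Xc_space P"
  unfolding dof_combination_def using nodal_basis_nth[OF assms] by (intro Xc_space_sum) simp

lemma dof_combination_at_vertex:
  assumes "set xs \<subseteq> dofs" "j < n" "q \<in> mesh_vertices (mesh j)"
  shows "dof_combination xs w j q = (\<Sum>i<length xs. if carries (xs ! i) j q then vec_index w i else 0)"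
  unfolding dof_combination_def
proof (rule sum.cong[OF refl])
  fix i assume "i \<in> {..<length xs}"
  then have "xs ! i \<in> dofs" using assms(1) by auto
  then show "vec_index w i * nodal_basis P (xs ! i) j q = (if carries (xs ! i) j q then vec_index w i else 0)"
    using nodal_basis(2)[of "xs ! i"] assms by simp
qed

lemma dof_combination_at_location:
  assumes xs: "set xs \<subseteq> dofs" "distinct xs" and i: "i < length xs"
    and loc: "j < n" "q \<in> mesh_vertices (mesh j)" "\<And>b. b \<in> dofs \<Longrightarrow> carries b j q \<longleftrightarrow> b = xs ! i"
  shows "dof_combination xs w j q = vec_index w i"
proof -
  have "carries (xs ! k) j q \<longleftrightarrow> k = i" if "k < length xs" for k
    using loc(3)[of "xs ! k"] xs i that nth_eq_iff_index_eq[OF xs(2) that i] by (auto dest: nth_mem)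
  then have "dof_combination xs w j q = (\<Sum>k<length xs. if k = i then vec_index w i else 0)"
    unfolding dof_combination_at_vertex[OF xs(1) loc(1,2)] by (intro sum.cong) auto
  then show ?thesis using i by simp
qed

lemma dof_combination_eq_zero:
  assumes xs: "set xs \<subseteq> dofs" "distinct xs" and w: "w \<in> carrier_vec (length xs)"
    and 0: "\<And>j q. j < n \<Longrightarrow> q \<in> mesh_vertices (mesh j) \<Longrightarrow> dof_combination xs w j q = 0"
  shows "w = 0\<^sub>v (length xs)"
proof (rule eq_vecI)
  fix i assume "i < dim_vec (0\<^sub>v (length xs) :: real Matrix.vec)"
  then have i: "i < length xs" by simp
  then have "xs ! i \<in> dofs" using xs(1) by auto
  then obtain j q where loc: "j < n" "q \<in> mesh_vertices (mesh j)" "\<forall>b\<in>dofs. carries b j q \<longleftrightarrow> b = xs ! i"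
    using dof_location by blast
  have "dof_combination xs w j q = vec_index w i"
    by (rule dof_combination_at_location[OF xs i loc(1,2)]) (use loc(3) in blast)
  then show "vec_index w i = vec_index (0\<^sub>v (length xs)) i" using 0[OF loc(1,2)] i by simp
qed (use w in simp)

lemma stiffness_block_form:
  assumes xs: "set xs \<subseteq> dofs" and ys: "set ys \<subseteq> dofs"
    and x: "x \<in> carrier_vec (length xs)" and y: "y \<in> carrier_vec (length ys)"
  shows "scalar_prod x (stiffness_block P xs ys *\<^sub>v y) = broken_form P (dof_combination xs x) (dof_combination ys y)"
proof -
  have "broken_form P (dof_combination xs x) (dof_combination ys y)
      = (\<Sum>i<length xs. vec_index x i * broken_form P (nodal_basis P (xs ! i)) (dof_combination ys y))"
    unfolding dof_combination_def[of xs] using nodal_basis_nth[OF xs] dof_combination_in_Xc[OF ys] by (intro broken_form_sum_left) simp_all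
  also have "\<dots> = (\<Sum>i<length xs. vec_index x i * (\<Sum>k<length ys. vec_index y k * broken_form P (nodal_basis P (xs ! i)) (nodal_basis P (ys ! k))))"
  proof (rule sum.cong[OF refl])
    fix i assume "i \<in> {..<length xs}"
    then have "nodal_basis P (xs ! i) \<in> Xc_space P" using nodal_basis_nth[OF xs] by simp
    then show "vec_index x i * broken_form P (nodal_basis P (xs ! i)) (dof_combination ys y)
      = vec_index x i * (\<Sum>k<length ys. vec_index y k * broken_form P (nodal_basis P (xs ! i)) (nodal_basis P (ys ! k)))"
      unfolding dof_combination_def using nodal_basis_nth[OF ys] by (subst broken_form_sum_right) simp_all
  qed
  also have "\<dots> = scalar_prod x (stiffness_block P xs ys *\<^sub>v y)"
    using x y unfolding scalar_prod_def stiffness_block_def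
    by (auto simp: atLeast0LessThan scalar_prod_def mult.commute intro!: sum.cong)
  finally show ?thesis by simp
qed

lemma stiffness_block_carrier: "stiffness_block P xs ys \<in> carrier_mat (length xs) (length ys)"
  unfolding stiffness_block_def by simp

lemma stiffness_block_transpose:
  assumes "set xs \<subseteq> dofs" "set ys \<subseteq> dofs"
  shows "transpose_mat (stiffness_block P xs ys) = stiffness_block P ys xs"
proof (rule eq_matI)
  fix i j assume "i < dim_row (stiffness_block P ys xs)" "j < dim_col (stiffness_block P ys xs)"
  then have ij: "i < length ys" "j < length xs" unfolding stiffness_block_def by auto
  have "nodal_basis P (ys ! i) \<in> Xc_space P" "nodal_basis P (xs ! j) \<in> Xc_space P"
    by (rule nodal_basis_nth[OF assms(2) ij(1)], rule nodal_basis_nth[OF assms(1) ij(2)])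
  then have "broken_form P (nodal_basis P (xs ! j)) (nodal_basis P (ys ! i)) = broken_form P (nodal_basis P (ys ! i)) (nodal_basis P (xs ! j))"
    by (rule broken_form_commute[OF _ , rotated])
  then show "transpose_mat (stiffness_block P xs ys) $$ (i, j) = stiffness_block P ys xs $$ (i, j)"
    using ij unfolding stiffness_block_def by simp
qed (auto simp: stiffness_block_def)

lemma zero_energy_at_vertices:
  assumes "v \<in> Xc_space P" "broken_form P v v = 0" "j < n" "q \<in> mesh_vertices (mesh j)"
  shows "v j q = 0"
proof (rule zero_energy_imp_zero[OF assms(1-3)])
  show "q \<in> closure (sub j)"
    using assms(4) mesh_covers[OF assms(3)] unfolding mesh_vertices_def extreme_point_of_def by auto
qed

lemma stiffness_pd:
  assumes xs: "set xs \<subseteq> dofs" "distinct xs"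
  shows "pd_mat (length xs) (stiffness_block P xs xs)"
proof -
  have "x = 0\<^sub>v (length xs)" if x: "x \<in> carrier_vec (length xs)" "scalar_prod x (stiffness_block P xs xs *\<^sub>v x) = 0" for x
  proof (rule dof_combination_eq_zero[OF xs x(1)])
    show "dof_combination xs x j q = 0" if "j < n" "q \<in> mesh_vertices (mesh j)" for j q
      using zero_energy_at_vertices[OF dof_combination_in_Xc[OF xs(1)] _ that] x(2) stiffness_block_form[OF xs(1) xs(1) x(1) x(1)] by simp
  qed
  then show ?thesis
    unfolding pd_mat_def psd_mat_def
    using stiffness_block_carrier stiffness_block_transpose[OF xs(1) xs(1)] stiffness_block_form[OF xs(1) xs(1)]
      broken_form_nonneg[OF dof_combination_in_Xc[OF xs(1)]] by simp
qed

lemma broken_form_diff: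
  assumes u: "u \<in> Xc_space P" and v: "v \<in> Xc_space P"
  shows "(\<lambda>j x. u j x - v j x) \<in> Xc_space P"
    and "broken_form P (\<lambda>j x. u j x - v j x) (\<lambda>j x. u j x - v j x)
       = broken_form P u u - 2 * broken_form P u v + broken_form P v v"
proof -
  define \<phi> where "\<phi> i = (if i = (0::nat) then u else v)" for i
  define w where "w i = (if i = (0::nat) then 1 else (- 1::real))" for i
  have eq: "(\<lambda>j x. \<Sum>i\<in>{0,1}. w i * \<phi> i j x) = (\<lambda>j x. u j x - v j x)" unfolding \<phi>_def w_def by auto
  have \<phi>: "\<phi> i \<in> Xc_space P" if "i \<in> {0,1}" for i using u v unfolding \<phi>_def by simp
  show X: "(\<lambda>j x. u j x - v j x) \<in> Xc_space P" using Xc_space_sum[where I = "{0,1}" and \<phi> = \<phi> and w = w, OF \<phi>] unfolding eq by simp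
  have l: "broken_form P (\<lambda>j x. u j x - v j x) z = broken_form P u z - broken_form P v z" if "z \<in> Xc_space P" for z
    using broken_form_sum_left[where I = "{0,1}" and \<phi> = \<phi> and v = z and w = w, OF \<phi> that] unfolding eq by (simp add: \<phi>_def w_def)
  have r: "broken_form P z (\<lambda>j x. u j x - v j x) = broken_form P z u - broken_form P z v" if "z \<in> Xc_space P" for z
    using broken_form_sum_right[where I = "{0,1}" and \<phi> = \<phi> and v = z and w = w, OF \<phi> that] unfolding eq by (simp add: \<phi>_def w_def)
  show "broken_form P (\<lambda>j x. u j x - v j x) (\<lambda>j x. u j x - v j x)
       = broken_form P u u - 2 * broken_form P u v + broken_form P v v"
    unfolding l[OF X] r[OF u] r[OF v] using broken_form_commute[OF u v] by simp
qed

abbreviation "S \<equiv> schur_matrix P rs ds"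

lemma ds_nth:
  assumes "i < length ds"
  shows "\<exists>j p. ds ! i = Local j p"
proof -
  have "ds ! i \<in> dual_dofs P" using nth_mem[OF assms] unfolding ds(2) .
  then show ?thesis unfolding dual_dofs_def by auto
qed

lemma dual_dof_location:
  assumes i: "i < length ds" and d: "ds ! i = Local j p"
  shows "j < n" "p \<in> mesh_vertices (mesh j)" "\<And>b. b \<in> dofs \<Longrightarrow> carries b j p \<longleftrightarrow> b = ds ! i"
proof -
  have L: "Local j p \<in> dual_dofs P" using nth_mem[OF i] unfolding d ds(2) .
  then have Ld: "Local j p \<in> dofs" unfolding dofs_def by simp
  show "j < n" "p \<in> mesh_vertices (mesh j)" using local_dof_not_corner[OF Ld] by auto
  show "carries b j p \<longleftrightarrow> b = ds ! i" if "b \<in> dofs" for b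
  proof (cases b)
    case (Corner q)
    then have "q \<noteq> p" using corner_dof[of q] that local_dof_not_corner(3)[OF Ld] by auto
    then show ?thesis using Corner d by simp
  qed (simp add: d)
qed

text \<open>The function \<open>w\<close> is the discrete harmonic extension of \<open>u\<close>: the interior and corner part is chosen as
  \<open>- A\<^sub>r\<^sub>r\<inverse> A\<^sub>r\<^sub>d u\<close>, which does not affect the dual values. Taking it to be zero instead can only increase the
  energy.\<close>

lemma schur_energy:
  assumes u: "u \<in> carrier_vec (length ds)"
  shows "\<exists>w. w \<in> Xc_space P \<and> scalar_prod u (S *\<^sub>v u) = broken_form P w w \<and>
      (\<forall>i j p. i < length ds \<longrightarrow> ds ! i = Local j p \<longrightarrow> w j p = vec_index u i)"
    and "scalar_prod u (S *\<^sub>v u) \<le> broken_form P (dof_combination ds u) (dof_combination ds u)"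
proof -
  let ?r = "length rs" and ?d = "length ds"
  define Arr where "Arr = stiffness_block P rs rs"
  define Adr where "Adr = stiffness_block P ds rs"
  define Ard where "Ard = stiffness_block P rs ds"
  define Add where "Add = stiffness_block P ds ds"
  note blocks = Arr_def Adr_def Ard_def Add_def
  have car: "Arr \<in> carrier_mat ?r ?r" "Adr \<in> carrier_mat ?d ?r" "Ard \<in> carrier_mat ?r ?d" "Add \<in> carrier_mat ?d ?d"
    unfolding blocks by (rule stiffness_block_carrier)+
  have pd: "pd_mat ?r Arr" unfolding Arr_def by (rule stiffness_pd[OF rs_dofs rs(1)])
  note Ai = pd_mat_inv(1)[OF pd]
  define q where "q = Ard *\<^sub>v u"
  define r where "r = mat_inv Arr *\<^sub>v q"
  have q: "q \<in> carrier_vec ?r" unfolding q_def using car u by simp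
  have r: "r \<in> carrier_vec ?r" "Arr *\<^sub>v r = q" unfolding r_def using pd_mat_inv_mult_vec[OF pd q] by auto
  have Su: "S *\<^sub>v u = Add *\<^sub>v u - Adr *\<^sub>v r"
  proof -
    have m0: "Adr * mat_inv Arr \<in> carrier_mat ?d ?r" by (rule mult_carrier_mat[OF car(2) Ai])
    have m1: "Adr * mat_inv Arr * Ard \<in> carrier_mat ?d ?d" by (rule mult_carrier_mat[OF m0 car(3)])
    have "Adr * mat_inv Arr * Ard *\<^sub>v u = (Adr * mat_inv Arr) *\<^sub>v q"
      unfolding q_def by (rule assoc_mult_mat_vec[OF m0 car(3) u])
    also have "\<dots> = Adr *\<^sub>v r" unfolding r_def by (rule assoc_mult_mat_vec[OF car(2) Ai q])
    finally have "Adr * mat_inv Arr * Ard *\<^sub>v u = Adr *\<^sub>v r" .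
    then show ?thesis using minus_mult_distrib_mat_vec[OF car(4) m1 u]
      unfolding schur_matrix_def blocks[symmetric] by (simp only:)
  qed
  let ?f = "dof_combination ds u" and ?g = "dof_combination rs r"
  have f: "?f \<in> Xc_space P" by (rule dof_combination_in_Xc[OF ds_dofs])
  have g: "?g \<in> Xc_space P" by (rule dof_combination_in_Xc[OF rs_dofs])
  have ff: "scalar_prod u (Add *\<^sub>v u) = broken_form P ?f ?f" unfolding Add_def by (rule stiffness_block_form[OF ds_dofs ds_dofs u u])
  have fg: "scalar_prod u (Adr *\<^sub>v r) = broken_form P ?f ?g" unfolding Adr_def by (rule stiffness_block_form[OF ds_dofs rs_dofs u r(1)])
  have gg: "broken_form P ?g ?g = broken_form P ?f ?g"
  proof -
    have "broken_form P ?g ?g = scalar_prod r q" using stiffness_block_form[OF rs_dofs rs_dofs r(1) r(1)] r(2) unfolding Arr_def by simp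
    also have "\<dots> = broken_form P ?g ?f" unfolding q_def Ard_def by (rule stiffness_block_form[OF rs_dofs ds_dofs r(1) u])
    finally show ?thesis using broken_form_commute[OF f g] by simp
  qed
  have uS: "scalar_prod u (S *\<^sub>v u) = broken_form P ?f ?f - broken_form P ?f ?g"
  proof -
    have "Add *\<^sub>v u \<in> carrier_vec ?d" "Adr *\<^sub>v r \<in> carrier_vec ?d" using car u r by auto
    then show ?thesis unfolding Su using u by (simp add: scalar_prod_minus_distrib[of _ ?d] ff fg)
  qed
  define w where "w = (\<lambda>j x. ?f j x - ?g j x)"
  have w: "w \<in> Xc_space P" "broken_form P w w = broken_form P ?f ?f - 2 * broken_form P ?f ?g + broken_form P ?g ?g"
    unfolding w_def using broken_form_diff[OF f g] by auto
  show "scalar_prod u (S *\<^sub>v u) \<le> broken_form P ?f ?f" using uS gg broken_form_nonneg[OF g] by simp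
  have wu: "w j p = vec_index u i" if i: "i < ?d" "ds ! i = Local j p" for i j p
  proof -
    note loc = dual_dof_location[OF i]
    have "?f j p = vec_index u i" by (rule dof_combination_at_location[OF ds_dofs ds(1) i(1) loc])
    moreover have "?g j p = 0"
    proof -
      have "\<not> carries (rs ! k) j p" if kr: "k < ?r" for k
      proof -
        have k: "rs ! k \<in> set rs" and "ds ! i \<in> set ds" using kr i(1) by simp_all
        then have "rs ! k \<noteq> ds ! i" using rs_ds_disjoint by (metis disjoint_iff)
        moreover have "rs ! k \<in> dofs" using k rs_dofs by (rule subsetD[rotated])
        ultimately show ?thesis using loc(3) by simp
      qed
      then show ?thesis unfolding dof_combination_at_vertex[OF rs_dofs loc(1,2)] by (intro sum.neutral) auto
    qed
    ultimately show "w j p = vec_index u i" unfolding w_def by simp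
  qed
  have en: "scalar_prod u (S *\<^sub>v u) = broken_form P w w" unfolding w(2) uS gg by simp
  show "\<exists>w. w \<in> Xc_space P \<and> scalar_prod u (S *\<^sub>v u) = broken_form P w w \<and>
      (\<forall>i j p. i < length ds \<longrightarrow> ds ! i = Local j p \<longrightarrow> w j p = vec_index u i)"
    by (intro exI[of _ w] conjI allI impI w(1) en wu)
qed

lemma schur_carrier: "S \<in> carrier_mat (length ds) (length ds)"
proof -
  have "stiffness_block P ds rs * mat_inv (stiffness_block P rs rs) * stiffness_block P rs ds
      \<in> carrier_mat (length ds) (length ds)"
    using stiffness_block_carrier[of ds rs] pd_mat_inv(1)[OF stiffness_pd[OF rs_dofs rs(1)]]
      stiffness_block_carrier[of rs ds] by (metis mult_carrier_mat)
  then show ?thesis unfolding schur_matrix_def by (rule minus_carrier_mat)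
qed

lemma schur_symmetric: "transpose_mat S = S"
proof -
  let ?r = "length rs" and ?d = "length ds"
  define Arr where "Arr = stiffness_block P rs rs"
  define Adr where "Adr = stiffness_block P ds rs"
  define Ard where "Ard = stiffness_block P rs ds"
  define Add where "Add = stiffness_block P ds ds"
  note blocks = Arr_def Adr_def Ard_def Add_def
  have car: "Arr \<in> carrier_mat ?r ?r" "Adr \<in> carrier_mat ?d ?r" "Ard \<in> carrier_mat ?r ?d" "Add \<in> carrier_mat ?d ?d"
    unfolding blocks by (rule stiffness_block_carrier)+
  have tr: "transpose_mat Adr = Ard" "transpose_mat Ard = Adr" "transpose_mat Add = Add"
    unfolding blocks using stiffness_block_transpose rs_dofs ds_dofs by auto
  have pd: "pd_mat ?r Arr" unfolding Arr_def by (rule stiffness_pd[OF rs_dofs rs(1)])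
  note Ai = pd_mat_inv(1,4)[OF pd]
  have "transpose_mat (Adr * mat_inv Arr * Ard) = transpose_mat Ard * transpose_mat (Adr * mat_inv Arr)"
    by (rule transpose_mult[OF mult_carrier_mat[OF car(2) Ai(1)] car(3)])
  also have "transpose_mat (Adr * mat_inv Arr) = mat_inv Arr * Ard"
    using transpose_mult[OF car(2) Ai(1)] Ai(2) tr by simp
  also have "transpose_mat Ard * (mat_inv Arr * Ard) = Adr * mat_inv Arr * Ard"
    unfolding tr by (rule assoc_mult_mat[OF car(2) Ai(1) car(3), symmetric])
  finally have t: "transpose_mat (Adr * mat_inv Arr * Ard) = Adr * mat_inv Arr * Ard" .
  have "Adr * mat_inv Arr * Ard \<in> carrier_mat ?d ?d" by (rule mult_carrier_mat[OF mult_carrier_mat[OF car(2) Ai(1)] car(3)])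
  then show ?thesis
    unfolding schur_matrix_def blocks[symmetric] using transpose_minus[OF car(4)] t tr(3) by metis
qed

lemma schur_pd: "pd_mat (length ds) S"
proof -
  have nonneg: "0 \<le> scalar_prod u (S *\<^sub>v u)" if u: "u \<in> carrier_vec (length ds)" for u
  proof -
    obtain w where "w \<in> Xc_space P" "scalar_prod u (S *\<^sub>v u) = broken_form P w w"
      using schur_energy(1)[OF u] by (elim exE conjE)
    then show ?thesis using broken_form_nonneg by simp
  qed
  have zero: "u = 0\<^sub>v (length ds)" if u: "u \<in> carrier_vec (length ds)" and 0: "scalar_prod u (S *\<^sub>v u) = 0" for u
  proof -
    obtain w where w: "w \<in> Xc_space P" "scalar_prod u (S *\<^sub>v u) = broken_form P w w"
      "\<forall>i j p. i < length ds \<longrightarrow> ds ! i = Local j p \<longrightarrow> w j p = vec_index u i"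
      using schur_energy(1)[OF u] by (elim exE conjE)
    show ?thesis
    proof (rule eq_vecI)
      fix i assume "i < dim_vec (0\<^sub>v (length ds) :: real Matrix.vec)"
      then have i: "i < length ds" by simp
      obtain j p where d: "ds ! i = Local j p" using ds_nth[OF i] by blast
      have "w j p = 0"
        using zero_energy_at_vertices[OF w(1) _ dual_dof_location(1,2)[OF i d]] w(2) 0 by simp
      then show "vec_index u i = vec_index (0\<^sub>v (length ds)) i" using w(3) d i by simp
    qed (use u in simp)
  qed
  show ?thesis unfolding pd_mat_def psd_mat_def
    by (intro conjI ballI impI schur_carrier schur_symmetric nonneg zero)
qed

lemma js_subset: "set js \<subseteq> interface_jumps P"
  using js(2) unfolding jump_constraints_def by (rule conjunct1)

lemma js_nth: "i < length js \<Longrightarrow> js ! i = e \<Longrightarrow> e \<in> interface_jumps P"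
  using js_subset nth_mem by blast

lemma sum_over_ds: "(\<Sum>i<length ds. f (ds ! i)) = (\<Sum>a\<in>dual_dofs P. f a)"
  using sum.reindex_bij_betw[OF bij_betw_nth[OF ds(1) refl refl], of f] ds(2) by simp

lemma sum_over_js: "(\<Sum>i<length js. f (js ! i)) = (\<Sum>e\<in>set js. f e)"
  using sum.reindex_bij_betw[OF bij_betw_nth[OF js(1) refl refl], of f] by simp

abbreviation "B \<equiv> jump_matrix js ds"

lemma B_carrier: "B \<in> carrier_mat (length js) (length ds)"
  unfolding jump_matrix_def by simp

lemma B_mult:
  assumes u: "u \<in> carrier_vec (length ds)"
    and W: "\<And>i j p. i < length ds \<Longrightarrow> ds ! i = Local j p \<Longrightarrow> W j p = vec_index u i"
    and i: "i < length js" and e: "js ! i = (j, k, p)"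
  shows "vec_index (B *\<^sub>v u) i = W j p - W k p"
proof -
  have "(j, k, p) \<in> interface_jumps P"
    using js_nth[OF i e] .
  note J = interface_jump[OF this]
  have "Local j p \<in> set ds" using J(6) by (simp only: ds(2))
  then obtain a where a: "a < length ds" "ds ! a = Local j p" unfolding in_set_conv_nth by auto
  have "Local k p \<in> set ds" using J(7) by (simp only: ds(2))
  then obtain b where b: "b < length ds" "ds ! b = Local k p" unfolding in_set_conv_nth by auto
  have ab: "a \<noteq> b" using a b J(1) by auto
  have ja: "ds ! c = Local j p \<longleftrightarrow> c = a" if "c < length ds" for c
    using a nth_eq_iff_index_eq[OF ds(1) that a(1)] by auto
  have kb: "ds ! c = Local k p \<longleftrightarrow> c = b" if "c < length ds" for c
    using b nth_eq_iff_index_eq[OF ds(1) that b(1)] by auto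
  have "vec_index (B *\<^sub>v u) i = (\<Sum>c<length ds. (if ds ! c = Local j p then 1 else if ds ! c = Local k p then - 1 else 0) * vec_index u c)"
    using u i e unfolding jump_matrix_def scalar_prod_def by (auto simp: scalar_prod_def atLeast0LessThan intro!: sum.cong)
  also have "\<dots> = (\<Sum>c<length ds. (if c = a then vec_index u a else 0) - (if c = b then vec_index u b else 0))"
    using ja kb ab by (intro sum.cong) auto
  also have "\<dots> = vec_index u a - vec_index u b" using a b by (simp add: sum_subtractf)
  finally show ?thesis using W[OF a] W[OF b] by simp
qed

lemma B_norm:
  assumes u: "u \<in> carrier_vec (length ds)"
    and W: "\<And>i j p. i < length ds \<Longrightarrow> ds ! i = Local j p \<Longrightarrow> W j p = vec_index u i"
  shows "scalar_prod (B *\<^sub>v u) (B *\<^sub>v u) = (\<Sum>(j, k, p)\<in>set js. (W j p - W k p)\<^sup>2)"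
proof -
  have "scalar_prod (B *\<^sub>v u) (B *\<^sub>v u) = (\<Sum>i<length js. (vec_index (B *\<^sub>v u) i)\<^sup>2)"
    unfolding scalar_prod_def using B_carrier u by (simp add: atLeast0LessThan power2_eq_square)
  also have "\<dots> = (\<Sum>i<length js. case js ! i of (j, k, p) \<Rightarrow> (W j p - W k p)\<^sup>2)"
    using B_mult[OF u W] by (intro sum.cong refl) (auto split: prod.split)
  also have "\<dots> = (\<Sum>(j, k, p)\<in>set js. (W j p - W k p)\<^sup>2)" by (rule sum_over_js)
  finally show ?thesis .
qed

lemma B_upper:
  assumes u: "u \<in> carrier_vec (length ds)"
  shows "scalar_prod (B *\<^sub>v u) (B *\<^sub>v u)
    \<le> jump_const DIM('a) (\<sigma> * \<tau>) M * C_upper DIM('a) H h * scalar_prod u (S *\<^sub>v u)"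
proof -
  obtain w where w: "w \<in> Xc_space P" "scalar_prod u (S *\<^sub>v u) = broken_form P w w"
    "\<forall>i j p. i < length ds \<longrightarrow> ds ! i = Local j p \<longrightarrow> w j p = vec_index u i"
    using schur_energy(1)[OF u] by (elim exE conjE)
  have "scalar_prod (B *\<^sub>v u) (B *\<^sub>v u) = (\<Sum>(j, k, p)\<in>set js. (w j p - w k p)\<^sup>2)"
    by (rule B_norm[OF u]) (use w(3) in blast)
  also have "\<dots> \<le> (\<Sum>(j, k, p)\<in>interface_jumps P. (w j p - w k p)\<^sup>2)"
    by (rule sum_mono2[OF finite_interface_jumps js_subset]) (simp split: prod.split)
  also have "\<dots> \<le> jump_const DIM('a) (\<sigma> * \<tau>) M * C_upper DIM('a) H h * broken_form P w w"
    by (rule jump_energy_bound[OF w(1)])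
  finally show ?thesis unfolding w(2) .
qed

lemma S_upper:
  assumes u: "u \<in> carrier_vec (length ds)"
  shows "scalar_prod u (S *\<^sub>v u) \<le> inverse_const DIM('a) (\<sigma> * \<tau>) * h ^ (DIM('a) - 2) * scalar_prod u u"
proof -
  let ?v = "dof_combination ds u"
  define A where "A = inverse_const DIM('a) (\<sigma> * \<tau>) * h ^ (DIM('a) - 2)"
  have A0: "0 \<le> A" unfolding A_def inverse_const_def using regularity_pos h by simp
  have X: "?v \<in> Xc_space P" by (rule dof_combination_in_Xc[OF ds_dofs])
  have "scalar_prod u (S *\<^sub>v u) \<le> broken_form P ?v ?v" by (rule schur_energy(2)[OF u])
  also have "\<dots> \<le> (\<Sum>j<n. A * (\<Sum>c\<in>mesh_vertices (mesh j). (?v j c)\<^sup>2))"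
    unfolding broken_form_energy[OF X] A_def using inverse_estimate Xc_P1[OF X] by (intro sum_mono) auto
  also have "\<dots> = A * (\<Sum>j<n. \<Sum>c\<in>mesh_vertices (mesh j). (?v j c)\<^sup>2)" by (simp add: sum_distrib_left)
  also have "\<dots> \<le> A * scalar_prod u u"
  proof (rule mult_left_mono[OF _ A0])
    let ?Z = "Sigma {..<n} (\<lambda>j. mesh_vertices (mesh j))"
    have fZ: "finite ?Z" using finite_mesh_vertices by auto
    define loc where "loc i = (case ds ! i of Local j p \<Rightarrow> (j, p) | Corner p \<Rightarrow> (0, p))" for i
    have inj: "inj_on loc {..<length ds}"
    proof (rule inj_onI)
      fix i k assume ik: "i \<in> {..<length ds}" "k \<in> {..<length ds}" "loc i = loc k"
      obtain j p j' p' where "ds ! i = Local j p" "ds ! k = Local j' p'" using ds_nth ik(1,2) by (meson lessThan_iff)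
      then have "ds ! i = ds ! k" using ik(3) unfolding loc_def by simp
      then show "i = k" using nth_eq_iff_index_eq[OF ds(1)] ik(1,2) by simp
    qed
    have locZ: "loc ` {..<length ds} \<subseteq> ?Z"
    proof
      fix z assume "z \<in> loc ` {..<length ds}"
      then obtain i where i: "i < length ds" "z = loc i" by auto
      obtain j p where d: "ds ! i = Local j p" using ds_nth[OF i(1)] by blast
      then show "z \<in> ?Z" using dual_dof_location(1,2)[OF i(1) d] i(2) unfolding loc_def by simp
    qed
    have off: "?v j c = 0" if "(j, c) \<in> ?Z - loc ` {..<length ds}" for j c
    proof -
      have jc: "j < n" "c \<in> mesh_vertices (mesh j)" using that by auto
      have "\<not> carries (ds ! i) j c" if i: "i < length ds" for i
      proof
        assume c: "carries (ds ! i) j c"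
        obtain j' p where "ds ! i = Local j' p" using ds_nth[OF i] by blast
        then have "loc i = (j, c)" using c unfolding loc_def by simp
        then show False using \<open>(j, c) \<in> ?Z - loc ` {..<length ds}\<close> i by force
      qed
      then show ?thesis unfolding dof_combination_at_vertex[OF ds_dofs jc] by (intro sum.neutral) auto
    qed
    have "(\<Sum>j<n. \<Sum>c\<in>mesh_vertices (mesh j). (?v j c)\<^sup>2) = (\<Sum>(j, c)\<in>?Z. (?v j c)\<^sup>2)"
      using finite_mesh_vertices by (intro sum.Sigma) auto
    also have "\<dots> = (\<Sum>(j, c)\<in>loc ` {..<length ds}. (?v j c)\<^sup>2)"
      using off locZ fZ by (intro sum.mono_neutral_right) auto
    also have "\<dots> = (\<Sum>i<length ds. (?v (fst (loc i)) (snd (loc i)))\<^sup>2)"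
      using inj by (simp add: sum.reindex case_prod_beta)
    also have "\<dots> = (\<Sum>i<length ds. (vec_index u i)\<^sup>2)"
    proof (rule sum.cong[OF refl])
      fix i assume "i \<in> {..<length ds}"
      then have i: "i < length ds" by simp
      obtain j p where d: "ds ! i = Local j p" using ds_nth[OF i] by blast
      have "?v j p = vec_index u i" by (rule dof_combination_at_location[OF ds_dofs ds(1) i dual_dof_location[OF i d]])
      then show "(?v (fst (loc i)) (snd (loc i)))\<^sup>2 = (vec_index u i)\<^sup>2" unfolding loc_def d by simp
    qed
    also have "\<dots> = scalar_prod u u"
      unfolding scalar_prod_def using u by (simp add: atLeast0LessThan power2_eq_square)
    finally show "(\<Sum>j<n. \<Sum>c\<in>mesh_vertices (mesh j). (?v j c)\<^sup>2) \<le> scalar_prod u u" by simp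
  qed
  finally show ?thesis unfolding A_def .
qed

text \<open>Write \<open>l = B w\<close>. Replacing \<open>w\<close> by its values \<open>w'\<close> relative to the reference subdomains keeps \<open>B w\<close>, and the
  length of \<open>w'\<close> is bounded by that of \<open>l\<close>. Now \<open>l \<bullet> l = (B\<^sup>T l) \<bullet> w'\<close> and Cauchy-Schwarz give the claim.\<close>

lemma Bt_lower:
  assumes l: "l \<in> multipliers js ds"
  shows "scalar_prod l l \<le> ((\<sigma> * \<tau>) ^ DIM('a)) ^ 3 * scalar_prod (transpose_mat B *\<^sub>v l) (transpose_mat B *\<^sub>v l)"
proof -
  define D where "D = ((\<sigma> * \<tau>) ^ DIM('a)) ^ 3"
  have D0: "0 \<le> D" unfolding D_def using regularity_pos by simp
  obtain w where w: "w \<in> carrier_vec (length ds)" "l = B *\<^sub>v w" using l unfolding multipliers_def by auto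
  define W where "W j p = (\<Sum>i<length ds. if ds ! i = Local j p then vec_index w i else 0)" for j p
  have W: "W j p = vec_index w i" if i: "i < length ds" "ds ! i = Local j p" for i j p
  proof -
    have "W j p = (\<Sum>k<length ds. if k = i then vec_index w i else 0)"
      unfolding W_def i(2)[symmetric] using nth_eq_iff_index_eq[OF ds(1) _ i(1)] by (intro sum.cong) auto
    then show ?thesis using i by simp
  qed
  define g where "g a = (case a of Local j p \<Rightarrow> W j p - W (reference_subdomain p) p | Corner p \<Rightarrow> 0)" for a
  define w' where "w' = Matrix.vec (length ds) (\<lambda>i. g (ds ! i))"
  have w': "w' \<in> carrier_vec (length ds)" unfolding w'_def by simp
  have lc: "l \<in> carrier_vec (length js)" using w B_carrier by simp
  have ll: "scalar_prod l l = (\<Sum>(j, k, p)\<in>set js. (W j p - W k p)\<^sup>2)"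
    unfolding w(2) by (rule B_norm[OF w(1) W])
  have "B *\<^sub>v w' = l"
  proof (rule eq_vecI)
    show "dim_vec (B *\<^sub>v w') = dim_vec l" using lc B_carrier w' by simp
    fix i assume "i < dim_vec l"
    then have i: "i < length js" using lc by simp
    obtain j k p where e: "js ! i = (j, k, p)" by (cases "js ! i") auto
    have "vec_index (B *\<^sub>v w') i = (W j p - W (reference_subdomain p) p) - (W k p - W (reference_subdomain p) p)"
      by (rule B_mult[OF w' _ i e, where W = "\<lambda>j p. W j p - W (reference_subdomain p) p"]) (simp add: w'_def g_def)
    also have "\<dots> = vec_index l i" unfolding w(2) using B_mult[OF w(1) W i e] by simp
    finally show "vec_index (B *\<^sub>v w') i = vec_index l i" .
  qed
  then have eq: "scalar_prod l l = scalar_prod (transpose_mat B *\<^sub>v l) w'"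
    using transpose_vec_mult_scalar[OF B_carrier w' lc] by simp
  have ww: "scalar_prod w' w' \<le> D * scalar_prod l l"
  proof -
    have "scalar_prod w' w' = (\<Sum>i<length ds. (g (ds ! i))\<^sup>2)"
      unfolding scalar_prod_def w'_def by (simp add: atLeast0LessThan power2_eq_square)
    also have "\<dots> = (\<Sum>a\<in>dual_dofs P. (g a)\<^sup>2)" by (rule sum_over_ds)
    also have "\<dots> = (\<Sum>a\<in>dual_dofs P. case a of Local j p \<Rightarrow> (W j p - W (reference_subdomain p) p)\<^sup>2 | Corner p \<Rightarrow> 0)"
      unfolding g_def by (intro sum.cong) (auto split: dof.split)
    also have "\<dots> \<le> D * scalar_prod l l" unfolding D_def ll by (rule jump_graph_bound[OF js(2)])
    finally show ?thesis .
  qed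
  let ?m = "transpose_mat B *\<^sub>v l"
  have m: "?m \<in> carrier_vec (length ds)" using B_carrier lc by simp
  have "(scalar_prod l l)\<^sup>2 \<le> scalar_prod ?m ?m * scalar_prod w' w'"
    unfolding eq by (rule scalar_prod_Cauchy_Schwarz[OF m w'])
  also have "\<dots> \<le> scalar_prod ?m ?m * (D * scalar_prod l l)"
    using ww by (intro mult_left_mono scalar_prod_self_nonneg)
  finally have le: "scalar_prod l l * scalar_prod l l \<le> (D * scalar_prod ?m ?m) * scalar_prod l l"
    by (simp add: power2_eq_square mult_ac)
  show ?thesis
  proof (cases "scalar_prod l l = 0")
    case True
    then show ?thesis using D0 scalar_prod_self_nonneg[of ?m] unfolding D_def by simp
  next
    case False
    then have "0 < scalar_prod l l" using scalar_prod_self_nonneg[of l] by simp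
    then show ?thesis using le unfolding D_def by simp
  qed
qed

lemma multipliers_nontrivial:
  assumes "js \<noteq> []"
  shows "multipliers js ds \<noteq> {0\<^sub>v (length js)}"
proof -
  have i: "0 < length js" using assms by simp
  obtain j k p where e: "js ! 0 = (j, k, p)" by (cases "js ! 0") auto
  define W where "W j' p' = (if j' = j \<and> p' = p then 1 else (0::real))" for j' p'
  define u where "u = Matrix.vec (length ds) (\<lambda>i. case ds ! i of Local j p \<Rightarrow> W j p | Corner p \<Rightarrow> 0)"
  have u: "u \<in> carrier_vec (length ds)" unfolding u_def by simp
  have "(j, k, p) \<in> interface_jumps P"
    using js_nth[OF i e] .
  then have "j \<noteq> k" using interface_jump(1) by blast
  moreover have "vec_index (B *\<^sub>v u) 0 = W j p - W k p"
    by (rule B_mult[OF u _ i e]) (simp add: u_def)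
  ultimately have "vec_index (B *\<^sub>v u) 0 = 1" unfolding W_def by simp
  then have "B *\<^sub>v u \<noteq> 0\<^sub>v (length js)" using i by auto
  then show ?thesis using u unfolding multipliers_def by blast
qed

text \<open>The abstract bounds with \<open>K C_upper\<close> from the jump estimate and \<open>L / C_lower\<close> from the inverse inequality
  and the graph bound; \<open>C_lower\<close> is the reciprocal of \<open>h\<close> to the power \<open>DIM('a) - 2\<close>.\<close>

lemma fetidp_bounds:
  defines "K \<equiv> jump_const DIM('a) (\<sigma> * \<tau>) M" and "L \<equiv> ((\<sigma> * \<tau>) ^ DIM('a)) ^ 3 * inverse_const DIM('a) (\<sigma> * \<tau>)"
  shows "\<And>l. l \<in> multipliers js ds \<Longrightarrow> scalar_prod l (fetidp_matrix P rs ds js *\<^sub>v l) \<le> K * (C_upper DIM('a) H h * scalar_prod l l)"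
    and "\<And>l. l \<in> multipliers js ds \<Longrightarrow> C_lower DIM('a) h * scalar_prod l l \<le> L * scalar_prod l (fetidp_matrix P rs ds js *\<^sub>v l)"
    and "js \<noteq> [] \<Longrightarrow> condition_number_on (multipliers js ds) (fetidp_matrix P rs ds js) \<le> K * L * kappa_bound DIM('a) H h"
    and "0 \<le> K" "0 < L" "0 \<le> C_upper DIM('a) H h" "0 \<le> kappa_bound DIM('a) H h"
proof -
  let ?d = "DIM('a)"
  define D where "D = ((\<sigma> * \<tau>) ^ ?d) ^ 3"
  define c where "c = inverse_const ?d (\<sigma> * \<tau>) * h ^ (?d - 2)"
  have s: "0 < \<sigma> * \<tau>" using regularity_pos by simp
  have pc: "0 \<le> pointwise_const ?d (\<sigma> * \<tau>)" "0 \<le> node_const ?d (\<sigma> * \<tau>)" "0 < inverse_const ?d (\<sigma> * \<tau>)"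
    unfolding pointwise_const_def node_const_def inverse_const_def using s by auto
  show K0: "0 \<le> K" unfolding K_def jump_const_def using pc s by simp
  show "0 < L" unfolding L_def using pc s by simp
  show C0: "0 \<le> C_upper ?d H h" unfolding C_upper_eq using log_factor_pos h by simp
  have kb: "kappa_bound ?d H h = C_upper ?d H h * h ^ (?d - 2)"
    unfolding kappa_bound_def C_upper_def using dim h by auto
  then show "0 \<le> kappa_bound ?d H h" using C0 h by simp
  have D: "0 < D" unfolding D_def using s by simp
  have c: "0 < c" unfolding c_def using pc h by simp
  have KC: "0 \<le> K * C_upper ?d H h" using K0 C0 by simp
  have F: "fetidp_matrix P rs ds js = B * mat_inv S * transpose_mat B" unfolding fetidp_matrix_def ..
  note main = dual_operator_bounds[OF schur_pd B_carrier F multipliers_def KC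
      B_upper[folded K_def] c S_upper[folded c_def] D Bt_lower[folded D_def]]
  show "scalar_prod l (fetidp_matrix P rs ds js *\<^sub>v l) \<le> K * (C_upper ?d H h * scalar_prod l l)"
    if l: "l \<in> multipliers js ds" for l
  proof -
    have "scalar_prod l (fetidp_matrix P rs ds js *\<^sub>v l) \<le> K * C_upper ?d H h * scalar_prod l l"
      by (rule main(1)[OF _ _ _ l])
    then show ?thesis by (simp only: mult.assoc)
  qed
  have hp: "C_lower ?d h * h ^ (?d - 2) = 1" "0 \<le> C_lower ?d h"
    unfolding C_lower_def using dim h by (auto simp: power_int_def)
  show "C_lower ?d h * scalar_prod l l \<le> L * scalar_prod l (fetidp_matrix P rs ds js *\<^sub>v l)"
    if l: "l \<in> multipliers js ds" for l
  proof -
    have "scalar_prod l l \<le> D * c * scalar_prod l (fetidp_matrix P rs ds js *\<^sub>v l)"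
      by (rule main(2)[OF _ _ _ l])
    then have "C_lower ?d h * scalar_prod l l \<le> C_lower ?d h * (D * c * scalar_prod l (fetidp_matrix P rs ds js *\<^sub>v l))"
      using hp(2) by (rule mult_left_mono)
    also have "\<dots> = (C_lower ?d h * h ^ (?d - 2)) * (L * scalar_prod l (fetidp_matrix P rs ds js *\<^sub>v l))"
      unfolding c_def L_def D_def by (simp add: mult_ac)
    finally show ?thesis unfolding hp by simp
  qed
  show "condition_number_on (multipliers js ds) (fetidp_matrix P rs ds js) \<le> K * L * kappa_bound ?d H h" if js: "js \<noteq> []"
  proof -
    have "condition_number_on (multipliers js ds) (fetidp_matrix P rs ds js) \<le> K * C_upper ?d H h * (D * c)"
      by (rule main(3)[OF _ _ _ multipliers_nontrivial[OF js]])
    also have "\<dots> = K * L * kappa_bound ?d H h" unfolding kb c_def L_def D_def by (simp add: mult_ac)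
    finally show ?thesis .
  qed
qed

end

section \<open>Spectral bounds and condition number\<close>

theorem proposition3:
  fixes \<Omega> :: "'a::euclidean_space set" and \<sigma> \<tau> :: real and M :: nat
  assumes "DIM('a) = 2 \<or> DIM('a) = 3" and "polyhedral_domain \<Omega>"
  shows "\<exists>C>0. \<forall>(P :: 'a decomposition) H h rs ds js.
           dom\<Omega> P = \<Omega> \<and> admissible_decomposition \<sigma> \<tau> M H h P \<and>
           distinct rs \<and> set rs = interior_dofs P \<union> corner_dofs P \<and>
           distinct ds \<and> set ds = dual_dofs P \<and>
           distinct js \<and> jump_constraints P (set js) \<longrightarrow>
           (\<forall>l\<in>multipliers js ds.
              C_lower DIM('a) h * scalar_prod l l
                \<le> C * scalar_prod l (fetidp_matrix P rs ds js *\<^sub>v l) \<and>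
              scalar_prod l (fetidp_matrix P rs ds js *\<^sub>v l)
                \<le> C * (C_upper DIM('a) H h * scalar_prod l l)) \<and>
           (js \<noteq> [] \<longrightarrow>
              condition_number_on (multipliers js ds) (fetidp_matrix P rs ds js)
                \<le> C * kappa_bound DIM('a) H h)"
proof -
  define K where "K = jump_const DIM('a) (\<sigma> * \<tau>) M"
  define L where "L = ((\<sigma> * \<tau>) ^ DIM('a)) ^ 3 * inverse_const DIM('a) (\<sigma> * \<tau>)"
  \<comment> \<open>Without an admissible decomposition \<open>K\<close> and \<open>L\<close> may be negative; the absolute values make \<open>C\<close> positive for all \<open>\<sigma>\<close> and \<open>\<tau>\<close>.\<close>
  define C where "C = 1 + \<bar>K\<bar> + \<bar>L\<bar> + \<bar>K * L\<bar>"
  have C: "C > 0" "K \<le> C" "L \<le> C" "K * L \<le> C" unfolding C_def by linarith+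
  show ?thesis
  proof (intro exI[of _ C] conjI C(1) allI impI)
    fix P :: "'a decomposition" and H h rs ds js
    assume *: "dom\<Omega> P = \<Omega> \<and> admissible_decomposition \<sigma> \<tau> M H h P \<and>
           distinct rs \<and> set rs = interior_dofs P \<union> corner_dofs P \<and>
           distinct ds \<and> set ds = dual_dofs P \<and>
           distinct js \<and> jump_constraints P (set js)"
    interpret fetidp_problem \<sigma> \<tau> M H h P rs ds js
      using * assms(1) by unfold_locales auto
    let ?F = "fetidp_matrix P rs ds js"
    note bounds = fetidp_bounds[folded K_def L_def]
    show "\<forall>l\<in>multipliers js ds. C_lower DIM('a) h * scalar_prod l l \<le> C * scalar_prod l (?F *\<^sub>v l) \<and>
              scalar_prod l (?F *\<^sub>v l) \<le> C * (C_upper DIM('a) H h * scalar_prod l l)"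
    proof
      fix l assume l: "l \<in> multipliers js ds"
      have "0 \<le> h" using h by simp
      then have "0 \<le> C_lower DIM('a) h * scalar_prod l l"
        unfolding C_lower_def by (intro mult_nonneg_nonneg scalar_prod_self_nonneg) simp
      then have "0 \<le> L * scalar_prod l (?F *\<^sub>v l)" using bounds(2)[OF l] by linarith
      show "C_lower DIM('a) h * scalar_prod l l \<le> C * scalar_prod l (?F *\<^sub>v l) \<and>
              scalar_prod l (?F *\<^sub>v l) \<le> C * (C_upper DIM('a) H h * scalar_prod l l)"
      proof
        have "0 \<le> scalar_prod l (?F *\<^sub>v l)"
          using \<open>0 \<le> L * scalar_prod l (?F *\<^sub>v l)\<close> bounds(5) by (simp add: zero_le_mult_iff)
        then have "L * scalar_prod l (?F *\<^sub>v l) \<le> C * scalar_prod l (?F *\<^sub>v l)" using C(3) by (intro mult_right_mono)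
        then show "C_lower DIM('a) h * scalar_prod l l \<le> C * scalar_prod l (?F *\<^sub>v l)" using bounds(2)[OF l] by linarith
        have "K * (C_upper DIM('a) H h * scalar_prod l l) \<le> C * (C_upper DIM('a) H h * scalar_prod l l)"
          using C(2) bounds(6) scalar_prod_self_nonneg[of l] by (intro mult_right_mono) auto
        then show "scalar_prod l (?F *\<^sub>v l) \<le> C * (C_upper DIM('a) H h * scalar_prod l l)" using bounds(1)[OF l] by linarith
      qed
    qed
    assume "js \<noteq> []"
    then have "condition_number_on (multipliers js ds) ?F \<le> K * L * kappa_bound DIM('a) H h" by (rule bounds(3))
    also have "\<dots> \<le> C * kappa_bound DIM('a) H h" using C(4) bounds(7) by (rule mult_right_mono)
    finally show "condition_number_on (multipliers js ds) ?F \<le> C * kappa_bound DIM('a) H h" .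
  qed
qed

end
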